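(* Let $\alpha,\beta,\gamma\in\mathbb{R}$ satisfy $\alpha>-\frac12$, $\gamma\in(-1,-\frac12)$ and $H:=\alpha+\beta+\gamma+\frac32>0$, and let $X=\{X(t),t\ge 0\}$ be the Gaussian Volterra process $X(t)=\int_0^t r^\alpha\left(\int_r^t u^\beta(u-r)^\gamma\,du\right)dW_r$. Then there exist constants $\kappa_1,\kappa_2\in(0,\infty)$ such that, for every $t>0$ and every $0<\varepsilon<t^H$, $$\exp\left(-\kappa_1\left(\frac{t^H}{\varepsilon}\right)^{\frac{2}{2\gamma+3}}\right)\le \mathbb{P}\left\{\sup_{s\in[0,t]}|X(s)|\le\varepsilon\right\}\le \exp\left(-\kappa_2\left(\frac{t^H}{\varepsilon}\right)^{\frac{2}{2\gamma+3}}\right).$$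
   Context: $W=\{W(t),t\ge0\}$ is a standard Brownian motion, the stochastic integral is a Wiener integral, and $X(0)=0$. Under the stated conditions on the parameters, $X$ is a well-defined centered Gaussian process, self-similar with index $H$; it is taken with continuous sample paths. *)

theory Defs
  imports "HOL-Probability.Probability"
begin

text \<open>
  Time is \<^typ>\<open>real\<close>, and only the restriction of a process to \<open>[0, \<infinity>)\<close> matters.
  The normalisation \<open>W(0) = 0\<close> and path continuity are only required almost surely.
\<close>

definition standard_brownian_motion :: "'a measure \<Rightarrow> (real \<Rightarrow> 'a \<Rightarrow> real) \<Rightarrow> bool" where
  "standard_brownian_motion M W \<longleftrightarrow>
     prob_space M \<and>
     (\<forall>t\<ge>0. W t \<in> borel_measurable M) \<and>
     (AE \<omega> in M. W 0 \<omega> = 0) \<and>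
     (AE \<omega> in M. continuous_on {0..} (\<lambda>t. W t \<omega>)) \<and>
     (\<forall>s t. 0 \<le> s \<and> s < t \<longrightarrow>
        distributed M lborel (\<lambda>\<omega>. W t \<omega> - W s \<omega>) (normal_density 0 (sqrt (t - s)))) \<and>
     (\<forall>(n::nat) (p::nat \<Rightarrow> real). 0 \<le> p 0 \<and> mono_on {..n} p \<longrightarrow>
        prob_space.indep_vars M (\<lambda>_. borel) (\<lambda>i \<omega>. W (p (Suc i)) \<omega> - W (p i) \<omega>) {..<n})"

definition step_function :: "nat \<Rightarrow> (nat \<Rightarrow> real) \<Rightarrow> (nat \<Rightarrow> real) \<Rightarrow> real \<Rightarrow> real" where
  "step_function n p c r = (\<Sum>i<n. c i * indicator {p i<..p (Suc i)} r)"

definition step_integral ::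
  "(real \<Rightarrow> 'a \<Rightarrow> real) \<Rightarrow> nat \<Rightarrow> (nat \<Rightarrow> real) \<Rightarrow> (nat \<Rightarrow> real) \<Rightarrow> 'a \<Rightarrow> real" where
  "step_integral W n p c \<omega> = (\<Sum>i<n. c i * (W (p (Suc i)) \<omega> - W (p i) \<omega>))"

text \<open>
  \<open>has_wiener_integral M W f T Y\<close>: the function \<open>f\<close> is in \<open>L\<^sup>2([0, T])\<close> and the random variable
  \<open>Y\<close> is a version of the Wiener integral of \<open>f\<close> over \<open>[0, T]\<close>, that is, the limit in \<open>L\<^sup>2(M)\<close>
  of the integrals of step functions converging to \<open>f\<close> in \<open>L\<^sup>2([0, T])\<close>. By the Ito isometry
  such a \<open>Y\<close> exists, is almost surely unique, and does not depend on the approximating sequence.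
  The \<open>L\<^sup>2\<close> distances are nonnegative integrals, since the Bochner integral of a
  non-integrable function would be \<open>0\<close>.
\<close>

definition has_wiener_integral ::
  "'a measure \<Rightarrow> (real \<Rightarrow> 'a \<Rightarrow> real) \<Rightarrow> (real \<Rightarrow> real) \<Rightarrow> real \<Rightarrow> ('a \<Rightarrow> real) \<Rightarrow> bool" where
  "has_wiener_integral M W f T Y \<longleftrightarrow>
     set_borel_measurable lborel {0..T} f \<and>
     set_integrable lborel {0..T} (\<lambda>r. (f r)\<^sup>2) \<and>
     Y \<in> borel_measurable M \<and>
     (\<exists>(n::nat \<Rightarrow> nat) (p::nat \<Rightarrow> nat \<Rightarrow> real) (c::nat \<Rightarrow> nat \<Rightarrow> real).
        (\<forall>k. mono_on {..n k} (p k) \<and> p k ` {..n k} \<subseteq> {0..T}) \<and>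
        (\<lambda>k. \<integral>\<^sup>+r\<in>{0..T}. ennreal ((f r - step_function (n k) (p k) (c k) r)\<^sup>2) \<partial>lborel)
          \<longlonglongrightarrow> 0 \<and>
        (\<lambda>k. \<integral>\<^sup>+\<omega>. ennreal ((Y \<omega> - step_integral W (n k) (p k) (c k) \<omega>)\<^sup>2) \<partial>M)
          \<longlonglongrightarrow> 0)"

text \<open>
  The value at \<open>r = 0\<close>, where \<open>0 powr \<alpha> = 0\<close>, is irrelevant: a single point is a null set.
\<close>

definition volterra_kernel :: "real \<Rightarrow> real \<Rightarrow> real \<Rightarrow> real \<Rightarrow> real \<Rightarrow> real" where
  "volterra_kernel \<alpha> \<beta> \<gamma> t r =
     r powr \<alpha> * (LBINT u:{r..t}. u powr \<beta> * (u - r) powr \<gamma>)"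

text \<open>
  Path continuity is required for every outcome, not just almost surely, so that the supremum of
  \<open>\<bar>X\<bar>\<close> over a compact interval is finite and measurable without completing \<open>M\<close>.
\<close>

definition gaussian_volterra_process ::
  "'a measure \<Rightarrow> (real \<Rightarrow> 'a \<Rightarrow> real) \<Rightarrow> real \<Rightarrow> real \<Rightarrow> real \<Rightarrow> (real \<Rightarrow> 'a \<Rightarrow> real) \<Rightarrow> bool" where
  "gaussian_volterra_process M W \<alpha> \<beta> \<gamma> X \<longleftrightarrow>
     (\<forall>\<omega>\<in>space M. X 0 \<omega> = 0) \<and>
     (\<forall>t>0. has_wiener_integral M W (volterra_kernel \<alpha> \<beta> \<gamma> t) t (X t)) \<and>
     (\<forall>\<omega>\<in>space M. continuous_on {0..} (\<lambda>t. X t \<omega>))"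

end

theory Submission imports Defs
begin

text \<open>
  Write \<open>\<tau> = \<gamma> + 3/2\<close> and \<open>\<eta> = \<epsilon> / t\<^sup>H\<close>; the exponent in the theorem is \<open>1/\<tau>\<close>.

  Upper bound: on \<open>(s, s']\<close> with \<open>s' \<le> 2 s\<close> the variable \<open>X(s')\<close> receives noise independent of the
  past whose standard deviation is at least of order \<open>s\<^sup>\<alpha>\<^sup>+\<^sup>\<beta> (s' - s)\<^sup>\<tau>\<close>. Cutting \<open>[t/2, t]\<close> into
  about \<open>\<eta>\<^sup>-\<^sup>1\<^sup>/\<^sup>\<tau>\<close> intervals makes this comparable with \<open>\<epsilon>\<close>, so that staying in
  \<open>[-\<epsilon>, \<epsilon>]\<close> costs a constant factor on each of them.

  Lower bound: \<open>X(s') - X(s)\<close> has standard deviation at most of order \<open>s\<^sup>\<alpha>\<^sup>+\<^sup>\<beta> (s' - s)\<^sup>\<tau>\<close>, hence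
  on the blocks \<open>[t 2\<^sup>-\<^sup>m\<^sup>-\<^sup>1, t 2\<^sup>-\<^sup>m]\<close> the path is controlled by dyadic chaining. Sidak's inequality
  bounds the probability that all chaining increments are small from below by the product of the
  single probabilities, and the sum of their logarithms is of order \<open>\<eta>\<^sup>-\<^sup>1\<^sup>/\<^sup>\<tau>\<close>; the blocks
  contribute a geometric series because \<open>H > 0\<close>. Sidak's inequality itself follows from the
  one-dimensional Prekopa-Leindler inequality: after a rotation, the conditional probability of the
  remaining slabs given the first coordinate is an even log-concave function of it.
\<close>

section \<open>Log-concavity and the inequality of Prekopa and Leindler\<close>

text \<open>\<open>X\<close> is known only through L2 approximation by step integrals, so no
  Gaussian vector is built for it. The finitely many step functions in play are refined to one
  common grid, whose normalised Brownian increments are independent standard normals. Slab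
  probabilities then become \<open>gint\<close>, and the passage to the limit costs only constants,
  such as the 4 in \<open>a / (4 * \<sigma>)\<close> and in \<open>4 * a / v\<close>. Sidak's
  inequality asks for single variances and the upper bound for fresh noise, so covariances of
  \<open>X\<close> are never computed.

  The range of \<gamma> shapes the exponent: \<gamma> < -1/2 makes the integral of
  \<open>(s - r) powr (2 * \<gamma>)\<close> over \<open>r < s - h\<close> of order
  \<open>h powr (2 * \<gamma> + 1)\<close>, so that the distant past adds no more to an increment
  over length \<open>h\<close> than the noise near \<open>s\<close>, and it gives \<tau> < 1;
  \<gamma> > -1 gives \<tau> > 1/2.

  Chaining thresholds that are constant over the levels would not be summable, and the number of
  levels coarser than the one where the deviation is comparable with \<epsilon> is unbounded. Hence
  the thresholds decay geometrically in both directions from that level.\<close>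

lemma emeasure_minkowski_sum_ge:
  fixes I J K :: "real set"
  assumes [measurable]: "I \<in> sets lborel" "J \<in> sets lborel" "K \<in> sets lborel"
    and "is_interval I" "is_interval J" "bounded I" "bounded J" "I \<noteq> {}" "J \<noteq> {}" "0 < l" "l < 1"
    and sub: "\<And>x y. x \<in> I \<Longrightarrow> y \<in> J \<Longrightarrow> (1 - l) * x + l * y \<in> K"
  shows "ennreal (1 - l) * emeasure lborel I + ennreal l * emeasure lborel J \<le> emeasure lborel K"
proof -
  define a b c d where "a = Inf I" and "b = Sup I" and "c = Inf J" and "d = Sup J"
  have bb: "bdd_below I" "bdd_above I" "bdd_below J" "bdd_above J"
    using assms by (auto simp: bounded_imp_bdd_below bounded_imp_bdd_above)
  have "I \<subseteq> {a..b}" "J \<subseteq> {c..d}"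
    unfolding a_def b_def c_def d_def using bb by (auto intro: cInf_lower cSup_upper)
  moreover from this have "a \<le> b" "c \<le> d" using assms by auto
  ultimately have I: "emeasure lborel I \<le> ennreal (b - a)" and J: "emeasure lborel J \<le> ennreal (d - c)"
    using emeasure_mono[of I "{a..b}" lborel] emeasure_mono[of J "{c..d}" lborel] by auto
  \<comment> \<open>The extrema need not be attained, so \<open>z\<close> is enclosed strictly
    between the combinations of two nearly minimal and of two nearly maximal points. Moving in both
    intervals with the same parameter \<open>th\<close> makes the combination affine in
    \<open>th\<close>, and some value hits \<open>z\<close>.\<close>
  have "{(1 - l) * a + l * c <..< (1 - l) * b + l * d} \<subseteq> K"
  proof
    fix z assume z: "z \<in> {(1 - l) * a + l * c <..< (1 - l) * b + l * d}"
    define e where "e = (z - ((1 - l) * a + l * c))"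
    have "e > 0" using z e_def by auto
    obtain x1 where x1: "x1 \<in> I" "x1 < a + e" using \<open>e > 0\<close> assms bb cInf_lessD[of I "a+e"] a_def by auto
    obtain y1 where y1: "y1 \<in> J" "y1 < c + e" using \<open>e > 0\<close> assms bb cInf_lessD[of J "c+e"] c_def by auto
    have lo: "(1 - l) * x1 + l * y1 < z"
    proof -
      have "(1 - l) * x1 + l * y1 < (1 - l) * (a + e) + l * (c + e)"
        using x1 y1 assms by (intro add_strict_mono mult_strict_left_mono) auto
      also have "\<dots> = z" by (simp add: e_def algebra_simps)
      finally show ?thesis .
    qed
    define f where "f = ((1 - l) * b + l * d) - z"
    have "f > 0" using z f_def by auto
    obtain x2 where x2: "x2 \<in> I" "x2 > b - f" using \<open>f > 0\<close> assms bb less_cSupD[of I "b-f"] b_def by auto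
    obtain y2 where y2: "y2 \<in> J" "y2 > d - f" using \<open>f > 0\<close> assms bb less_cSupD[of J "d-f"] d_def by auto
    have hi: "(1 - l) * x2 + l * y2 > z"
    proof -
      have "(1 - l) * x2 + l * y2 > (1 - l) * (b - f) + l * (d - f)"
        using x2 y2 assms by (intro add_strict_mono mult_strict_left_mono) auto
      moreover have "(1 - l) * (b - f) + l * (d - f) = z" by (simp add: f_def algebra_simps)
      ultimately show ?thesis by simp
    qed
    define p where "p x y = (1 - l) * x + l * y" for x y
    define th where "th = (z - p x1 y1) / (p x2 y2 - p x1 y1)"
    have th: "0 \<le> th" "th \<le> 1" using lo hi by (auto simp: th_def p_def)
    have "(1 - th) * x1 + th * x2 \<in> I"
      using \<open>is_interval I\<close> x1 x2 th
      by (metis is_interval_convex_1 convexD_alt real_scaleR_def)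
    moreover have "(1 - th) * y1 + th * y2 \<in> J"
      using \<open>is_interval J\<close> y1 y2 th
      by (metis is_interval_convex_1 convexD_alt real_scaleR_def)
    ultimately have "p ((1 - th) * x1 + th * x2) ((1 - th) * y1 + th * y2) \<in> K"
      using sub by (simp add: p_def)
    also have "p ((1 - th) * x1 + th * x2) ((1 - th) * y1 + th * y2) = p x1 y1 + th * (p x2 y2 - p x1 y1)"
      by (simp add: p_def algebra_simps)
    also have "\<dots> = z" using lo hi by (simp add: th_def p_def)
    finally show "z \<in> K" .
  qed
  from emeasure_mono[OF this, of lborel]
  have K: "ennreal ((1 - l) * (b - a) + l * (d - c)) \<le> emeasure lborel K"
  proof -
    have "(1 - l) * a + l * c \<le> (1 - l) * b + l * d"
      using \<open>a \<le> b\<close> \<open>c \<le> d\<close> assms by (intro add_mono mult_left_mono) auto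
    moreover have "(1 - l) * b + l * d - ((1 - l) * a + l * c) = (1 - l) * (b - a) + l * (d - c)"
      by (simp add: algebra_simps)
    ultimately show ?thesis
      using emeasure_mono[OF \<open>{(1 - l) * a + l * c <..< (1 - l) * b + l * d} \<subseteq> K\<close>, of lborel] assms(3) by simp
  qed
  have "ennreal (1 - l) * emeasure lborel I + ennreal l * emeasure lborel J
     \<le> ennreal (1 - l) * ennreal (b - a) + ennreal l * ennreal (d - c)"
    by (intro add_mono mult_left_mono I J) auto
  also have "\<dots> = ennreal ((1 - l) * (b - a) + l * (d - c))"
    using \<open>a \<le> b\<close> \<open>c \<le> d\<close> assms by (simp flip: ennreal_mult)
  finally show ?thesis using K by simp
qed

lemma nn_integral_layer_cake:
  fixes f :: "real \<Rightarrow> real"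
  assumes [measurable]: "f \<in> borel_measurable borel" and "\<And>x. 0 \<le> f x"
  shows "(\<integral>\<^sup>+x. ennreal (f x) \<partial>lborel)
       = (\<integral>\<^sup>+u. indicator {0<..} u * emeasure lborel {x. u < f x} \<partial>lborel)"
proof -
  have "(\<integral>\<^sup>+x. ennreal (f x) \<partial>lborel) = (\<integral>\<^sup>+x. \<integral>\<^sup>+u. indicator {0<..} u * indicator {x. u < f x} x \<partial>lborel \<partial>lborel)"
  proof (intro nn_integral_cong)
    fix x
    have "(\<integral>\<^sup>+u. indicator {0<..} u * indicator {x. u < f x} x \<partial>lborel) = (\<integral>\<^sup>+u. indicator {0<..<f x} u \<partial>lborel)"
      by (intro nn_integral_cong) (auto simp: indicator_def)
    also have "\<dots> = ennreal (f x)" using assms(2)[of x] by simp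
    finally show "ennreal (f x) = (\<integral>\<^sup>+u. indicator {0<..} u * indicator {x. u < f x} x \<partial>lborel)" by simp
  qed
  also have "\<dots> = (\<integral>\<^sup>+u. \<integral>\<^sup>+x. indicator {0<..} u * indicator {x. u < f x} x \<partial>lborel \<partial>lborel)"
    by (rule lborel_pair.Fubini'[symmetric]) measurable
  also have "\<dots> = (\<integral>\<^sup>+u. indicator {0<..} u * emeasure lborel {x. u < f x} \<partial>lborel)"
    by (intro nn_integral_cong, subst nn_integral_cmult) (auto intro!: nn_integral_indicator)
  finally show ?thesis .
qed

text \<open>Normalised by their suprema, \<open>f0 / A\<close> and \<open>f1 / B\<close> have
  non-empty superlevel sets at the same positive levels, those below 1, so the inequality for sums
  of intervals applies level by level. Integrating over the levels bounds the arithmetic mean of the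
  normalised integrals, and the geometric mean lies below it. Bounded intervals as superlevel sets
  are general enough, since the integrands in question are log-concave and lie below a normal
  density.\<close>

lemma prekopa_leindler_real:
  fixes f0 f1 f2 :: "real \<Rightarrow> real"
  assumes meas [measurable]: "f0 \<in> borel_measurable borel" "f1 \<in> borel_measurable borel" "f2 \<in> borel_measurable borel"
    and nn: "\<And>x. 0 \<le> f0 x" "\<And>x. 0 \<le> f1 x" "\<And>x. 0 \<le> f2 x"
    and bdd: "bdd_above (range f0)" "bdd_above (range f1)"
    and iv: "\<And>u. 0 < u \<Longrightarrow> is_interval {x. u < f0 x}" "\<And>u. 0 < u \<Longrightarrow> is_interval {x. u < f1 x}"
    and bd: "\<And>u. 0 < u \<Longrightarrow> bounded {x. u < f0 x}" "\<And>u. 0 < u \<Longrightarrow> bounded {x. u < f1 x}"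
    and int: "integrable lborel f0" "integrable lborel f1" "integrable lborel f2"
    and l: "0 < l" "l < 1"
    and le: "\<And>x y. f0 x powr (1 - l) * f1 y powr l \<le> f2 ((1 - l) * x + l * y)"
  shows "(\<integral>x. f0 x \<partial>lborel) powr (1 - l) * (\<integral>x. f1 x \<partial>lborel) powr l \<le> (\<integral>x. f2 x \<partial>lborel)"
proof -
  define A where "A = (SUP x. f0 x)"
  define B where "B = (SUP x. f1 x)"
  have fA: "f0 x \<le> A" "f1 x \<le> B" for x
    unfolding A_def B_def using bdd by (auto intro: cSUP_upper)
  have I2: "0 \<le> (\<integral>x. f2 x \<partial>lborel)" using nn by simp
  show ?thesis
  proof (cases "A > 0 \<and> B > 0")
    case False
    then have "(\<forall>x. f0 x = 0) \<or> (\<forall>x. f1 x = 0)"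
      using fA nn by (metis order.trans linorder_not_less order_antisym)
    then show ?thesis using I2 by auto
  next
    case True
    then have A: "A > 0" and B: "B > 0" by auto
    \<comment> \<open>The matching normalisation of \<open>f2\<close>: points where
      \<open>f0\<close> exceeds \<open>u * A\<close> and \<open>f1\<close> exceeds
      \<open>u * B\<close> combine to a point where \<open>f2\<close> exceeds
      \<open>u * D\<close>.\<close>
    define D where "D = A powr (1 - l) * B powr l"
    have D: "D > 0" using A B by (simp add: D_def)
    have key: "ennreal (1 - l) * emeasure lborel {x. u < f0 x / A} + ennreal l * emeasure lborel {x. u < f1 x / B}
        \<le> emeasure lborel {x. u < f2 x / D}" if u: "0 < u" for u
    proof (cases "u < 1")
      case False
      have "f0 x / A \<le> 1" "f1 x / B \<le> 1" for x using fA A B by auto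
      then have "{x. u < f0 x / A} = {}" "{x. u < f1 x / B} = {}"
        using False by (auto simp: not_less intro: order_trans)
      then show ?thesis by (simp only: emeasure_empty) simp
    next
      case u1: True
      have eq: "{x. u < f0 x / A} = {x. u * A < f0 x}" "{x. u < f1 x / B} = {x. u * B < f1 x}"
        using A B by (auto simp: field_simps)
      have ne: "{x. u * A < f0 x} \<noteq> {}" "{x. u * B < f1 x} \<noteq> {}"
      proof -
        have "u * A < A" "u * B < B" using u1 A B by auto
        then obtain x y where "u * A < f0 x" "u * B < f1 y"
          unfolding A_def B_def using bdd by (auto simp: less_cSUP_iff)
        then show "{x. u * A < f0 x} \<noteq> {}" "{x. u * B < f1 x} \<noteq> {}" by auto
      qed
      show ?thesis unfolding eq
      proof (rule emeasure_minkowski_sum_ge)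
        fix x y assume "x \<in> {x. u * A < f0 x}" "y \<in> {x. u * B < f1 x}"
        then have xy: "u * A < f0 x" "u * B < f1 y" by auto
        have pos: "0 < u * A" "0 < u * B" using u A B by auto
        then have "0 < f0 x" "0 < f1 y" using xy by linarith+
        have "u * D = (u * A) powr (1 - l) * (u * B) powr l"
          using u A B by (simp add: D_def powr_mult algebra_simps flip: powr_add)
        also have "\<dots> < f0 x powr (1 - l) * f1 y powr l"
          using xy pos \<open>0 < f0 x\<close> l by (intro mult_strict_mono powr_less_mono2) (auto simp: less_imp_le)
        also have "\<dots> \<le> f2 ((1 - l) * x + l * y)" by (rule le)
        finally show "(1 - l) * x + l * y \<in> {x. u < f2 x / D}" using D by (simp add: field_simps)
      qed (use u A B ne iv bd l in auto)
    qed
    define F0 where "F0 = (\<integral>x. f0 x / A \<partial>lborel)"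
    define F1 where "F1 = (\<integral>x. f1 x / B \<partial>lborel)"
    define F2 where "F2 = (\<integral>x. f2 x / D \<partial>lborel)"
    have F: "0 \<le> F0" "0 \<le> F1" "0 \<le> F2" using nn A B D by (auto simp: F0_def F1_def F2_def)
    have e0: "ennreal F0 = (\<integral>\<^sup>+u. indicator {0<..} u * emeasure lborel {x. u < f0 x / A} \<partial>lborel)"
      unfolding F0_def using nn A int by (subst nn_integral_eq_integral[symmetric]) (auto simp: nn_integral_layer_cake)
    have e1: "ennreal F1 = (\<integral>\<^sup>+u. indicator {0<..} u * emeasure lborel {x. u < f1 x / B} \<partial>lborel)"
      unfolding F1_def using nn B int by (subst nn_integral_eq_integral[symmetric]) (auto simp: nn_integral_layer_cake)
    have e2: "ennreal F2 = (\<integral>\<^sup>+u. indicator {0<..} u * emeasure lborel {x. u < f2 x / D} \<partial>lborel)"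
      unfolding F2_def using nn D int by (subst nn_integral_eq_integral[symmetric]) (auto simp: nn_integral_layer_cake)
    have "ennreal ((1 - l) * F0 + l * F1) = ennreal (1 - l) * ennreal F0 + ennreal l * ennreal F1"
      using F l by (simp add: ennreal_mult)
    also have "\<dots> = (\<integral>\<^sup>+u. ennreal (1 - l) * (indicator {0<..} u * emeasure lborel {x. u < f0 x / A})
         + ennreal l * (indicator {0<..} u * emeasure lborel {x. u < f1 x / B}) \<partial>lborel)"
      unfolding e0 e1 by (subst nn_integral_add) (auto simp: nn_integral_cmult)
    also have "\<dots> \<le> ennreal F2" unfolding e2
    proof (intro nn_integral_mono)
      fix u :: real
      show "ennreal (1 - l) * (indicator {0<..} u * emeasure lborel {x. u < f0 x / A})
         + ennreal l * (indicator {0<..} u * emeasure lborel {x. u < f1 x / B})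
         \<le> indicator {0<..} u * emeasure lborel {x. u < f2 x / D}"
        using key[of u] by (cases "u > 0") (auto simp: indicator_def)
    qed
    finally have "(1 - l) * F0 + l * F1 \<le> F2" using F by (simp add: ennreal_le_iff)
    moreover have "F0 powr (1 - l) * F1 powr l \<le> (1 - l) * F0 + l * F1"
    proof (cases "F0 > 0 \<and> F1 > 0")
      case True then show ?thesis using Youngs_inequality_0[of "1-l" l F0 F1] l by simp
    next
      case False then have "F0 = 0 \<or> F1 = 0" using F by auto
      then show ?thesis using F l by auto
    qed
    ultimately have "D * (F0 powr (1 - l) * F1 powr l) \<le> D * F2" using D by auto
    moreover have "D * (F0 powr (1 - l) * F1 powr l) = (A * F0) powr (1 - l) * (B * F1) powr l"
      using F A B by (simp add: D_def powr_mult)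
    ultimately show ?thesis using A B D by (simp add: F0_def F1_def F2_def)
  qed
qed

section \<open>Gaussian integrals in finitely many variables\<close>

abbreviation "\<N> \<equiv> std_normal_distribution"

abbreviation prod_borel :: "('i \<Rightarrow> real) measure" where "prod_borel \<equiv> Pi\<^sub>M UNIV (\<lambda>_. borel)"

abbreviation sqint :: "'a measure \<Rightarrow> ('a \<Rightarrow> real) \<Rightarrow> ennreal" where
  "sqint M f \<equiv> (\<integral>\<^sup>+x. ennreal ((f x)\<^sup>2) \<partial>M)"

text \<open>\<open>gint h [B\<^sub>1, \<dots>, B\<^sub>n] u\<close> is the expectation of \<open>h (u + g\<^sub>1 B\<^sub>1 + \<dots> + g\<^sub>n B\<^sub>n)\<close> for
  independent standard normal \<open>g\<^sub>j\<close>. Keeping the dimension in the length of the list lets rotations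
  and inductions act on single columns.\<close>

primrec gint :: "(('i \<Rightarrow> real) \<Rightarrow> ennreal) \<Rightarrow> ('i \<Rightarrow> real) list \<Rightarrow> ('i \<Rightarrow> real) \<Rightarrow> ennreal" where
  "gint h [] = h"
| "gint h (B # Bs) = (\<lambda>u. \<integral>\<^sup>+s. gint h Bs (\<lambda>i. u i + s * B i) \<partial>\<N>)"

lemma gint_append: "gint h (xs @ ys) = gint (gint h ys) xs"
  by (induction xs) auto

lemma prob_space_std_normal: "prob_space \<N>"
  by (intro prob_space_normal_density) simp

lemma emeasure_std_normal_UNIV [simp]: "emeasure \<N> UNIV = 1"
  using prob_space.emeasure_space_1[OF prob_space_std_normal] by simp

lemma measurable_add_scaled [measurable]:
  assumes [measurable]: "f \<in> measurable M borel"
    and [measurable]: "g \<in> measurable M (Pi\<^sub>M UNIV (\<lambda>_. borel :: real measure))"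
  shows "(\<lambda>x. (\<lambda>i. g x i + f x * B i)) \<in> measurable M (Pi\<^sub>M UNIV (\<lambda>_. borel :: real measure))"
proof (rule measurable_PiM_single')
  fix i
  have "(\<lambda>x. g x i) \<in> borel_measurable M"
    using measurable_compose[OF assms(2) measurable_component_singleton[of i UNIV "\<lambda>_. borel"]] by simp
  then show "(\<lambda>x. g x i + f x * B i) \<in> borel_measurable M" by measurable
qed auto

lemma measurable_gint:
  assumes "h \<in> borel_measurable prod_borel"
  shows "gint h Bs \<in> borel_measurable prod_borel"
proof (induction Bs)
  case (Cons B Bs)
  have *: "(\<lambda>(u, s). gint h Bs (\<lambda>i. u i + s * B i)) \<in> borel_measurable (Pi\<^sub>M UNIV (\<lambda>_. borel) \<Otimes>\<^sub>M \<N>)"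
    unfolding split_beta' by (rule measurable_compose[OF measurable_add_scaled Cons]) measurable
  interpret prob_space \<N> by (rule prob_space_std_normal)
  show ?case using * unfolding gint.simps by (rule borel_measurable_nn_integral)
qed (use assms in simp)

lemma measurable_gint_affine [measurable (raw)]:
  assumes "h \<in> borel_measurable prod_borel"
    and "f \<in> borel_measurable N" "g \<in> measurable N prod_borel"
  shows "(\<lambda>x. gint h Bs (\<lambda>i. g x i + f x * B i)) \<in> borel_measurable N"
  using measurable_compose[OF measurable_add_scaled[OF assms(2,3)] measurable_gint[OF assms(1)]] .

lemma measurable_const_PiM_UNIV [measurable (raw)]:
  "(\<lambda>_. u) \<in> measurable N (Pi\<^sub>M UNIV (\<lambda>_. borel :: real measure))"
  by (rule measurable_const) (simp add: space_PiM)

lemma gint_mono: "(\<And>v. h v \<le> k v) \<Longrightarrow> gint h Bs u \<le> gint k Bs u"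
  by (induction Bs arbitrary: u) (auto intro!: nn_integral_mono)

lemma gint_cong: "(\<And>v. h v = k v) \<Longrightarrow> gint h Bs u = gint k Bs u"
  by (rule arg_cong[of h k "\<lambda>h. gint h Bs u"]) auto

lemma gint_cmult:
  assumes [measurable]: "h \<in> borel_measurable prod_borel"
  shows "gint (\<lambda>v. c * h v) Bs u = c * gint h Bs u"
proof (induction Bs arbitrary: u)
  case (Cons B Bs)
  have "(\<lambda>s. gint h Bs (\<lambda>i. u i + s * B i)) \<in> borel_measurable \<N>"
    by measurable
  then show ?case using Cons by (simp add: nn_integral_cmult)
qed simp

lemma gint_le_1: "(\<And>v. h v \<le> 1) \<Longrightarrow> gint h Bs u \<le> 1"
proof (induction Bs arbitrary: u)
  case (Cons B Bs)
  have "gint h (B # Bs) u \<le> (\<integral>\<^sup>+s. 1 \<partial>\<N>)"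
    unfolding gint.simps by (intro nn_integral_mono Cons)
  then show ?case by simp
qed auto

text \<open>Columns vanishing at \<open>i0\<close> never move that coordinate, so a factor depending
  on it alone is constant throughout the integration.\<close>

lemma gint_mult_invariant:
  assumes [measurable]: "h \<in> borel_measurable prod_borel"
    and "\<And>C. C \<in> set Bs \<Longrightarrow> C i0 = 0"
  shows "gint (\<lambda>v. k (v i0) * h v) Bs u = k (u i0) * gint h Bs u"
  using assms(2)
proof (induction Bs arbitrary: u)
  case (Cons B Bs)
  have [simp]: "B i0 = 0" using Cons.prems by simp
  have "(\<lambda>s. gint h Bs (\<lambda>i. u i + s * B i)) \<in> borel_measurable \<N>"
    by measurable
  then show ?case using Cons by (simp add: nn_integral_cmult)
qed auto

lemma gint_const: "gint (\<lambda>v. c) Bs u = c"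
  by (induction Bs arbitrary: u) auto

section \<open>Rotation invariance and elimination of a coordinate\<close>

text \<open>Two one-variable affine substitutions with an exchange of the integrals between them.
  Their factors \<open>\<bar>1/c\<bar>\<close> and \<open>\<bar>c\<bar>\<close> cancel; dividing by
  \<open>c\<close> is what excludes quarter turns here.\<close>

lemma gaussian_rotation:
  fixes G :: "real \<Rightarrow> real \<Rightarrow> ennreal"
  assumes [measurable]: "case_prod G \<in> borel_measurable (borel \<Otimes>\<^sub>M borel)" and cs: "c\<^sup>2 + s\<^sup>2 = 1" "c \<noteq> 0"
  shows "(\<integral>\<^sup>+x. \<integral>\<^sup>+y. G (c * x - s * y) (s * x + c * y) \<partial>lborel \<partial>lborel) = (\<integral>\<^sup>+x. \<integral>\<^sup>+y. G x y \<partial>lborel \<partial>lborel)"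
proof -
  have G [measurable (raw)]: "(\<lambda>x. G (f x) (g x)) \<in> borel_measurable N"
    if "f \<in> borel_measurable N" "g \<in> borel_measurable N" for f g and N :: "'b measure"
    using measurable_compose[OF measurable_Pair[OF that] assms(1)] by simp
  have eq: "c * x - s * (v / c - s * x / c) = x / c - s * v / c" "s * x + c * (v / c - s * x / c) = v" for x v
  proof -
    have "c * x - s * (v / c - s * x / c) = (c\<^sup>2 + s\<^sup>2) * x / c - s * v / c"
      using cs(2) by (simp add: field_simps power2_eq_square)
    then show "c * x - s * (v / c - s * x / c) = x / c - s * v / c" using cs by simp
    show "s * x + c * (v / c - s * x / c) = v" using cs by (simp add: field_simps)
  qed
  have "(\<integral>\<^sup>+x. \<integral>\<^sup>+y. G (c * x - s * y) (s * x + c * y) \<partial>lborel \<partial>lborel)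
      = (\<integral>\<^sup>+x. \<bar>1/c\<bar> * (\<integral>\<^sup>+v. G (x / c - s * v / c) v \<partial>lborel) \<partial>lborel)"
  proof (intro nn_integral_cong)
    fix x
    show "(\<integral>\<^sup>+y. G (c * x - s * y) (s * x + c * y) \<partial>lborel) = \<bar>1/c\<bar> * (\<integral>\<^sup>+v. G (x / c - s * v / c) v \<partial>lborel)"
      using cs by (subst nn_integral_real_affine[where c="1/c" and t="- (s * x / c)"]) (auto simp: eq)
  qed
  also have "\<dots> = \<bar>1/c\<bar> * (\<integral>\<^sup>+x. (\<integral>\<^sup>+v. G (x / c - s * v / c) v \<partial>lborel) \<partial>lborel)"
    by (rule nn_integral_cmult) measurable
  also have "\<dots> = \<bar>1/c\<bar> * (\<integral>\<^sup>+v. (\<integral>\<^sup>+x. G (x / c - s * v / c) v \<partial>lborel) \<partial>lborel)"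
    by (subst lborel_pair.Fubini') (auto simp: split_beta')
  also have "(\<integral>\<^sup>+v. (\<integral>\<^sup>+x. G (x / c - s * v / c) v \<partial>lborel) \<partial>lborel) = (\<integral>\<^sup>+v. \<bar>c\<bar> * (\<integral>\<^sup>+x. G x v \<partial>lborel) \<partial>lborel)"
  proof (intro nn_integral_cong)
    fix v
    have "(s * v + c * x) / c - s * v / c = x" for x using cs by (simp add: field_simps)
    then show "(\<integral>\<^sup>+x. G (x / c - s * v / c) v \<partial>lborel) = \<bar>c\<bar> * (\<integral>\<^sup>+x. G x v \<partial>lborel)"
      using cs by (subst nn_integral_real_affine[where c="c" and t="s * v"]) auto
  qed
  also have "\<bar>1/c\<bar> * \<dots> = (\<integral>\<^sup>+v. (\<integral>\<^sup>+x. G x v \<partial>lborel) \<partial>lborel)"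
    using cs by (simp add: nn_integral_cmult mult.assoc[symmetric] flip: ennreal_mult)
  also have "\<dots> = (\<integral>\<^sup>+x. (\<integral>\<^sup>+v. G x v \<partial>lborel) \<partial>lborel)"
    by (rule lborel_pair.Fubini') (simp add: split_beta')
  finally show ?thesis .
qed

text \<open>The product of two standard normal densities depends on \<open>x^2 + y^2\<close> only,
  and rotating the two coefficients is the same as mixing the columns: \<open>(c x - s y) B + (s x +
  c y) B' = x (c B + s B') + y (c B' - s B)\<close>.\<close>

lemma gint_rotate_aux:
  assumes h: "h \<in> borel_measurable prod_borel" and cs: "c\<^sup>2 + s\<^sup>2 = 1" "c \<noteq> 0"
  shows "gint h (B # B' # Bs) u = gint h ((\<lambda>i. c * B i + s * B' i) # (\<lambda>i. c * B' i - s * B i) # Bs) u"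
proof -
  note [measurable] = h
  define F where "F x y = gint h Bs (\<lambda>i. u i + x * B i + y * B' i)" for x y
  define p where "p = std_normal_density"
  define G where "G x y = ennreal (p x) * (ennreal (p y) * F x y)" for x y
  have [measurable (raw)]: "(\<lambda>x. F (f x) (g x)) \<in> borel_measurable N"
    if [measurable]: "f \<in> borel_measurable N" "g \<in> borel_measurable N" for f g and N :: "'b measure"
    unfolding F_def using that by (intro measurable_gint_affine measurable_add_scaled h measurable_const_PiM_UNIV)
  have [measurable]: "p \<in> borel_measurable borel" by (simp add: p_def)
  have G: "case_prod G \<in> borel_measurable (borel \<Otimes>\<^sub>M borel)"
    unfolding G_def split_beta' by measurable
  have pp: "ennreal (p x) * ennreal (p y) = ennreal (p (c * x - s * y)) * ennreal (p (s * x + c * y))" for x y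
  proof -
    have "x\<^sup>2 + y\<^sup>2 = (c\<^sup>2 + s\<^sup>2) * (x\<^sup>2 + y\<^sup>2)" using cs by simp
    also have "\<dots> = (c * x - s * y)\<^sup>2 + (s * x + c * y)\<^sup>2" by (simp add: power2_eq_square algebra_simps)
    finally have "exp (- x\<^sup>2 / 2) * exp (- y\<^sup>2 / 2) = exp (- (c * x - s * y)\<^sup>2 / 2) * exp (- (s * x + c * y)\<^sup>2 / 2)"
      by (simp add: field_simps flip: exp_add)
    then have "p x * p y = p (c * x - s * y) * p (s * x + c * y)"
      by (simp add: p_def std_normal_density_def)
    then show ?thesis by (simp add: p_def flip: ennreal_mult)
  qed
  have *: "(\<integral>\<^sup>+x. (\<integral>\<^sup>+y. H x y \<partial>\<N>) \<partial>\<N>)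
      = (\<integral>\<^sup>+x. (\<integral>\<^sup>+y. ennreal (p x) * (ennreal (p y) * H x y) \<partial>lborel) \<partial>lborel)"
    if [measurable]: "case_prod H \<in> borel_measurable (borel \<Otimes>\<^sub>M borel)" for H
  proof -
    have [measurable (raw)]: "(\<lambda>x. H (f x) (g x)) \<in> borel_measurable N"
      if "f \<in> borel_measurable N" "g \<in> borel_measurable N" for f g and N :: "'c measure"
      using measurable_compose[OF measurable_Pair[OF that] \<open>case_prod H \<in> _\<close>] by simp
    have i: "(\<integral>\<^sup>+y. H x y \<partial>\<N>) = (\<integral>\<^sup>+y. ennreal (p y) * H x y \<partial>lborel)" for x
      by (subst nn_integral_density) (auto simp: p_def)
    show ?thesis unfolding i
      by (subst nn_integral_density) (auto simp: nn_integral_cmult p_def)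
  qed
  have "gint h (B # B' # Bs) u = (\<integral>\<^sup>+x. (\<integral>\<^sup>+y. F x y \<partial>\<N>) \<partial>\<N>)"
    by (simp add: F_def[abs_def])
  also have "\<dots> = (\<integral>\<^sup>+x. \<integral>\<^sup>+y. G x y \<partial>lborel \<partial>lborel)"
    unfolding G_def by (rule *) (simp add: split_beta')
  also have "\<dots> = (\<integral>\<^sup>+x. \<integral>\<^sup>+y. G (c * x - s * y) (s * x + c * y) \<partial>lborel \<partial>lborel)"
    by (rule gaussian_rotation[symmetric, OF G cs])
  also have "\<dots> = (\<integral>\<^sup>+x. \<integral>\<^sup>+y. ennreal (p x) * (ennreal (p y) * F (c * x - s * y) (s * x + c * y)) \<partial>lborel \<partial>lborel)"
    using pp by (intro nn_integral_cong) (simp add: G_def mult.assoc[symmetric])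
  also have "\<dots> = (\<integral>\<^sup>+x. (\<integral>\<^sup>+y. F (c * x - s * y) (s * x + c * y) \<partial>\<N>) \<partial>\<N>)"
    by (subst *) (auto simp: split_beta')
  also have "\<dots> = gint h ((\<lambda>i. c * B i + s * B' i) # (\<lambda>i. c * B' i - s * B i) # Bs) u"
    unfolding F_def gint.simps
    by (intro nn_integral_cong arg_cong[where f="gint h Bs"]) (auto simp: algebra_simps fun_eq_iff)
  finally show ?thesis .
qed

lemma gint_rotate:
  assumes h: "h \<in> borel_measurable prod_borel" and cs: "c\<^sup>2 + s\<^sup>2 = 1"
  shows "gint h (B # B' # Bs) u = gint h ((\<lambda>i. c * B i + s * B' i) # (\<lambda>i. c * B' i - s * B i) # Bs) u"
proof (cases "c = 0")
  case True
  \<comment> \<open>A quarter turn is two successive eighth turns, whose cosine \<open>q\<close> is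
    not zero.\<close>
  define q where "q = sqrt (1/2)"
  have q: "q\<^sup>2 = 1/2" "q \<noteq> 0" by (auto simp: q_def)
  have s: "s\<^sup>2 = 1" using cs True by simp
  have e: "gint h (B # B' # Bs) u = gint h ((\<lambda>i. q * B i + (q * s) * B' i) # (\<lambda>i. q * B' i - (q * s) * B i) # Bs) u" for B B'
    using q s by (intro gint_rotate_aux[OF h]) (auto simp: power_mult_distrib)
  have qq: "q * q = 1/2" using q by (simp add: power2_eq_square)
  have qx: "q * (q * x) = x / 2" for x using qq by (simp add: mult.assoc[symmetric])
  have sx: "s * (s * x) = x" for x using s by (simp add: power2_eq_square mult.assoc[symmetric])
  have "gint h (B # B' # Bs) u = gint h ((\<lambda>i. q * (q * B i + (q * s) * B' i) + (q * s) * (q * B' i - (q * s) * B i))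
      # (\<lambda>i. q * (q * B' i - (q * s) * B i) - (q * s) * (q * B i + (q * s) * B' i)) # Bs) u"
    by (subst e, subst e) (rule refl)
  also have "(\<lambda>i. q * (q * B i + (q * s) * B' i) + (q * s) * (q * B' i - (q * s) * B i)) = (\<lambda>i. c * B i + s * B' i)"
  proof
    fix i
    have "q * (q * B i + (q * s) * B' i) + (q * s) * (q * B' i - (q * s) * B i)
       = q * q * B i + 2 * (q * q) * (s * B' i) - (q * q) * (s * (s * B i))" by (simp add: algebra_simps)
    then show "q * (q * B i + (q * s) * B' i) + (q * s) * (q * B' i - (q * s) * B i) = c * B i + s * B' i"
      using True qq sx by simp
  qed
  also have "(\<lambda>i. q * (q * B' i - (q * s) * B i) - (q * s) * (q * B i + (q * s) * B' i)) = (\<lambda>i. c * B' i - s * B i)"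
  proof
    fix i
    have "q * (q * B' i - (q * s) * B i) - (q * s) * (q * B i + (q * s) * B' i)
       = q * q * B' i - 2 * (q * q) * (s * B i) - (q * q) * (s * (s * B' i))" by (simp add: algebra_simps)
    then show "q * (q * B' i - (q * s) * B i) - (q * s) * (q * B i + (q * s) * B' i) = c * B' i - s * B i"
      using True qq sx by simp
  qed
  finally show ?thesis .
qed (use gint_rotate_aux assms in blast)

text \<open>Givens rotations, starting from the end of the list, sweep all entries at
  \<open>i0\<close> into a single column; the square of the surviving entry is the variance of that
  coordinate. The new columns are chosen before \<open>h\<close>, so that one choice serves several
  integrands.\<close>

lemma gint_givens:
  fixes i0 :: 'i
  assumes "Bs \<noteq> []"
  shows "\<exists>B' Bs'. (\<forall>h u. h \<in> borel_measurable prod_borel \<longrightarrow> gint h Bs u = gint h (B' # Bs') u)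
     \<and> (\<forall>C\<in>set Bs'. C i0 = 0) \<and> (B' i0)\<^sup>2 = (\<Sum>B\<leftarrow>Bs. (B i0)\<^sup>2)"
  using assms
proof (induction Bs)
  case (Cons B Bs)
  show ?case
  proof (cases "Bs = []")
    case True
    then show ?thesis by (intro exI[of _ B] exI[of _ "[]"]) auto
  next
    case False
    then obtain B' Bs' where IH: "\<And>h u. h \<in> borel_measurable prod_borel \<Longrightarrow> gint h Bs u = gint h (B' # Bs') u"
      "\<forall>C\<in>set Bs'. C i0 = 0" "(B' i0)\<^sup>2 = (\<Sum>B\<leftarrow>Bs. (B i0)\<^sup>2)"
      using Cons.IH by blast
    have 1: "gint h (B # Bs) u = gint h (B # B' # Bs') u" if "h \<in> borel_measurable prod_borel" for h u
      using IH(1)[OF that] by simp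
    define r where "r = sqrt ((B i0)\<^sup>2 + (B' i0)\<^sup>2)"
    have r2: "r\<^sup>2 = (B i0)\<^sup>2 + (B' i0)\<^sup>2" by (simp add: r_def)
    show ?thesis
    proof (cases "r = 0")
      case True
      then have "B i0 = 0" "B' i0 = 0" using r2 by (auto simp: sum_power2_eq_zero_iff)
      then show ?thesis
        using 1 IH by (intro exI[of _ B] exI[of _ "B' # Bs'"]) auto
    next
      case False
      \<comment> \<open>The angle for which the second of the mixed columns vanishes at
        \<open>i0\<close>.\<close>
      define c s where "c = B i0 / r" and "s = B' i0 / r"
      have "c\<^sup>2 + s\<^sup>2 = ((B i0)\<^sup>2 + (B' i0)\<^sup>2) / r\<^sup>2"
        by (simp add: c_def s_def power_divide add_divide_distrib)
      then have cs: "c\<^sup>2 + s\<^sup>2 = 1" using False unfolding r2[symmetric] by simp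
      have "c * B i0 + s * B' i0 = ((B i0)\<^sup>2 + (B' i0)\<^sup>2) / r"
        by (simp add: c_def s_def power2_eq_square add_divide_distrib)
      also have "\<dots> = r" using False unfolding r2[symmetric] by (simp add: power2_eq_square)
      finally have "c * B i0 + s * B' i0 = r" .
      moreover have "c * B' i0 - s * B i0 = 0" by (simp add: c_def s_def)
      ultimately show ?thesis
        using 1 IH(2,3) r2 gint_rotate[OF _ cs, of _ B B' Bs']
        by (intro exI[of _ "\<lambda>i. c * B i + s * B' i"] exI[of _ "(\<lambda>i. c * B' i - s * B i) # Bs'"]) auto
    qed
  qed
qed simp

definition slab :: "'i set \<Rightarrow> ('i \<Rightarrow> real) \<Rightarrow> ('i \<Rightarrow> real) \<Rightarrow> ennreal" where
  "slab I b u = (if \<forall>i\<in>I. \<bar>u i\<bar> \<le> b i then 1 else 0)"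

lemma measurable_slab [measurable]:
  "finite I \<Longrightarrow> slab I b \<in> borel_measurable prod_borel"
  unfolding slab_def by measurable

text \<open>After the elimination, coordinate \<open>i0\<close> is a single normal variable times
  \<open>B' i0\<close>. The event is written with a product instead of a quotient, so that a
  vanishing standard deviation is included.\<close>

lemma gint_slab_single:
  "gint (slab {i0} b) Bs (\<lambda>_. 0) = emeasure \<N> {x. \<bar>x\<bar> * sqrt (\<Sum>B\<leftarrow>Bs. (B i0)\<^sup>2) \<le> b i0}"
proof (cases "Bs = []")
  case True
  then show ?thesis by (simp add: slab_def)
next
  case False
  obtain B' Bs' where B: "\<And>h u. h \<in> borel_measurable prod_borel \<Longrightarrow> gint h Bs u = gint h (B' # Bs') u"
      "\<forall>C\<in>set Bs'. C i0 = 0" "(B' i0)\<^sup>2 = (\<Sum>B\<leftarrow>Bs. (B i0)\<^sup>2)"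
    using gint_givens[OF False, of i0] by blast
  define k :: "real \<Rightarrow> ennreal" where "k x = (if \<bar>x\<bar> \<le> b i0 then 1 else 0)" for x
  have k: "slab {i0} b = (\<lambda>u. k (u i0) * 1)" by (auto simp: slab_def k_def)
  have s: "sqrt (\<Sum>B\<leftarrow>Bs. (B i0)\<^sup>2) = \<bar>B' i0\<bar>" unfolding B(3)[symmetric] by simp
  have "gint (slab {i0} b) Bs (\<lambda>_. 0) = gint (\<lambda>u. k (u i0) * 1) (B' # Bs') (\<lambda>_. 0)"
    unfolding k[symmetric] by (intro B) simp
  also have "\<dots> = (\<integral>\<^sup>+x. k (x * B' i0) \<partial>\<N>)"
  proof -
    have "gint (\<lambda>u. k (u i0) * 1) Bs' v = k (v i0) * gint (\<lambda>_. 1) Bs' v" for v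
      using B(2) by (intro gint_mult_invariant) auto
    then show ?thesis by (simp add: gint_const)
  qed
  also have "\<dots> = (\<integral>\<^sup>+x. indicator {x. \<bar>x\<bar> * \<bar>B' i0\<bar> \<le> b i0} x \<partial>\<N>)"
    by (intro nn_integral_cong) (auto simp: k_def abs_mult)
  finally show ?thesis unfolding s by simp
qed

section \<open>Sidak's inequality\<close>

text \<open>Since \<open>0 powr x = 0\<close>, the log-concavity condition is void where \<open>h\<close> vanishes.\<close>

definition lc_even :: "(('i \<Rightarrow> real) \<Rightarrow> ennreal) \<Rightarrow> bool" where
  "lc_even h \<longleftrightarrow> h \<in> borel_measurable prod_borel \<and> (\<forall>u. h u \<le> 1) \<and> (\<forall>u. h (\<lambda>i. - u i) = h u) \<and>
     (\<forall>u v l. 0 < l \<longrightarrow> l < 1 \<longrightarrow>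
        enn2real (h u) powr (1 - l) * enn2real (h v) powr l \<le> enn2real (h (\<lambda>i. (1 - l) * u i + l * v i)))"

lemma lc_even_slab:
  assumes "finite I"
  shows "lc_even (slab I b)"
  unfolding lc_even_def
proof (intro conjI allI impI)
  fix u v :: "'a \<Rightarrow> real" and l :: real assume l: "0 < l" "l < 1"
  show "enn2real (slab I b u) powr (1 - l) * enn2real (slab I b v) powr l
       \<le> enn2real (slab I b (\<lambda>i. (1 - l) * u i + l * v i))"
  proof (cases "(\<forall>i\<in>I. \<bar>u i\<bar> \<le> b i) \<and> (\<forall>i\<in>I. \<bar>v i\<bar> \<le> b i)")
    case True
    have "\<bar>(1 - l) * u i + l * v i\<bar> \<le> b i" if "i \<in> I" for i
    proof -
      have "\<bar>(1 - l) * u i + l * v i\<bar> \<le> (1 - l) * \<bar>u i\<bar> + l * \<bar>v i\<bar>"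
        using l abs_triangle_ineq[of "(1 - l) * u i" "l * v i"] by (simp add: abs_mult)
      also have "\<dots> \<le> (1 - l) * b i + l * b i"
        using True that l by (intro add_mono mult_left_mono) auto
      finally show ?thesis by (simp add: algebra_simps)
    qed
    then show ?thesis using True by (simp add: slab_def)
  next
    case False
    then show ?thesis by (auto simp: slab_def)
  qed
qed (use assms in \<open>auto simp: slab_def\<close>)

text \<open>Log-concavity of the density is convexity of the square, with defect
  \<open>(1 - l) * l * (x - y)^2\<close>.\<close>

lemma std_normal_density_convex:
  assumes "0 < l" "l < 1"
  shows "std_normal_density x powr (1 - l) * std_normal_density y powr l \<le> std_normal_density ((1 - l) * x + l * y)"
proof -
  define c where "c = 1 / sqrt (2 * pi)"
  have c: "c > 0" by (simp add: c_def)
  have eq: "std_normal_density z = c * exp (- z\<^sup>2 / 2)" for z by (simp add: std_normal_density_def c_def)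
  have "((1 - l) * x + l * y)\<^sup>2 \<le> (1 - l) * x\<^sup>2 + l * y\<^sup>2"
  proof -
    have "(1 - l) * x\<^sup>2 + l * y\<^sup>2 - ((1 - l) * x + l * y)\<^sup>2 = (1 - l) * l * (x - y)\<^sup>2"
      by (simp add: power2_eq_square algebra_simps)
    also have "\<dots> \<ge> 0" using assms by simp
    finally show ?thesis by simp
  qed
  then have "exp ((1 - l) * (- x\<^sup>2 / 2) + l * (- y\<^sup>2 / 2)) \<le> exp (- ((1 - l) * x + l * y)\<^sup>2 / 2)"
    by (simp add: field_simps)
  moreover have "c powr (1 - l) * c powr l = c" using c by (simp flip: powr_add)
  moreover have "std_normal_density x powr (1 - l) * std_normal_density y powr l
     = (c powr (1 - l) * c powr l) * exp ((1 - l) * (- x\<^sup>2 / 2) + l * (- y\<^sup>2 / 2))"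
    using c by (simp add: eq powr_mult powr_def[of "exp _"] mult_exp_exp mult_ac)
  ultimately show ?thesis using c by (simp add: eq)
qed

lemma bounded_superlevel_std_normal: "0 < u \<Longrightarrow> bounded {x. u < std_normal_density x}"
proof -
  assume u: "0 < u"
  have "\<bar>x\<bar> \<le> 2 / u + 1" if "u < std_normal_density x" for x
  proof -
    have "1 \<le> sqrt (2 * pi)" using pi_gt3 by simp
    then have "exp (- x\<^sup>2 / 2) / sqrt (2 * pi) \<le> exp (- x\<^sup>2 / 2) / 1" by (intro divide_left_mono) auto
    then have "u < exp (- x\<^sup>2 / 2)" using that by (simp add: std_normal_density_def)
    also have "\<dots> = 1 / exp (x\<^sup>2 / 2)" by (simp add: exp_minus field_simps)
    also have "\<dots> \<le> 1 / (1 + x\<^sup>2 / 2)" by (intro divide_left_mono exp_ge_add_one_self mult_pos_pos) (auto intro: add_pos_nonneg)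
    finally have "u * (1 + x\<^sup>2 / 2) < 1" using u by (simp add: pos_less_divide_eq add_pos_nonneg)
    then have x: "u * x\<^sup>2 < 2" using u by (simp add: algebra_simps)
    show ?thesis
    proof (cases "\<bar>x\<bar> \<le> 1")
      case True then show ?thesis using u by (smt (verit) divide_nonneg_pos)
    next
      case False
      then have "\<bar>x\<bar> * 1 \<le> \<bar>x\<bar> * \<bar>x\<bar>" by (intro mult_left_mono) auto
      then have "u * \<bar>x\<bar> \<le> u * x\<^sup>2" using u by (intro mult_left_mono) (auto simp: power2_eq_square)
      then have "u * \<bar>x\<bar> \<le> 2" using x by linarith
      then have "\<bar>x\<bar> \<le> 2 / u" using u by (simp add: field_simps)
      then show ?thesis by simp
    qed
  qed
  then show ?thesis by (intro boundedI) auto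
qed

text \<open>Multiplied by the density, the integrand \<open>f u s\<close> is jointly log-concave in
  \<open>u\<close> and \<open>s\<close>, and the inequality of Prekopa and Leindler integrates out
  \<open>s\<close>. Its side conditions come from the same source: \<open>le\<close> with equal base
  points makes the superlevel sets intervals, and domination by the normal density makes them
  bounded. Evenness survives because the density is even.\<close>

lemma lc_even_integrate:
  assumes "lc_even h"
  shows "lc_even (\<lambda>u. \<integral>\<^sup>+s. h (\<lambda>i. u i + s * B i) \<partial>\<N>)" (is "lc_even ?k")
proof -
  have h[measurable]: "h \<in> borel_measurable prod_borel" and h1: "\<And>u. h u \<le> 1" and ev: "\<And>u. h (\<lambda>i. - u i) = h u"
    and lc: "\<And>u v l. 0 < l \<Longrightarrow> l < 1 \<Longrightarrow>
        enn2real (h u) powr (1 - l) * enn2real (h v) powr l \<le> enn2real (h (\<lambda>i. (1 - l) * u i + l * v i))"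
    using assms by (auto simp: lc_even_def)
  define p where "p = std_normal_density"
  have [measurable]: "p \<in> borel_measurable borel" by (simp add: p_def)
  have p0: "0 \<le> p x" for x by (simp add: p_def)
  have [measurable]: "(\<lambda>s. h (\<lambda>i. u i + s * B i)) \<in> borel_measurable borel" for u
    using measurable_gint_affine[OF h, of "\<lambda>s. s" borel "\<lambda>_. u" "[]"] by simp
  define f where "f u s = enn2real (h (\<lambda>i. u i + s * B i)) * p s" for u s
  have fm[measurable]: "f u \<in> borel_measurable borel" for u unfolding f_def by measurable
  have h_real: "ennreal (enn2real (h u)) = h u" "enn2real (h u) \<le> 1" for u
    using h1[of u] by (auto simp: ennreal_enn2real_if neq_top_trans enn2real_leI top_unique)
  have f0: "0 \<le> f u s" for u s by (simp add: f_def p0)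
  have fp: "f u s \<le> p s" for u s using h_real[of "\<lambda>i. u i + s * B i"] p0 by (simp add: f_def mult_left_le_one_le)
  have pint: "integrable lborel p" by (simp add: p_def)
  have fint: "integrable lborel (f u)" for u
    by (rule Bochner_Integration.integrable_bound[OF pint]) (use f0 fp p0 in auto)
  have k: "?k u = ennreal (\<integral>s. f u s \<partial>lborel)" for u
  proof -
    have "?k u = (\<integral>\<^sup>+s. ennreal (p s) * h (\<lambda>i. u i + s * B i) \<partial>lborel)"
      by (subst nn_integral_density) (auto simp: p_def)
    also have "\<dots> = (\<integral>\<^sup>+s. ennreal (f u s) \<partial>lborel)"
      by (intro nn_integral_cong) (simp add: f_def ennreal_mult h_real p0 mult.commute)
    also have "\<dots> = ennreal (\<integral>s. f u s \<partial>lborel)"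
      using fint f0 by (intro nn_integral_eq_integral) auto
    finally show ?thesis .
  qed
  have le: "f u x powr (1 - l) * f v y powr l \<le> f (\<lambda>i. (1 - l) * u i + l * v i) ((1 - l) * x + l * y)"
    if l: "0 < l" "l < 1" for u v l x y
  proof -
    have "f u x powr (1 - l) * f v y powr l =
       (enn2real (h (\<lambda>i. u i + x * B i)) powr (1 - l) * enn2real (h (\<lambda>i. v i + y * B i)) powr l) * (p x powr (1 - l) * p y powr l)"
      by (simp add: f_def powr_mult p0)
    also have "\<dots> \<le> enn2real (h (\<lambda>i. (1 - l) * (u i + x * B i) + l * (v i + y * B i))) * p ((1 - l) * x + l * y)"
      using l by (intro mult_mono lc) (auto simp: p_def std_normal_density_convex)
    also have "(\<lambda>i. (1 - l) * (u i + x * B i) + l * (v i + y * B i)) = (\<lambda>i. ((1 - l) * u i + l * v i) + ((1 - l) * x + l * y) * B i)"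
      by (simp add: fun_eq_iff algebra_simps)
    finally show ?thesis by (simp add: f_def)
  qed
  have pb: "p x \<le> 1" for x
  proof -
    have "1 \<le> sqrt (2 * pi)" using pi_gt3 by simp
    moreover have "exp (- x\<^sup>2 / 2) \<le> 1" by simp
    ultimately have "exp (- x\<^sup>2 / 2) \<le> sqrt (2 * pi)" by linarith
    then show ?thesis by (simp add: p_def std_normal_density_def field_simps)
  qed
  have bdd: "bdd_above (range (f u))" for u using fp pb by (auto intro!: bdd_aboveI2[where M=1] intro: order_trans)
  have iv: "is_interval {x. a < f u x}" if "0 < a" for a u
    unfolding is_interval_convex_1
  proof (rule convexI)
    fix x y s t :: real assume xy: "x \<in> {x. a < f u x}" "y \<in> {x. a < f u x}" and st: "0 \<le> s" "0 \<le> t" "s + t = 1"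
    show "s *\<^sub>R x + t *\<^sub>R y \<in> {x. a < f u x}"
    proof (cases "t = 0 \<or> t = 1")
      case True then show ?thesis using xy st by auto
    next
      case False
      then have t: "0 < t" "t < 1" "s = 1 - t" using st by auto
      have "(\<lambda>i. (1 - t) * u i + t * u i) = u" by (simp add: algebra_simps)
      then have "f u x powr (1 - t) * f u y powr t \<le> f u ((1 - t) * x + t * y)" using le[OF t(1,2), of u x u y] by simp
      moreover have "a powr (1 - t) * a powr t < f u x powr (1 - t) * f u y powr t"
        using xy that t by (intro mult_strict_mono powr_less_mono2) auto
      moreover have "a powr (1 - t) * a powr t = a" using that by (simp flip: powr_add)
      ultimately show ?thesis using t by simp
    qed
  qed
  have bd: "bounded {x. a < f u x}" if "0 < a" for a u
    by (rule bounded_subset[OF bounded_superlevel_std_normal[OF that]]) (use fp in \<open>auto simp: p_def intro: less_le_trans\<close>)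
  show ?thesis unfolding lc_even_def
  proof (intro conjI allI impI)
    show "?k \<in> borel_measurable prod_borel"
      using measurable_gint[OF h, of "[B]"] by simp
    show "?k u \<le> 1" for u using gint_le_1[of h "[B]" u] h1 by simp
    show "?k (\<lambda>i. - u i) = ?k u" for u
    proof -
      have "(\<integral>s. f (\<lambda>i. - u i) s \<partial>lborel) = (\<integral>s. f u (- s) \<partial>lborel)"
      proof (intro Bochner_Integration.integral_cong refl)
        fix s
        show "f (\<lambda>i. - u i) s = f u (- s)"
          using ev[of "\<lambda>i. u i + (-s) * B i"] by (simp add: f_def p_def std_normal_density_def)
      qed
      also have "\<dots> = (\<integral>s. f u s \<partial>lborel)"
        using lborel_integral_real_affine[of "-1" "f u" 0] by simp
      finally show ?thesis unfolding k by simp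
    qed
    fix u v :: "'a \<Rightarrow> real" and l :: real assume l: "0 < l" "l < 1"
    have "(\<integral>s. f u s \<partial>lborel) powr (1 - l) * (\<integral>s. f v s \<partial>lborel) powr l \<le> (\<integral>s. f (\<lambda>i. (1 - l) * u i + l * v i) s \<partial>lborel)"
      by (intro prekopa_leindler_real fm f0 bdd iv bd fint l le)
    moreover have "enn2real (?k w) = (\<integral>s. f w s \<partial>lborel)" for w
      unfolding k using f0 by (intro enn2real_ennreal integral_nonneg) auto
    ultimately show "enn2real (?k u) powr (1 - l) * enn2real (?k v) powr l \<le> enn2real (?k (\<lambda>i. (1 - l) * u i + l * v i))"
      by simp
  qed
qed

lemma lc_even_gint: "lc_even h \<Longrightarrow> lc_even (gint h Bs)"
  by (induction Bs) (auto intro: lc_even_integrate)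

lemma lc_even_decreasing:
  assumes "lc_even h" "\<bar>x\<bar> \<le> \<bar>y\<bar>"
  shows "h (\<lambda>i. y * B i) \<le> h (\<lambda>i. x * B i)"
proof (cases "\<bar>x\<bar> = \<bar>y\<bar>")
  case True
  then have "x = y \<or> x = - y" by auto
  moreover have "h (\<lambda>i. - (y * B i)) = h (\<lambda>i. y * B i)" using assms(1) by (simp add: lc_even_def)
  ultimately show ?thesis by auto
next
  case False
  then have xy: "\<bar>x\<bar> < \<bar>y\<bar>" "y \<noteq> 0" using assms by auto
  have h1: "h u \<le> 1" for u using assms by (auto simp: lc_even_def)
  have ev: "h (\<lambda>i. - u i) = h u" for u using assms by (auto simp: lc_even_def)
  \<comment> \<open>Chosen so that \<open>x\<close> is the mixture
    \<open>(1 - l) * y + l * (- y)\<close> of two opposite points, at which \<open>h\<close> takes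
    the same value.\<close>
  define l where "l = (1 - x / y) / 2"
  have "\<bar>x / y\<bar> < 1" using xy by simp
  then have "- 1 < x / y" "x / y < 1" by (simp_all only: abs_less_iff) linarith+
  then have l: "0 < l" "l < 1" by (auto simp: l_def)
  have "(1 - l) * y + l * (- y) = x" using xy by (simp add: l_def field_simps)
  then have eq: "(\<lambda>i. (1 - l) * (y * B i) + l * (- (y * B i))) = (\<lambda>i. x * B i)"
    by (metis (no_types, opaque_lifting) distrib_right minus_mult_left mult.assoc)
  have lc: "enn2real (h u) powr (1 - l) * enn2real (h v) powr l \<le> enn2real (h (\<lambda>i. (1 - l) * u i + l * v i))" for u v
    using assms l by (auto simp: lc_even_def)
  have "enn2real (h (\<lambda>i. y * B i)) = enn2real (h (\<lambda>i. y * B i)) powr (1 - l) * enn2real (h (\<lambda>i. y * B i)) powr l"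
    by (simp flip: powr_add)
  also have "\<dots> \<le> enn2real (h (\<lambda>i. x * B i))"
    using lc[of "\<lambda>i. y * B i" "\<lambda>i. - (y * B i)"] ev[of "\<lambda>i. y * B i"] unfolding eq by simp
  finally have "ennreal (enn2real (h (\<lambda>i. y * B i))) \<le> ennreal (enn2real (h (\<lambda>i. x * B i)))" by (rule ennreal_leI)
  moreover have "h u \<noteq> top" for u using h1[of u] by (metis ennreal_one_neq_top neq_top_trans)
  ultimately show ?thesis by (simp add: ennreal_enn2real_if)
qed

section \<open>Correlation of slabs\<close>

text \<open>The supremum \<open>m\<close> of \<open>g\<close> off \<open>A\<close> separates the
  values: on \<open>A\<close> the function is at least \<open>m\<close>, elsewhere at most
  \<open>m\<close>. Comparing both parts of the integral with \<open>m\<close> shows that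
  \<open>g\<close> and the indicator of \<open>A\<close> are nonnegatively correlated.\<close>

lemma (in prob_space) chebyshev_association:
  assumes [measurable]: "g \<in> borel_measurable M" "A \<in> sets M"
    and mono: "\<And>x y. x \<in> A \<Longrightarrow> y \<in> space M - A \<Longrightarrow> g y \<le> g x"
  shows "emeasure M A * (\<integral>\<^sup>+x. g x \<partial>M) \<le> (\<integral>\<^sup>+x. indicator A x * g x \<partial>M)"
proof -
  define m where "m = (SUP y\<in>space M - A. g y)"
  define a where "a = (\<integral>\<^sup>+x. indicator A x * g x \<partial>M)"
  define c where "c = (\<integral>\<^sup>+x. indicator (space M - A) x * g x \<partial>M)"
  have "(\<integral>\<^sup>+x. m * indicator A x \<partial>M) \<le> a"
    unfolding a_def using mono by (intro nn_integral_mono) (auto simp: indicator_def m_def intro: SUP_least)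
  then have a: "m * emeasure M A \<le> a" by (simp add: nn_integral_cmult_indicator)
  have "c \<le> (\<integral>\<^sup>+x. m * indicator (space M - A) x \<partial>M)"
    unfolding c_def by (intro nn_integral_mono) (auto simp: indicator_def m_def intro: SUP_upper)
  then have c: "c \<le> m * emeasure M (space M - A)" by (subst (asm) nn_integral_cmult_indicator) auto
  have sum: "(\<integral>\<^sup>+x. g x \<partial>M) = a + c"
    unfolding a_def c_def by (subst nn_integral_add[symmetric]) (auto intro!: nn_integral_cong simp: indicator_def)
  have one: "emeasure M A + emeasure M (space M - A) = 1"
    by (subst plus_emeasure) (auto simp: emeasure_space_1 Un_absorb1 sets.sets_into_space)
  have "emeasure M A * (\<integral>\<^sup>+x. g x \<partial>M) = emeasure M A * a + emeasure M A * c"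
    by (simp add: sum distrib_left)
  also have "\<dots> \<le> emeasure M A * a + emeasure M A * (m * emeasure M (space M - A))"
    by (intro add_left_mono mult_left_mono c) auto
  also have "\<dots> = emeasure M A * a + emeasure M (space M - A) * (m * emeasure M A)"
    by (simp add: ac_simps)
  also have "\<dots> \<le> emeasure M A * a + emeasure M (space M - A) * a"
    by (intro add_left_mono mult_left_mono a) auto
  also have "\<dots> = a" by (simp add: one flip: distrib_right)
  finally show ?thesis by (simp add: a_def)
qed

text \<open>With coordinate \<open>i0\<close> carried by the first column alone, its slab becomes
  the symmetric condition \<open>A\<close> on \<open>s\<close>, while the mass \<open>g s\<close> of
  the other slabs decreases in \<open>\<bar>s\<bar>\<close>. Both are favoured by small
  \<open>s\<close>, which is the hypothesis of \<open>chebyshev_association\<close>. If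
  \<open>B' i0 = 0\<close>, then \<open>A\<close> is everything or empty and the same argument
  applies.\<close>

lemma gint_slab_insert:
  assumes I: "finite I"
  shows "gint (slab {i0} b) Bs (\<lambda>_. 0) * gint (slab I b) Bs (\<lambda>_. 0) \<le> gint (slab (insert i0 I) b) Bs (\<lambda>_. 0)"
proof (cases "Bs = []")
  case True
  then show ?thesis by (simp add: slab_def)
next
  case False
  obtain B' Bs' where B: "\<And>h u. h \<in> borel_measurable prod_borel \<Longrightarrow> gint h Bs u = gint h (B' # Bs') u"
      "\<forall>C\<in>set Bs'. C i0 = 0"
    using gint_givens[OF False, of i0] by blast
  interpret N: prob_space \<N> by (rule prob_space_std_normal)
  define k :: "real \<Rightarrow> ennreal" where "k x = (if \<bar>x\<bar> \<le> b i0 then 1 else 0)" for x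
  have [measurable]: "slab I b \<in> borel_measurable prod_borel" using I by simp
  define A where "A = {s. \<bar>s * B' i0\<bar> \<le> b i0}"
  define g where "g s = gint (slab I b) Bs' (\<lambda>i. s * B' i)" for s
  have g[measurable]: "g \<in> borel_measurable borel"
    using measurable_gint_affine[of "slab I b" "\<lambda>s. s" borel "\<lambda>_ _. 0" Bs' B'] I by (simp add: g_def[abs_def])
  have A[measurable]: "A \<in> sets \<N>" unfolding A_def by measurable
  have k1: "slab (insert i0 I) b = (\<lambda>u. k (u i0) * slab I b u)" "slab {i0} b = (\<lambda>u. k (u i0) * 1)"
    by (auto simp: slab_def k_def)
  have "gint (slab (insert i0 I) b) Bs (\<lambda>_. 0) = (\<integral>\<^sup>+s. gint (\<lambda>u. k (u i0) * slab I b u) Bs' (\<lambda>i. s * B' i) \<partial>\<N>)"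
    unfolding k1[symmetric] using I by (subst B) auto
  also have "\<dots> = (\<integral>\<^sup>+s. indicator A s * g s \<partial>\<N>)"
    using B(2) I by (subst gint_mult_invariant) (auto intro!: nn_integral_cong simp: g_def k_def A_def indicator_def)
  finally have 1: "gint (slab (insert i0 I) b) Bs (\<lambda>_. 0) = (\<integral>\<^sup>+s. indicator A s * g s \<partial>\<N>)" .
  have "gint (slab {i0} b) Bs (\<lambda>_. 0) = (\<integral>\<^sup>+s. gint (\<lambda>u. k (u i0) * 1) Bs' (\<lambda>i. s * B' i) \<partial>\<N>)"
    unfolding k1(2)[symmetric] by (subst B) auto
  also have "\<dots> = (\<integral>\<^sup>+s. indicator A s \<partial>\<N>)"
    using B(2) by (subst gint_mult_invariant) (auto intro!: nn_integral_cong simp: gint_const k_def A_def indicator_def simp del: nn_integral_indicator)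
  finally have 2: "gint (slab {i0} b) Bs (\<lambda>_. 0) = emeasure \<N> A"
    using nn_integral_indicator[OF A] by simp
  have 3: "gint (slab I b) Bs (\<lambda>_. 0) = (\<integral>\<^sup>+s. g s \<partial>\<N>)"
    by (subst B) (auto simp: g_def[abs_def] I)
  show ?thesis unfolding 1 2 3
  proof (rule N.chebyshev_association)
    fix x y assume "x \<in> A" "y \<in> space \<N> - A"
    then have "\<bar>x\<bar> * \<bar>B' i0\<bar> < \<bar>y\<bar> * \<bar>B' i0\<bar>" by (auto simp: A_def abs_mult)
    then have "\<bar>x\<bar> \<le> \<bar>y\<bar>" by (metis abs_ge_zero less_le_not_le linorder_le_cases mult_right_mono)
    then show "g y \<le> g x" unfolding g_def by (intro lc_even_decreasing lc_even_gint lc_even_slab I)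
  qed (use A in auto)
qed

lemma sidak:
  assumes "finite I"
  shows "(\<Prod>i\<in>I. gint (slab {i} b) Bs (\<lambda>_. 0)) \<le> gint (slab I b) Bs (\<lambda>_. 0)"
  using assms
proof (induction I)
  case empty
  have "slab {} b = (\<lambda>_. 1)" by (auto simp: slab_def)
  then show ?case by (simp add: gint_const)
next
  case (insert i I)
  have "(\<Prod>i\<in>insert i I. gint (slab {i} b) Bs (\<lambda>_. 0)) \<le> gint (slab {i} b) Bs (\<lambda>_. 0) * gint (slab I b) Bs (\<lambda>_. 0)"
    using insert by (auto intro: mult_left_mono)
  then show ?case using gint_slab_insert[OF insert(1), of i b Bs] by (rule order_trans)
qed

text \<open>The set is an interval of half-length at most \<open>a / v\<close> around
  \<open>- y / \<beta>\<close>, so by the sign of its centre it lies in \<open>{..a / v}\<close> or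
  in \<open>{- (a / v)..}\<close>, and these half-lines have equal mass. What matters later is a
  bound below 1 that is uniform in the shift \<open>y\<close>.\<close>

lemma emeasure_normal_shifted_interval_le:
  assumes "0 \<le> a" "0 < v" "v \<le> \<bar>\<beta>\<bar>"
  shows "emeasure \<N> {s. \<bar>y + s * \<beta>\<bar> \<le> a} \<le> emeasure \<N> {..a / v}"
proof -
  have sym: "emeasure \<N> {- c..} = emeasure \<N> {..c}" for c
  proof -
    have "emeasure \<N> {- c..} = (\<integral>\<^sup>+x. ennreal (std_normal_density x) * indicator {-c..} x \<partial>lborel)"
      by (subst emeasure_density) auto
    also have "\<dots> = (\<integral>\<^sup>+x. ennreal (std_normal_density (- x)) * indicator {-c..} (- x) \<partial>lborel)"
      by (subst nn_integral_real_affine[where c="-1" and t=0]) auto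
    also have "\<dots> = (\<integral>\<^sup>+x. ennreal (std_normal_density x) * indicator {..c} x \<partial>lborel)"
      by (intro nn_integral_cong) (auto simp: std_normal_density_def indicator_def)
    also have "\<dots> = emeasure \<N> {..c}" by (subst emeasure_density) auto
    finally show ?thesis .
  qed
  have av: "a / \<bar>\<beta>\<bar> \<le> a / v" using assms by (intro divide_left_mono) auto
  have "{s. \<bar>y + s * \<beta>\<bar> \<le> a} \<subseteq> {..a / v} \<or> {s. \<bar>y + s * \<beta>\<bar> \<le> a} \<subseteq> {- (a / v)..}"
  proof (cases "0 \<le> y * \<beta>")
    case True
    have "s \<le> a / v" if "\<bar>y + s * \<beta>\<bar> \<le> a" for s
    proof -
      have "s * \<bar>\<beta>\<bar> \<le> a" using that True assms by (auto simp: abs_if zero_le_mult_iff mult_le_0_iff split: if_splits)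
      then have "s \<le> a / \<bar>\<beta>\<bar>" using assms by (simp add: field_simps)
      then show ?thesis using av by simp
    qed
    then show ?thesis by auto
  next
    case False
    have "- (a / v) \<le> s" if "\<bar>y + s * \<beta>\<bar> \<le> a" for s
    proof -
      have "- s * \<bar>\<beta>\<bar> \<le> a" using that False assms by (auto simp: abs_if zero_le_mult_iff mult_le_0_iff split: if_splits)
      then have "- s \<le> a / \<bar>\<beta>\<bar>" using assms by (simp add: field_simps)
      then show ?thesis using av by simp
    qed
    then show ?thesis by auto
  qed
  then show ?thesis
  proof
    assume "{s. \<bar>y + s * \<beta>\<bar> \<le> a} \<subseteq> {..a / v}"
    then show ?thesis by (intro emeasure_mono) auto
  next
    assume "{s. \<bar>y + s * \<beta>\<bar> \<le> a} \<subseteq> {- (a / v)..}"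
    then have "emeasure \<N> {s. \<bar>y + s * \<beta>\<bar> \<le> a} \<le> emeasure \<N> {- (a / v)..}"
      by (intro emeasure_mono) auto
    then show ?thesis by (simp add: sym)
  qed
qed

text \<open>Each block of columns brings fresh noise to the next row, whatever the earlier rows are.\<close>

lemma gint_slab_blocks:
  fixes blk :: "nat \<Rightarrow> (nat \<Rightarrow> real) list"
  assumes a: "0 \<le> a" and v: "0 < v"
    and tri: "\<And>k i C. k < n \<Longrightarrow> C \<in> set (blk k) \<Longrightarrow> i < k \<Longrightarrow> C i = 0"
    and var: "\<And>k. k < n \<Longrightarrow> v\<^sup>2 \<le> (\<Sum>C\<leftarrow>blk k. (C k)\<^sup>2)"
  shows "gint (slab {..<n} (\<lambda>_. a)) (concat (map blk [0..<n])) u \<le> emeasure \<N> {..a / v} ^ n"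
  using tri var
proof (induction n)
  case 0
  have "slab {} (\<lambda>_::nat. a) = (\<lambda>_. 1)" by (auto simp: slab_def)
  then show ?case by simp
next
  case (Suc n)
  define q where "q = emeasure \<N> {..a / v}"
  define k :: "real \<Rightarrow> ennreal" where "k x = (if \<bar>x\<bar> \<le> a then 1 else 0)" for x
  have [measurable]: "k \<in> borel_measurable borel" unfolding k_def by measurable
  have km: "(\<lambda>u. k (u n)) \<in> borel_measurable (Pi\<^sub>M UNIV (\<lambda>_::nat. borel))" by measurable
  \<comment> \<open>Whatever the earlier noise has made of coordinate \<open>n\<close>, it acts as a
    mere shift \<open>w n\<close>; the block adds a normal variable of standard deviation at least
    \<open>v\<close>.\<close>
  have one: "gint (\<lambda>u. k (u n)) (blk n) w \<le> q" for w
  proof -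
    have v2: "v\<^sup>2 \<le> (\<Sum>C\<leftarrow>blk n. (C n)\<^sup>2)" using Suc.prems(2) by simp
    have "blk n \<noteq> []" using v2 v by (auto simp: power2_eq_square mult_le_0_iff)
    then obtain B' Bs' where B: "\<And>h u. h \<in> borel_measurable prod_borel \<Longrightarrow> gint h (blk n) u = gint h (B' # Bs') u"
      "\<forall>C\<in>set Bs'. C n = 0" "(B' n)\<^sup>2 = (\<Sum>B\<leftarrow>blk n. (B n)\<^sup>2)"
      using gint_givens[of "blk n" n] by blast
    have vb: "v \<le> \<bar>B' n\<bar>" using v2 v unfolding B(3)[symmetric] by (metis abs_le_square_iff abs_of_pos)
    have "gint (\<lambda>u. k (u n)) Bs' w' = k (w' n)" for w'
      using gint_mult_invariant[of "\<lambda>_. 1" Bs' n k w'] B(2) by (simp add: gint_const)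
    then have "gint (\<lambda>u. k (u n)) (blk n) w = (\<integral>\<^sup>+s. k (w n + s * B' n) \<partial>\<N>)"
      using B(1)[OF km, of w] by simp
    also have "\<dots> = (\<integral>\<^sup>+s. indicator {s. \<bar>w n + s * B' n\<bar> \<le> a} s \<partial>\<N>)"
      by (intro nn_integral_cong) (auto simp: k_def)
    also have "\<dots> = emeasure \<N> {s. \<bar>w n + s * B' n\<bar> \<le> a}"
      by (rule nn_integral_indicator) simp
    also have "\<dots> \<le> q" unfolding q_def by (intro emeasure_normal_shifted_interval_le a v vb)
    finally show ?thesis .
  qed
  \<comment> \<open>Columns of the last block vanish in the rows below \<open>n\<close>, so the
    constraints on those rows leave the integral as a factor.\<close>
  have low: "gint (\<lambda>v. slab {..<n} (\<lambda>_. a) v * k (v n)) Bs w = slab {..<n} (\<lambda>_. a) w * gint (\<lambda>u. k (u n)) Bs w"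
    if "\<And>C i. C \<in> set Bs \<Longrightarrow> i < n \<Longrightarrow> C i = 0" for Bs w
    using that
  proof (induction Bs arbitrary: w)
    case (Cons B Bs)
    have "slab {..<n} (\<lambda>_. a) (\<lambda>i. w i + s * B i) = slab {..<n} (\<lambda>_. a) w" for s
      using Cons.prems[of B] by (simp add: slab_def)
    moreover have "(\<lambda>s. gint (\<lambda>u. k (u n)) Bs (\<lambda>i. w i + s * B i)) \<in> borel_measurable \<N>"
      using km by measurable
    ultimately show ?case using Cons by (simp add: nn_integral_cmult)
  qed simp
  have eq: "slab {..<Suc n} (\<lambda>_. a) = (\<lambda>v. slab {..<n} (\<lambda>_. a) v * k (v n))"
    by (auto simp: slab_def k_def less_Suc_eq fun_eq_iff)
  have "gint (slab {..<Suc n} (\<lambda>_. a)) (concat (map blk [0..<Suc n])) u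
      = gint (\<lambda>w. slab {..<n} (\<lambda>_. a) w * gint (\<lambda>u. k (u n)) (blk n) w) (concat (map blk [0..<n])) u"
    using Suc.prems(1)[of n] low[of "blk n"] by (simp add: gint_append eq gint_cong[where h="gint _ (blk n)"])
  also have "\<dots> \<le> gint (\<lambda>w. q * slab {..<n} (\<lambda>_. a) w) (concat (map blk [0..<n])) u"
    by (intro gint_mono) (auto simp: slab_def intro: one)
  also have "\<dots> = q * gint (slab {..<n} (\<lambda>_. a)) (concat (map blk [0..<n])) u"
    by (intro gint_cmult) simp
  also have "\<dots> \<le> q * q ^ n"
  proof (intro mult_left_mono)
    show "gint (slab {..<n} (\<lambda>_. a)) (concat (map blk [0..<n])) u \<le> q ^ n"
      unfolding q_def
    proof (rule Suc.IH)
      show "C i = 0" if "k < n" "C \<in> set (blk k)" "i < k" for k i C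
        using Suc.prems(1)[of k C i] that by simp
      show "v\<^sup>2 \<le> (\<Sum>C\<leftarrow>blk k. (C k)\<^sup>2)" if "k < n" for k
        using Suc.prems(2)[of k] that by simp
    qed
  qed simp
  finally show ?case by (simp add: q_def)
qed

section \<open>Brownian increments and step functions\<close>

text \<open>Taking the last coordinate out of the product measure replaces \<open>h\<close> by
  \<open>gint h [B m]\<close>, so the induction must leave \<open>h\<close> arbitrary;
  \<open>gint_append\<close> then puts the column back at the end of the list.\<close>

lemma nn_integral_PiM_normal_linear:
  fixes B :: "nat \<Rightarrow> 'i \<Rightarrow> real"
  assumes "h \<in> borel_measurable prod_borel"
  shows "(\<integral>\<^sup>+x. h (\<lambda>i. u i + (\<Sum>j<m. x j * B j i)) \<partial>(Pi\<^sub>M {..<m} (\<lambda>_. \<N>)))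
      = gint h (map B [0..<m]) u"
  using assms
proof (induction m arbitrary: h u)
  case 0
  then show ?case by (simp add: PiM_empty)
next
  case (Suc m)
  note h[measurable] = Suc.prems
  interpret N: prob_space \<N> by (rule prob_space_std_normal)
  interpret P: product_prob_space "\<lambda>_::nat. \<N>" by standard
  have S: "{..<Suc m} = insert m {..<m}" by auto
  have meas: "(\<lambda>x i. u i + (\<Sum>j<Suc m. x j * B j i)) \<in>
      measurable (Pi\<^sub>M {..<Suc m} (\<lambda>_. \<N>)) (Pi\<^sub>M UNIV (\<lambda>_. borel :: real measure))"
  proof (rule measurable_PiM_single')
    fix i :: 'i
    have "(\<lambda>x. x j) \<in> borel_measurable (Pi\<^sub>M {..<Suc m} (\<lambda>_. \<N>))" if "j < Suc m" for j
      using measurable_component_singleton[of j "{..<Suc m}" "\<lambda>_. \<N>"] that by simp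
    then show "(\<lambda>x. u i + (\<Sum>j<Suc m. x j * B j i)) \<in> borel_measurable (Pi\<^sub>M {..<Suc m} (\<lambda>_. \<N>))"
      by (intro borel_measurable_add borel_measurable_sum borel_measurable_times) auto
  qed auto
  have "(\<integral>\<^sup>+x. h (\<lambda>i. u i + (\<Sum>j<Suc m. x j * B j i)) \<partial>(Pi\<^sub>M {..<Suc m} (\<lambda>_. \<N>)))
     = (\<integral>\<^sup>+x. \<integral>\<^sup>+y. h (\<lambda>i. u i + (\<Sum>j<Suc m. (x(m := y)) j * B j i)) \<partial>\<N> \<partial>(Pi\<^sub>M {..<m} (\<lambda>_. \<N>)))"
    using measurable_compose[OF meas h] unfolding S by (subst P.product_nn_integral_insert) auto
  also have "\<dots> = (\<integral>\<^sup>+x. gint h [B m] (\<lambda>i. u i + (\<Sum>j<m. x j * B j i)) \<partial>(Pi\<^sub>M {..<m} (\<lambda>_. \<N>)))"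
    by (simp add: add.assoc)
  also have "\<dots> = gint (gint h [B m]) (map B [0..<m]) u"
    by (intro Suc.IH measurable_gint h)
  also have "\<dots> = gint h (map B [0..<Suc m]) u" by (simp add: gint_append)
  finally show ?case .
qed

text \<open>Increments over disjoint cells, divided by their standard deviations, are independent
  standard normals, so their joint law is the product measure. A strictly increasing grid keeps the
  divisors positive.\<close>

lemma brownian_increments_gint:
  fixes B :: "nat \<Rightarrow> 'i \<Rightarrow> real"
  assumes bm: "standard_brownian_motion M W" and s: "strict_mono_on {..m} s" "0 \<le> s 0"
    and h: "h \<in> borel_measurable prod_borel"
  shows "(\<integral>\<^sup>+\<omega>. h (\<lambda>i. \<Sum>j<m. (W (s (Suc j)) \<omega> - W (s j) \<omega>) / sqrt (s (Suc j) - s j) * B j i) \<partial>M)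
      = gint h (map B [0..<m]) (\<lambda>_. 0)"
proof -
  interpret prob_space M using bm by (simp add: standard_brownian_motion_def)
  define g where "g j \<omega> = (W (s (Suc j)) \<omega> - W (s j) \<omega>) / sqrt (s (Suc j) - s j)" for j \<omega>
  show ?thesis
  proof (cases "m = 0")
    case True
    then show ?thesis by (simp add: emeasure_space_1)
  next
    case False
    have mono: "mono_on {..m} s" by (rule strict_mono_on_imp_mono_on[OF s(1)])
    have less: "s j < s (Suc j)" if "j < m" for j
      using s(1) that by (auto simp: strict_mono_on_def)
    have nn: "0 \<le> s j" if "j \<le> m" for j
      using mono s(2) that by (auto simp: monotone_on_def intro: order_trans)
    have "indep_vars (\<lambda>_. borel) (\<lambda>j \<omega>. W (s (Suc j)) \<omega> - W (s j) \<omega>) {..<m}"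
      using bm mono s(2) by (auto simp: standard_brownian_motion_def)
    then have ind: "indep_vars (\<lambda>_. borel) g {..<m}"
      unfolding g_def by (rule indep_vars_compose2[where Y="\<lambda>j x. x / sqrt (s (Suc j) - s j)"]) simp
    have g: "distributed M lborel (g j) std_normal_density" if "j < m" for j
    proof -
      have "distributed M lborel (\<lambda>\<omega>. W (s (Suc j)) \<omega> - W (s j) \<omega>) (normal_density 0 (sqrt (s (Suc j) - s j)))"
        using bm less[OF that] nn[of j] that by (auto simp: standard_brownian_motion_def)
      then show ?thesis
        using normal_standard_normal_convert[of "sqrt (s (Suc j) - s j)" "\<lambda>\<omega>. W (s (Suc j)) \<omega> - W (s j) \<omega>" 0] less[OF that]
        by (simp add: g_def[abs_def])
    qed
    have gm: "g j \<in> borel_measurable M" if "j < m" for j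
      using g[OF that] by (auto simp: distributed_def)
    have dg: "distr M borel (g j) = \<N>" if "j < m" for j
      using g[OF that] by (auto simp: distributed_def cong: distr_cong)
    have "distr M (Pi\<^sub>M {..<m} (\<lambda>_. borel)) (\<lambda>\<omega>. \<lambda>j\<in>{..<m}. g j \<omega>) = Pi\<^sub>M {..<m} (\<lambda>j. distr M borel (g j))"
      using ind False gm by (subst indep_vars_iff_distr_eq_PiM'[symmetric]) auto
    also have "\<dots> = Pi\<^sub>M {..<m} (\<lambda>_. \<N>)"
      using dg by (intro PiM_cong) auto
    finally have D: "distr M (Pi\<^sub>M {..<m} (\<lambda>_. borel)) (\<lambda>\<omega>. \<lambda>j\<in>{..<m}. g j \<omega>) = Pi\<^sub>M {..<m} (\<lambda>_. \<N>)" .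
    have meas: "(\<lambda>x i. \<Sum>j<m. x j * B j i) \<in>
      measurable (Pi\<^sub>M {..<m} (\<lambda>_. borel :: real measure)) (Pi\<^sub>M UNIV (\<lambda>_. borel :: real measure))"
    proof (rule measurable_PiM_single')
      fix i :: 'i
      show "(\<lambda>x. (\<Sum>j<m. x j * B j i)) \<in> borel_measurable (Pi\<^sub>M {..<m} (\<lambda>_. borel))"
        by (intro borel_measurable_sum borel_measurable_times measurable_component_singleton) auto
    qed auto
    have "gint h (map B [0..<m]) (\<lambda>_. 0) = (\<integral>\<^sup>+x. h (\<lambda>i. \<Sum>j<m. x j * B j i) \<partial>(Pi\<^sub>M {..<m} (\<lambda>_. \<N>)))"
      using nn_integral_PiM_normal_linear[OF h, where u="\<lambda>_. 0" and B=B and m=m] by simp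
    also have "\<dots> = (\<integral>\<^sup>+\<omega>. h (\<lambda>i. \<Sum>j<m. (\<lambda>j\<in>{..<m}. g j \<omega>) j * B j i) \<partial>M)"
      unfolding D[symmetric] using gm measurable_compose[OF meas h]
      by (intro nn_integral_distr measurable_restrict) auto
    also have "\<dots> = (\<integral>\<^sup>+\<omega>. h (\<lambda>i. \<Sum>j<m. g j \<omega> * B j i) \<partial>M)"
      by (intro nn_integral_cong arg_cong[where f=h] ext sum.cong) auto
    finally show ?thesis by (simp add: g_def)
  qed
qed

section \<open>Step functions on a common grid\<close>

text \<open>A triple holds coefficient, left end and right end. The intervals of a list may overlap;
  a partition is chosen only when several lists have to share one.\<close>

definition stepf :: "(real \<times> real \<times> real) list \<Rightarrow> real \<Rightarrow> real" where
  "stepf l r = (\<Sum>(c, a, b)\<leftarrow>l. c * indicator {a<..b} r)"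

definition stepW :: "(real \<Rightarrow> 'a \<Rightarrow> real) \<Rightarrow> (real \<times> real \<times> real) list \<Rightarrow> 'a \<Rightarrow> real" where
  "stepW W l \<omega> = (\<Sum>(c, a, b)\<leftarrow>l. c * (W b \<omega> - W a \<omega>))"

lemma finite_real_set_enumeration:
  fixes S :: "real set"
  assumes "finite S" "S \<noteq> {}"
  obtains m s where "strict_mono_on {..m::nat} s" "s ` {..m} = S"
proof -
  define xs where "xs = sorted_list_of_set S"
  have xs: "set xs = S" "xs \<noteq> []" using assms by (auto simp: xs_def)
  have st: "sorted_wrt (<) xs" by (simp add: xs_def)
  have "strict_mono_on {..length xs - 1} ((!) xs)"
    using xs(2) by (auto intro!: strict_mono_onI sorted_wrt_nth_less[OF st] simp: length_greater_0_conv)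
  moreover have "(!) xs ` {..length xs - 1} = S"
  proof -
    have "{..length xs - 1} = {0..<length xs}" using xs(2) by (cases xs) auto
    then show ?thesis using xs(1) by (simp only: nth_image) simp
  qed
  ultimately show ?thesis using that by blast
qed

lemma stepf_measurable [measurable]: "stepf l \<in> borel_measurable borel"
proof (induction l)
  case (Cons x xs)
  obtain c a b where x: "x = (c, a, b)" by (cases x)
  note [measurable] = Cons
  have "stepf (x # xs) = (\<lambda>r. c * indicator {a<..b} r + stepf xs r)" by (auto simp: stepf_def x)
  then show ?case by simp
qed (simp add: stepf_def[abs_def])

context
  fixes m :: nat and s :: "nat \<Rightarrow> real" and l :: "(real \<times> real \<times> real) list"
  assumes s: "strict_mono_on {..m} s"
    and l: "\<And>c a b. (c, a, b) \<in> set l \<Longrightarrow> a \<in> s ` {..m} \<and> b \<in> s ` {..m} \<and> a \<le> b"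
begin

lemma grid_less_iff: "i \<le> m \<Longrightarrow> j \<le> m \<Longrightarrow> s i < s j \<longleftrightarrow> i < j"
  using s by (auto simp: strict_mono_on_def) (metis not_less_iff_gr_or_eq)

lemma grid_le_iff: "i \<le> m \<Longrightarrow> j \<le> m \<Longrightarrow> s i \<le> s j \<longleftrightarrow> i \<le> j"
  by (metis linorder_not_less grid_less_iff)

text \<open>Each increment over \<open>(a, b]\<close> telescopes over the cells inside it. A cell is
  represented by its right end because the intervals are open on the left.\<close>

lemma stepW_grid:
  "stepW W l \<omega> = (\<Sum>j<m. stepf l (s (Suc j)) * (W (s (Suc j)) \<omega> - W (s j) \<omega>))"
  using l
proof (induction l)
  case (Cons x xs)
  obtain c a b where x: "x = (c, a, b)" by (cases x)
  obtain p q where pq: "a = s p" "b = s q" "p \<le> m" "q \<le> m" and "a \<le> b"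
    using Cons.prems[of c a b] x by auto
  then have "p \<le> q" using grid_le_iff by auto
  have "(\<Sum>j<m. c * indicator {a<..b} (s (Suc j)) * (W (s (Suc j)) \<omega> - W (s j) \<omega>))
      = (\<Sum>j<m. if j \<in> {p..<q} then c * (W (s (Suc j)) \<omega> - W (s j) \<omega>) else 0)"
    using pq by (intro sum.cong) (auto simp: indicator_def grid_less_iff grid_le_iff)
  also have "\<dots> = (\<Sum>j\<in>{p..<q}. c * (W (s (Suc j)) \<omega> - W (s j) \<omega>))"
    using pq by (subst sum.inter_restrict[symmetric]) (auto intro!: sum.cong)
  also have "\<dots> = c * (W b \<omega> - W a \<omega>)"
    unfolding sum_distrib_left[symmetric] using sum_Suc_diff'[OF \<open>p \<le> q\<close>, of "\<lambda>j. W (s j) \<omega>"] pq by simp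
  finally have "(\<Sum>j<m. c * indicator {a<..b} (s (Suc j)) * (W (s (Suc j)) \<omega> - W (s j) \<omega>)) = c * (W b \<omega> - W a \<omega>)" .
  moreover have "stepW W xs \<omega> = (\<Sum>j<m. stepf xs (s (Suc j)) * (W (s (Suc j)) \<omega> - W (s j) \<omega>))"
    using Cons by auto
  ultimately show ?case by (simp add: x stepW_def stepf_def distrib_right sum.distrib)
qed (simp add: stepW_def stepf_def)

text \<open>No endpoint of \<open>l\<close> lies strictly inside a cell, so no interval of the list
  separates \<open>r\<close> from the right end.\<close>

lemma stepf_grid:
  assumes "j < m" "r \<in> {s j<..s (Suc j)}"
  shows "stepf l r = stepf l (s (Suc j))"
proof -
  have "(indicator {a<..b} r :: real) = indicator {a<..b} (s (Suc j))" if cab: "(c, a, b) \<in> set l" for c a b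
  proof -
    obtain p q where pq: "a = s p" "b = s q" "p \<le> m" "q \<le> m" using l[OF cab] by auto
    have "a < r \<longleftrightarrow> a < s (Suc j)"
    proof
      assume "a < s (Suc j)"
      then have "a \<le> s j" using pq assms by (simp add: grid_less_iff grid_le_iff)
      then show "a < r" using assms by simp
    qed (use assms in auto)
    moreover have "r \<le> b \<longleftrightarrow> s (Suc j) \<le> b"
    proof
      assume "r \<le> b"
      then have "s j < b" using assms by simp
      then show "s (Suc j) \<le> b" using pq assms by (simp add: grid_less_iff grid_le_iff)
    qed (use assms in auto)
    ultimately show ?thesis by (auto simp: indicator_def)
  qed
  then show ?thesis unfolding stepf_def by (intro arg_cong[where f=sum_list] map_cong) auto
qed

lemma stepf_outside: "r \<notin> {s 0<..s m} \<Longrightarrow> stepf l r = 0"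
proof -
  assume r: "r \<notin> {s 0<..s m}"
  have "indicator {a<..b} r = (0::real)" if cab: "(c, a, b) \<in> set l" for c a b
  proof -
    obtain p q where pq: "a = s p" "b = s q" "p \<le> m" "q \<le> m" using l[OF cab] by auto
    then have "s 0 \<le> a" "b \<le> s m" by (auto simp: grid_le_iff)
    then show ?thesis using r by auto
  qed
  then have "stepf l r = (\<Sum>(c, a, b)\<leftarrow>l. 0)"
    unfolding stepf_def by (intro arg_cong[where f=sum_list] map_cong) auto
  also have "\<dots> = 0" by (induction l) auto
  finally show ?thesis .
qed

text \<open>The summands are squares of the column entries in \<open>stepW_slab_gint\<close>, so
  this is the Ito isometry on the grid. Partial ranges of cells measure the noise contributed by a
  single block.\<close>

lemma nn_integral_stepf_square:
  assumes "p \<le> q" "q \<le> m"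
  shows "(\<integral>\<^sup>+r\<in>{s p<..s q}. ennreal ((stepf l r)\<^sup>2) \<partial>lborel)
     = ennreal (\<Sum>j\<in>{p..<q}. (stepf l (s (Suc j)) * sqrt (s (Suc j) - s j))\<^sup>2)"
  using assms
proof (induction q rule: dec_induct)
  case base
  then show ?case by simp
next
  case (step k)
  have le: "s p \<le> s k" "s k < s (Suc k)" using step by (auto simp: grid_le_iff grid_less_iff)
  have "{s p<..s (Suc k)} = {s p<..s k} \<union> {s k<..s (Suc k)}" using le by auto
  then have "(\<integral>\<^sup>+r\<in>{s p<..s (Suc k)}. ennreal ((stepf l r)\<^sup>2) \<partial>lborel)
     = (\<integral>\<^sup>+r\<in>{s p<..s k}. ennreal ((stepf l r)\<^sup>2) \<partial>lborel) + (\<integral>\<^sup>+r\<in>{s k<..s (Suc k)}. ennreal ((stepf l r)\<^sup>2) \<partial>lborel)"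
    by (simp only:) (rule nn_integral_disjoint_pair, auto)
  also have "(\<integral>\<^sup>+r\<in>{s k<..s (Suc k)}. ennreal ((stepf l r)\<^sup>2) \<partial>lborel)
     = (\<integral>\<^sup>+r\<in>{s k<..s (Suc k)}. ennreal ((stepf l (s (Suc k)))\<^sup>2) \<partial>lborel)"
  proof (intro nn_integral_cong)
    fix r
    show "ennreal ((stepf l r)\<^sup>2) * indicator {s k<..s (Suc k)} r = ennreal ((stepf l (s (Suc k)))\<^sup>2) * indicator {s k<..s (Suc k)} r"
    proof (cases "r \<in> {s k<..s (Suc k)}")
      case True
      then have "stepf l r = stepf l (s (Suc k))" using step by (intro stepf_grid) auto
      then show ?thesis by (simp only:)
    qed simp
  qed
  also have "\<dots> = ennreal ((stepf l (s (Suc k)) * sqrt (s (Suc k) - s k))\<^sup>2)"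
    using le by (simp add: nn_integral_cmult_indicator power_mult_distrib flip: ennreal_mult)
  finally show ?case using step by (simp add: sum_nonneg flip: ennreal_plus)
qed

lemma nn_integral_stepf_square_UNIV:
  "(sqint lborel (\<lambda>r. stepf l r)) = ennreal (\<Sum>j<m. (stepf l (s (Suc j)) * sqrt (s (Suc j) - s j))\<^sup>2)"
proof -
  have "(sqint lborel (\<lambda>r. stepf l r)) = (\<integral>\<^sup>+r\<in>{s 0<..s m}. ennreal ((stepf l r)\<^sup>2) \<partial>lborel)"
    using stepf_outside by (intro nn_integral_cong) (auto simp: indicator_def)
  then show ?thesis using nn_integral_stepf_square[of 0 m] by (simp add: atLeast0LessThan)
qed

end

section \<open>Approximation of Wiener integrals\<close>

text \<open>The Wiener integral with integrands extended by zero to the whole line and step functions given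
  by lists, so that differences of integrals over different intervals stay in the class.\<close>

definition wapprox :: "'a measure \<Rightarrow> (real \<Rightarrow> 'a \<Rightarrow> real) \<Rightarrow> real \<Rightarrow> (real \<Rightarrow> real) \<Rightarrow> ('a \<Rightarrow> real) \<Rightarrow> bool" where
  "wapprox M W T f Y \<longleftrightarrow> f \<in> borel_measurable borel \<and> Y \<in> borel_measurable M \<and>
     (\<exists>l :: nat \<Rightarrow> (real \<times> real \<times> real) list.
        (\<forall>k. \<forall>(c, a, b)\<in>set (l k). 0 \<le> a \<and> a \<le> b \<and> b \<le> T) \<and>
        (\<lambda>k. sqint lborel (\<lambda>r. f r - stepf (l k) r)) \<longlonglongrightarrow> 0 \<and>
        (\<lambda>k. sqint M (\<lambda>\<omega>. Y \<omega> - stepW W (l k) \<omega>)) \<longlonglongrightarrow> 0)"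

lemma stepW_measurable:
  assumes "standard_brownian_motion M W" "\<And>c a b. (c, a, b) \<in> set l \<Longrightarrow> 0 \<le> a \<and> a \<le> b"
  shows "stepW W l \<in> borel_measurable M"
  using assms(2)
proof (induction l)
  case (Cons x xs)
  obtain c a b where x: "x = (c, a, b)" by (cases x)
  have [measurable]: "W a \<in> borel_measurable M" "W b \<in> borel_measurable M"
    using Cons.prems[of c a b] assms(1) by (auto simp: x standard_brownian_motion_def)
  have [measurable]: "stepW W xs \<in> borel_measurable M" using Cons by auto
  have "stepW W (x # xs) = (\<lambda>\<omega>. c * (W b \<omega> - W a \<omega>) + stepW W xs \<omega>)" by (auto simp: stepW_def x)
  then show ?case by simp
qed (simp add: stepW_def[abs_def])

lemma stepf_eq_0:
  assumes "\<And>c a b. (c, a, b) \<in> set l \<Longrightarrow> r \<le> a \<or> b < r"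
  shows "stepf l r = 0"
  using assms
proof (induction l)
  case (Cons x xs)
  obtain c a b where x: "x = (c, a, b)" by (cases x)
  have "indicator {a<..b} r = (0::real)" using Cons.prems[of c a b] x by auto
  moreover have "stepf xs r = 0" using Cons by auto
  ultimately show ?case by (simp add: stepf_def x)
qed (simp add: stepf_def)

text \<open>Outside \<open>[0, T]\<close> the approximating step functions vanish together with the
  extended integrand, so the extension leaves all distances unchanged.\<close>

lemma has_wiener_integral_imp_wapprox:
  assumes "has_wiener_integral M W f T Y"
  shows "wapprox M W T (\<lambda>r. indicator {0..T} r * f r) Y"
proof -
  from assms obtain n p c where
    m: "set_borel_measurable lborel {0..T} f" "Y \<in> borel_measurable M"
    and p: "\<And>k. mono_on {..n k} (p k)" "\<And>k. p k ` {..n k} \<subseteq> {0..T}"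
    and l1: "(\<lambda>k. \<integral>\<^sup>+r\<in>{0..T}. ennreal ((f r - step_function (n k) (p k) (c k) r)\<^sup>2) \<partial>lborel) \<longlonglongrightarrow> 0"
    and l2: "(\<lambda>k. sqint M (\<lambda>\<omega>. Y \<omega> - step_integral W (n k) (p k) (c k) \<omega>)) \<longlonglongrightarrow> 0"
    unfolding has_wiener_integral_def by blast
  define l where "l k = map (\<lambda>i. (c k i, p k i, p k (Suc i))) [0..<n k]" for k
  have set_l: "0 \<le> a \<and> a \<le> b \<and> b \<le> T" if abc: "(d, a, b) \<in> set (l k)" for k d a b
  proof -
    obtain i where i: "i < n k" "a = p k i" "b = p k (Suc i)" using abc by (auto simp: l_def)
    then have "p k i \<in> p k ` {..n k}" "p k (Suc i) \<in> p k ` {..n k}" by auto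
    then have "p k i \<in> {0..T}" "p k (Suc i) \<in> {0..T}" using subsetD[OF p(2)[of k]] by blast+
    moreover have "p k i \<le> p k (Suc i)" using p(1)[of k] i by (auto simp: monotone_on_def)
    ultimately show ?thesis using i by auto
  qed
  have sf: "stepf (l k) r = step_function (n k) (p k) (c k) r" for k r
    by (simp add: stepf_def l_def step_function_def comp_def interv_sum_list_conv_sum_set_nat atLeast0LessThan)
  have sW: "stepW W (l k) \<omega> = step_integral W (n k) (p k) (c k) \<omega>" for k \<omega>
    by (simp add: stepW_def l_def step_integral_def comp_def interv_sum_list_conv_sum_set_nat atLeast0LessThan)
  have "(sqint lborel (\<lambda>r. indicator {0..T} r * f r - stepf (l k) r))
    = (\<integral>\<^sup>+r\<in>{0..T}. ennreal ((f r - step_function (n k) (p k) (c k) r)\<^sup>2) \<partial>lborel)" for k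
  proof (intro nn_integral_cong)
    fix r
    show "ennreal ((indicator {0..T} r * f r - stepf (l k) r)\<^sup>2)
      = ennreal ((f r - step_function (n k) (p k) (c k) r)\<^sup>2) * indicator {0..T} r"
    proof (cases "r \<in> {0..T}")
      case False
      have "stepf (l k) r = 0"
      proof (rule stepf_eq_0)
        fix d a b assume "(d, a, b) \<in> set (l k)"
        from set_l[OF this] show "r \<le> a \<or> b < r" using False by auto
      qed
      then show ?thesis using False by simp
    qed (simp add: sf)
  qed
  moreover have "(\<lambda>r. indicator {0..T} r * f r) \<in> borel_measurable borel"
    using m(1) by (simp add: set_borel_measurable_def)
  ultimately show ?thesis
    unfolding wapprox_def using m(2) l1 l2 set_l by (intro conjI exI[of _ l]) (auto simp: sW)
qed

lemma wapprox_mono: "wapprox M W T f Y \<Longrightarrow> T \<le> T' \<Longrightarrow> wapprox M W T' f Y"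
  unfolding wapprox_def by (auto simp: split_beta') (meson order_trans)

lemma nn_integral_diff_square_le:
  fixes f g :: "'a \<Rightarrow> real"
  assumes [measurable]: "f \<in> borel_measurable M" "g \<in> borel_measurable M"
  shows "(sqint M (\<lambda>x. f x - g x)) \<le> 2 * (sqint M (\<lambda>x. f x)) + 2 * (sqint M (\<lambda>x. g x))"
proof -
  have "(sqint M (\<lambda>x. f x - g x)) \<le> (\<integral>\<^sup>+x. 2 * ennreal ((f x)\<^sup>2) + 2 * ennreal ((g x)\<^sup>2) \<partial>M)"
  proof (intro nn_integral_mono)
    fix x
    have "0 \<le> (f x + g x)\<^sup>2" by simp
    then have "(f x - g x)\<^sup>2 \<le> 2 * (f x)\<^sup>2 + 2 * (g x)\<^sup>2" by (simp add: power2_eq_square algebra_simps)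
    then have "ennreal ((f x - g x)\<^sup>2) \<le> ennreal (2 * (f x)\<^sup>2 + 2 * (g x)\<^sup>2)" by (rule ennreal_leI)
    also have "\<dots> = 2 * ennreal ((f x)\<^sup>2) + 2 * ennreal ((g x)\<^sup>2)" by (simp add: ennreal_mult)
    finally show "ennreal ((f x - g x)\<^sup>2) \<le> 2 * ennreal ((f x)\<^sup>2) + 2 * ennreal ((g x)\<^sup>2)" .
  qed
  also have "\<dots> = 2 * (sqint M (\<lambda>x. f x)) + 2 * (sqint M (\<lambda>x. g x))"
    by (subst nn_integral_add) (auto simp: nn_integral_cmult)
  finally show ?thesis .
qed

lemma ennreal_tendsto_0_le_add:
  fixes a b c :: "nat \<Rightarrow> ennreal"
  assumes "a \<longlonglongrightarrow> 0" "b \<longlonglongrightarrow> 0" "\<And>k. c k \<le> 2 * a k + 2 * b k"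
  shows "c \<longlonglongrightarrow> 0"
proof (rule tendsto_sandwich[OF _ _ tendsto_const])
  have "(\<lambda>k. 2 * a k + 2 * b k) \<longlonglongrightarrow> 2 * 0 + 2 * 0"
    using assms by (intro tendsto_add ennreal_tendsto_cmult) auto
  then show "(\<lambda>k. 2 * a k + 2 * b k) \<longlonglongrightarrow> 0" by simp
qed (use assms in auto)

lemma wapprox_diff:
  assumes bm: "standard_brownian_motion M W" and f: "wapprox M W T f Y" and g: "wapprox M W T g Z"
  shows "wapprox M W T (\<lambda>r. f r - g r) (\<lambda>\<omega>. Y \<omega> - Z \<omega>)"
proof -
  obtain l1 where f': "f \<in> borel_measurable borel" "Y \<in> borel_measurable M"
    and l1: "\<And>k c a b. (c, a, b) \<in> set (l1 k) \<Longrightarrow> 0 \<le> a \<and> a \<le> b \<and> b \<le> T"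
     "(\<lambda>k. sqint lborel (\<lambda>r. f r - stepf (l1 k) r)) \<longlonglongrightarrow> 0"
     "(\<lambda>k. sqint M (\<lambda>\<omega>. Y \<omega> - stepW W (l1 k) \<omega>)) \<longlonglongrightarrow> 0"
    using f unfolding wapprox_def by blast
  obtain l2 where g': "g \<in> borel_measurable borel" "Z \<in> borel_measurable M"
    and l2: "\<And>k c a b. (c, a, b) \<in> set (l2 k) \<Longrightarrow> 0 \<le> a \<and> a \<le> b \<and> b \<le> T"
     "(\<lambda>k. sqint lborel (\<lambda>r. g r - stepf (l2 k) r)) \<longlonglongrightarrow> 0"
     "(\<lambda>k. sqint M (\<lambda>\<omega>. Z \<omega> - stepW W (l2 k) \<omega>)) \<longlonglongrightarrow> 0"
    using g unfolding wapprox_def by blast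
  note [measurable] = f' g'
  have [measurable]: "stepW W (l1 k) \<in> borel_measurable M" "stepW W (l2 k) \<in> borel_measurable M" for k
    using l1(1) l2(1) by (auto intro!: stepW_measurable[OF bm])
  define neg :: "(real \<times> real \<times> real) list \<Rightarrow> (real \<times> real \<times> real) list" where "neg = map (\<lambda>(c, a, b). (- c, a, b))"
  have neg: "stepf (neg l) r = - stepf l r" "stepW W (neg l) \<omega> = - stepW W l \<omega>" for l :: "(real \<times> real \<times> real) list" and r \<omega>
    by (induction l) (auto simp: neg_def stepf_def stepW_def algebra_simps)
  define l where "l k = l1 k @ neg (l2 k)" for k
  have lf: "stepf (l k) r = stepf (l1 k) r - stepf (l2 k) r" for k r
    using neg(1)[of "l2 k" r] by (simp add: l_def stepf_def)
  have lW: "stepW W (l k) \<omega> = stepW W (l1 k) \<omega> - stepW W (l2 k) \<omega>" for k \<omega>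
    using neg(2)[of "l2 k" \<omega>] by (simp add: l_def stepW_def)
  have "\<forall>k. \<forall>(c, a, b)\<in>set (l k). 0 \<le> a \<and> a \<le> b \<and> b \<le> T"
    using l1(1) l2(1) by (auto simp: l_def neg_def)
  moreover have "(\<lambda>k. sqint lborel (\<lambda>r. f r - g r - stepf (l k) r)) \<longlonglongrightarrow> 0"
  proof (rule ennreal_tendsto_0_le_add[OF l1(2) l2(2)])
    fix k
    have "(sqint lborel (\<lambda>r. f r - g r - stepf (l k) r))
      = (sqint lborel (\<lambda>r. (f r - stepf (l1 k) r) - (g r - stepf (l2 k) r)))"
      by (simp add: lf algebra_simps)
    also have "\<dots> \<le> 2 * (sqint lborel (\<lambda>r. f r - stepf (l1 k) r)) + 2 * (sqint lborel (\<lambda>r. g r - stepf (l2 k) r))"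
      by (rule nn_integral_diff_square_le) measurable
    finally show "(sqint lborel (\<lambda>r. f r - g r - stepf (l k) r)) \<le> \<dots>" .
  qed
  moreover have "(\<lambda>k. sqint M (\<lambda>\<omega>. Y \<omega> - Z \<omega> - stepW W (l k) \<omega>)) \<longlonglongrightarrow> 0"
  proof (rule ennreal_tendsto_0_le_add[OF l1(3) l2(3)])
    fix k
    have "(sqint M (\<lambda>\<omega>. Y \<omega> - Z \<omega> - stepW W (l k) \<omega>))
      = (sqint M (\<lambda>\<omega>. (Y \<omega> - stepW W (l1 k) \<omega>) - (Z \<omega> - stepW W (l2 k) \<omega>)))"
      by (simp add: lW algebra_simps)
    also have "\<dots> \<le> 2 * (sqint M (\<lambda>\<omega>. Y \<omega> - stepW W (l1 k) \<omega>)) + 2 * (sqint M (\<lambda>\<omega>. Z \<omega> - stepW W (l2 k) \<omega>))"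
      by (rule nn_integral_diff_square_le) measurable
    finally show "(sqint M (\<lambda>\<omega>. Y \<omega> - Z \<omega> - stepW W (l k) \<omega>)) \<le> \<dots>" .
  qed
  ultimately show ?thesis
    unfolding wapprox_def by (intro conjI exI[of _ l]) auto
qed

lemma (in prob_space) tendsto_prob_of_L2:
  assumes [measurable]: "Y \<in> borel_measurable M" "\<And>k. Z k \<in> borel_measurable M"
    and lim: "(\<lambda>k. sqint M (\<lambda>\<omega>. Y \<omega> - Z k \<omega>)) \<longlonglongrightarrow> 0" and d: "0 < d"
  shows "(\<lambda>k. prob {\<omega>\<in>space M. d < \<bar>Y \<omega> - Z k \<omega>\<bar>}) \<longlonglongrightarrow> 0"
proof -
  have "emeasure M {\<omega>\<in>space M. d < \<bar>Y \<omega> - Z k \<omega>\<bar>} \<le> ennreal (1 / d\<^sup>2) * (sqint M (\<lambda>\<omega>. Y \<omega> - Z k \<omega>))" for k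
  proof -
    have "{\<omega>\<in>space M. d < \<bar>Y \<omega> - Z k \<omega>\<bar>} \<subseteq> {\<omega>\<in>space M. 1 \<le> ennreal (1 / d\<^sup>2) * ennreal ((Y \<omega> - Z k \<omega>)\<^sup>2)}"
    proof safe
      fix \<omega> assume "d < \<bar>Y \<omega> - Z k \<omega>\<bar>"
      then have "d\<^sup>2 \<le> (Y \<omega> - Z k \<omega>)\<^sup>2" using d by (metis abs_le_square_iff abs_of_pos less_imp_le)
      then have "1 \<le> 1 / d\<^sup>2 * (Y \<omega> - Z k \<omega>)\<^sup>2" using d by (simp add: field_simps)
      then have "ennreal 1 \<le> ennreal (1 / d\<^sup>2 * (Y \<omega> - Z k \<omega>)\<^sup>2)" by (rule ennreal_leI)
      then show "1 \<le> ennreal (1 / d\<^sup>2) * ennreal ((Y \<omega> - Z k \<omega>)\<^sup>2)" by (subst ennreal_mult[symmetric]) auto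
    qed
    then have "emeasure M {\<omega>\<in>space M. d < \<bar>Y \<omega> - Z k \<omega>\<bar>} \<le> emeasure M {\<omega>\<in>space M. 1 \<le> ennreal (1 / d\<^sup>2) * ennreal ((Y \<omega> - Z k \<omega>)\<^sup>2)}"
      by (intro emeasure_mono) auto
    also have "\<dots> \<le> ennreal (1 / d\<^sup>2) * (\<integral>\<^sup>+\<omega>. ennreal ((Y \<omega> - Z k \<omega>)\<^sup>2) * indicator (space M) \<omega> \<partial>M)"
      by (rule nn_integral_Markov_inequality) auto
    also have "(\<integral>\<^sup>+\<omega>. ennreal ((Y \<omega> - Z k \<omega>)\<^sup>2) * indicator (space M) \<omega> \<partial>M) = (sqint M (\<lambda>\<omega>. Y \<omega> - Z k \<omega>))"
      by (intro nn_integral_cong) simp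
    finally show ?thesis .
  qed
  note le = this
  have lim': "(\<lambda>k. ennreal (1 / d\<^sup>2) * (sqint M (\<lambda>\<omega>. Y \<omega> - Z k \<omega>))) \<longlonglongrightarrow> ennreal (1 / d\<^sup>2) * 0"
    by (intro ennreal_tendsto_cmult lim) auto
  have "(\<lambda>k. emeasure M {\<omega>\<in>space M. d < \<bar>Y \<omega> - Z k \<omega>\<bar>}) \<longlonglongrightarrow> 0"
    by (rule tendsto_sandwich[OF _ _ tendsto_const lim'[simplified mult_zero_right]]) (use le in auto)
  then have "(\<lambda>k. ennreal (prob {\<omega>\<in>space M. d < \<bar>Y \<omega> - Z k \<omega>\<bar>})) \<longlonglongrightarrow> ennreal 0"
    by (simp add: emeasure_eq_measure)
  then show ?thesis by (subst (asm) tendsto_ennreal_iff) auto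
qed

text \<open>Off the exceptional events the triangle inequality carries the bounds from one family to
  the other. It serves in both directions: from step integrals to their limits and back.\<close>

lemma (in prob_space) prob_le_transfer:
  fixes Y Z :: "'i \<Rightarrow> 'a \<Rightarrow> real"
  assumes I: "finite I"
    and [measurable]: "\<And>i. i \<in> I \<Longrightarrow> Y i \<in> borel_measurable M" "\<And>i. i \<in> I \<Longrightarrow> Z i \<in> borel_measurable M"
  shows "prob {\<omega>\<in>space M. \<forall>i\<in>I. \<bar>Y i \<omega>\<bar> \<le> a i}
     \<le> prob {\<omega>\<in>space M. \<forall>i\<in>I. \<bar>Z i \<omega>\<bar> \<le> a i + d i} + (\<Sum>i\<in>I. prob {\<omega>\<in>space M. d i < \<bar>Y i \<omega> - Z i \<omega>\<bar>})"
proof -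
  have m1: "{\<omega>\<in>space M. \<forall>i\<in>I. \<bar>Z i \<omega>\<bar> \<le> a i + d i} \<in> sets M"
  proof (intro sets.sets_Collect_finite_All I)
    fix i assume "i \<in> I"
    then show "{\<omega>\<in>space M. \<bar>Z i \<omega>\<bar> \<le> a i + d i} \<in> sets M" by measurable
  qed
  have m2: "{\<omega>\<in>space M. d i < \<bar>Y i \<omega> - Z i \<omega>\<bar>} \<in> sets M" if "i \<in> I" for i using that by measurable
  have "prob {\<omega>\<in>space M. \<forall>i\<in>I. \<bar>Y i \<omega>\<bar> \<le> a i}
     \<le> prob ({\<omega>\<in>space M. \<forall>i\<in>I. \<bar>Z i \<omega>\<bar> \<le> a i + d i} \<union> (\<Union>i\<in>I. {\<omega>\<in>space M. d i < \<bar>Y i \<omega> - Z i \<omega>\<bar>}))"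
  proof (rule finite_measure_mono)
    show "{\<omega>\<in>space M. \<forall>i\<in>I. \<bar>Y i \<omega>\<bar> \<le> a i}
      \<subseteq> {\<omega>\<in>space M. \<forall>i\<in>I. \<bar>Z i \<omega>\<bar> \<le> a i + d i} \<union> (\<Union>i\<in>I. {\<omega>\<in>space M. d i < \<bar>Y i \<omega> - Z i \<omega>\<bar>})"
      by (auto simp: not_less) (smt (verit))
  qed (intro sets.Un m1 sets.finite_UN I m2)
  also have "\<dots> \<le> prob {\<omega>\<in>space M. \<forall>i\<in>I. \<bar>Z i \<omega>\<bar> \<le> a i + d i} + prob (\<Union>i\<in>I. {\<omega>\<in>space M. d i < \<bar>Y i \<omega> - Z i \<omega>\<bar>})"
    by (intro measure_Un_le m1 sets.finite_UN I m2)
  also have "prob (\<Union>i\<in>I. {\<omega>\<in>space M. d i < \<bar>Y i \<omega> - Z i \<omega>\<bar>}) \<le> (\<Sum>i\<in>I. prob {\<omega>\<in>space M. d i < \<bar>Y i \<omega> - Z i \<omega>\<bar>})"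
    using I m2 by (intro measure_UNION_le) auto
  finally show ?thesis by simp
qed

text \<open>One column per grid cell, one row per index: on a common grid all the step integrals are
  linear in the same normalised increments.\<close>

lemma stepW_slab_gint:
  fixes l :: "'i \<Rightarrow> (real \<times> real \<times> real) list"
  assumes bm: "standard_brownian_motion M W" and I: "finite I"
    and s: "strict_mono_on {..m} s" "0 \<le> s 0"
    and l: "\<And>i c a b. i \<in> I \<Longrightarrow> (c, a, b) \<in> set (l i) \<Longrightarrow> a \<in> s ` {..m} \<and> b \<in> s ` {..m} \<and> a \<le> b"
  shows "emeasure M {\<omega>\<in>space M. \<forall>i\<in>I. \<bar>stepW W (l i) \<omega>\<bar> \<le> a i}
     = gint (slab I a) (map (\<lambda>j i. stepf (l i) (s (Suc j)) * sqrt (s (Suc j) - s j)) [0..<m]) (\<lambda>_. 0)"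
proof -
  define B where "B = (\<lambda>j i. stepf (l i) (s (Suc j)) * sqrt (s (Suc j) - s j))"
  have nn: "0 \<le> s j" if "j \<le> m" for j
    using strict_mono_on_imp_mono_on[OF s(1)] s(2) that by (auto simp: monotone_on_def intro: order_trans)
  have meas: "stepW W (l i) \<in> borel_measurable M" if "i \<in> I" for i
    using l[OF that] nn by (intro stepW_measurable[OF bm]) auto
  have eq: "stepW W (l i) \<omega> = (\<Sum>j<m. (W (s (Suc j)) \<omega> - W (s j) \<omega>) / sqrt (s (Suc j) - s j) * B j i)"
    if "i \<in> I" for i \<omega>
  proof -
    have "stepW W (l i) \<omega> = (\<Sum>j<m. stepf (l i) (s (Suc j)) * (W (s (Suc j)) \<omega> - W (s j) \<omega>))"
      using l that by (intro stepW_grid[OF s(1)]) auto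
    also have "\<dots> = (\<Sum>j<m. (W (s (Suc j)) \<omega> - W (s j) \<omega>) / sqrt (s (Suc j) - s j) * B j i)"
    proof (intro sum.cong refl)
      fix j assume "j \<in> {..<m}"
      then have "s j < s (Suc j)" using s(1) by (auto simp: strict_mono_on_def)
      then show "stepf (l i) (s (Suc j)) * (W (s (Suc j)) \<omega> - W (s j) \<omega>) = (W (s (Suc j)) \<omega> - W (s j) \<omega>) / sqrt (s (Suc j) - s j) * B j i"
        by (simp add: B_def)
    qed
    finally show ?thesis .
  qed
  have "emeasure M {\<omega>\<in>space M. \<forall>i\<in>I. \<bar>stepW W (l i) \<omega>\<bar> \<le> a i} = (\<integral>\<^sup>+\<omega>. indicator {\<omega>\<in>space M. \<forall>i\<in>I. \<bar>stepW W (l i) \<omega>\<bar> \<le> a i} \<omega> \<partial>M)"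
    using I meas by (intro nn_integral_indicator[symmetric]) measurable
  also have "\<dots> = (\<integral>\<^sup>+\<omega>. slab I a (\<lambda>i. \<Sum>j<m. (W (s (Suc j)) \<omega> - W (s j) \<omega>) / sqrt (s (Suc j) - s j) * B j i) \<partial>M)"
    by (intro nn_integral_cong) (auto simp: slab_def eq indicator_def)
  also have "\<dots> = gint (slab I a) (map B [0..<m]) (\<lambda>_. 0)"
    using I by (intro brownian_increments_gint[OF bm s]) simp
  finally show ?thesis by (simp add: B_def)
qed

lemma wapprox_ex:
  assumes "wapprox M W T f Y"
  shows "\<exists>l. (\<forall>k c a b. (c, a, b) \<in> set (l k) \<longrightarrow> 0 \<le> a \<and> a \<le> b \<and> b \<le> T) \<and>
     (\<lambda>k. sqint lborel (\<lambda>r. f r - stepf (l k) r)) \<longlonglongrightarrow> 0 \<and>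
     (\<lambda>k. sqint M (\<lambda>\<omega>. Y \<omega> - stepW W (l k) \<omega>)) \<longlonglongrightarrow> 0"
proof -
  obtain l where l: "\<forall>k. \<forall>(c, a, b)\<in>set (l k). 0 \<le> a \<and> a \<le> b \<and> b \<le> T"
     "(\<lambda>k. sqint lborel (\<lambda>r. f r - stepf (l k) r)) \<longlonglongrightarrow> 0"
     "(\<lambda>k. sqint M (\<lambda>\<omega>. Y \<omega> - stepW W (l k) \<omega>)) \<longlonglongrightarrow> 0"
    using assms unfolding wapprox_def by (elim conjE exE) (rule that)
  have "\<forall>k c a b. (c, a, b) \<in> set (l k) \<longrightarrow> 0 \<le> a \<and> a \<le> b \<and> b \<le> T"
  proof (intro allI impI)
    fix k c a b assume "(c, a, b) \<in> set (l k)"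
    from bspec[OF spec[OF l(1), of k] this] show "0 \<le> a \<and> a \<le> b \<and> b \<le> T" by simp
  qed
  with l(2,3) show ?thesis by (intro exI[of _ l] conjI)
qed

lemma tendsto_sum_prob_of_wapprox:
  assumes bm: "standard_brownian_motion M W"
    and Y: "\<And>i. i \<in> I \<Longrightarrow> Y i \<in> borel_measurable M"
    and l: "\<And>i k c a b. i \<in> I \<Longrightarrow> (c, a, b) \<in> set (l i k) \<Longrightarrow> 0 \<le> a \<and> a \<le> b"
    and lim: "\<And>i. i \<in> I \<Longrightarrow> (\<lambda>k. sqint M (\<lambda>\<omega>. Y i \<omega> - stepW W (l i k) \<omega>)) \<longlonglongrightarrow> 0"
    and d: "\<And>i. i \<in> I \<Longrightarrow> 0 < d i"
  shows "(\<lambda>k. \<Sum>i\<in>I. measure M {\<omega>\<in>space M. d i < \<bar>Y i \<omega> - stepW W (l i k) \<omega>\<bar>}) \<longlonglongrightarrow> 0"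
proof -
  interpret prob_space M using bm by (simp add: standard_brownian_motion_def)
  have "(\<lambda>k. \<Sum>i\<in>I. measure M {\<omega>\<in>space M. d i < \<bar>Y i \<omega> - stepW W (l i k) \<omega>\<bar>}) \<longlonglongrightarrow> (\<Sum>i\<in>I. 0)"
    using l by (intro tendsto_sum tendsto_prob_of_L2 Y lim d stepW_measurable[OF bm])
  then show ?thesis by simp
qed

text \<open>\<open>P\<close> collects points that the grid must contain in any case; being
  non-empty, it also covers empty lists. The exact image is recorded because it identifies the last
  grid point.\<close>

lemma finite_endpoints:
  fixes l :: "'i \<Rightarrow> (real \<times> real \<times> real) list"
  assumes "finite I" "finite P" "P \<noteq> {}" "\<And>x. x \<in> P \<Longrightarrow> 0 \<le> x"
    and l: "\<And>i c a b. i \<in> I \<Longrightarrow> (c, a, b) \<in> set (l i) \<Longrightarrow> 0 \<le> a \<and> a \<le> b"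
  obtains m s where "strict_mono_on {..m::nat} s" "0 \<le> s 0" "P \<subseteq> s ` {..m}"
    "\<And>i c a b. i \<in> I \<Longrightarrow> (c, a, b) \<in> set (l i) \<Longrightarrow> a \<in> s ` {..m} \<and> b \<in> s ` {..m} \<and> a \<le> b"
    "s ` {..m} = P \<union> (\<Union>i\<in>I. \<Union>x\<in>set (l i). {fst (snd x), snd (snd x)})"
proof -
  define S where "S = P \<union> (\<Union>i\<in>I. \<Union>x\<in>set (l i). {fst (snd x), snd (snd x)})"
  have "finite S" "S \<noteq> {}" using assms by (auto simp: S_def)
  then obtain m s where s: "strict_mono_on {..m::nat} s" "s ` {..m} = S"
    by (rule finite_real_set_enumeration)
  have nn: "0 \<le> x" if "x \<in> S" for x
    using that assms(4) l by (auto simp: S_def) (blast | force)+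
  show ?thesis
  proof (rule that[OF s(1)])
    show "0 \<le> s 0" using nn[of "s 0"] s(2) by blast
    show "P \<subseteq> s ` {..m}" unfolding s(2) by (simp add: S_def)
    show "a \<in> s ` {..m} \<and> b \<in> s ` {..m} \<and> a \<le> b" if "i \<in> I" "(c, a, b) \<in> set (l i)" for i c a b
      unfolding s(2) using that l[OF that] by (force simp: S_def)
    show "s ` {..m} = P \<union> (\<Union>i\<in>I. \<Union>x\<in>set (l i). {fst (snd x), snd (snd x)})"
      unfolding s(2) S_def ..
  qed
qed

section \<open>Small balls of finite families of Wiener integrals\<close>

lemma prod_mono_ennreal:
  fixes x y :: "'i \<Rightarrow> ennreal"
  shows "(\<And>i. i \<in> I \<Longrightarrow> x i \<le> y i) \<Longrightarrow> prod x I \<le> prod y I"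
  by (induction I rule: infinite_finite_induct) (auto intro: mult_mono)

text \<open>Sidak's inequality is applied to approximating step integrals before the limit in
  \<open>k\<close>. Half of each threshold absorbs the approximation error, and the approximating
  integrand has norm at most \<open>2 * \<sigma> i\<close>; hence the quotient of
  \<open>a i / 2\<close> by \<open>2 * \<sigma> i\<close>.\<close>

lemma wiener_small_ball_lower:
  assumes bm: "standard_brownian_motion M W" and I: "finite I"
    and w: "\<And>i. i \<in> I \<Longrightarrow> wapprox M W T (f i) (Y i)"
    and \<sigma>: "\<And>i. i \<in> I \<Longrightarrow> 0 < \<sigma> i"
    and var: "\<And>i. i \<in> I \<Longrightarrow> (sqint lborel (\<lambda>r. f i r)) \<le> ennreal ((\<sigma> i)\<^sup>2)"
    and a: "\<And>i. i \<in> I \<Longrightarrow> 0 < a i"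
  shows "(\<Prod>i\<in>I. measure \<N> {x. \<bar>x\<bar> \<le> a i / (4 * \<sigma> i)})
     \<le> measure M {\<omega>\<in>space M. \<forall>i\<in>I. \<bar>Y i \<omega>\<bar> \<le> a i}"
proof -
  interpret prob_space M using bm by (simp add: standard_brownian_motion_def)
  interpret N: prob_space \<N> by (rule prob_space_std_normal)
  have meas[measurable]: "f i \<in> borel_measurable borel" "Y i \<in> borel_measurable M" if "i \<in> I" for i
    using w[OF that] by (auto simp: wapprox_def)
  have "\<forall>i\<in>I. \<exists>l. (\<forall>k c a b. (c, a, b) \<in> set (l k) \<longrightarrow> 0 \<le> a \<and> a \<le> b \<and> b \<le> T) \<and>
     (\<lambda>k. sqint lborel (\<lambda>r. f i r - stepf (l k) r)) \<longlonglongrightarrow> 0 \<and>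
     (\<lambda>k. sqint M (\<lambda>\<omega>. Y i \<omega> - stepW W (l k) \<omega>)) \<longlonglongrightarrow> 0"
    by (intro ballI wapprox_ex w)
  then obtain l where l0: "\<forall>i\<in>I. (\<forall>k c a b. (c, a, b) \<in> set (l i k) \<longrightarrow> 0 \<le> a \<and> a \<le> b \<and> b \<le> T) \<and>
     (\<lambda>k. sqint lborel (\<lambda>r. f i r - stepf (l i k) r)) \<longlonglongrightarrow> 0 \<and>
     (\<lambda>k. sqint M (\<lambda>\<omega>. Y i \<omega> - stepW W (l i k) \<omega>)) \<longlonglongrightarrow> 0"
    by (rule bchoice[THEN exE])
  have l: "0 \<le> x \<and> x \<le> y" if "i \<in> I" "(c, x, y) \<in> set (l i k)" for i k c x y
    using l0 that by blast
  have lf: "(\<lambda>k. sqint lborel (\<lambda>r. f i r - stepf (l i k) r)) \<longlonglongrightarrow> 0"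
    and lW: "(\<lambda>k. sqint M (\<lambda>\<omega>. Y i \<omega> - stepW W (l i k) \<omega>)) \<longlonglongrightarrow> 0" if "i \<in> I" for i
    using l0 that by auto
  define Q where "Q = (\<Prod>i\<in>I. measure \<N> {x. \<bar>x\<bar> \<le> a i / (4 * \<sigma> i)})"
  define P where "P = prob {\<omega>\<in>space M. \<forall>i\<in>I. \<bar>Y i \<omega>\<bar> \<le> a i}"
  define e where "e k = (\<Sum>i\<in>I. prob {\<omega>\<in>space M. a i / 2 < \<bar>Y i \<omega> - stepW W (l i k) \<omega>\<bar>})" for k
  have "e \<longlonglongrightarrow> 0"
    unfolding e_def using a l lW by (intro tendsto_sum_prob_of_wapprox[OF bm]) auto
  then have e: "(\<lambda>k. P + e k) \<longlonglongrightarrow> P" using tendsto_add[OF tendsto_const, of e 0 _ P] by simp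
  have "\<forall>\<^sub>F k in sequentially. \<forall>i\<in>I. (sqint lborel (\<lambda>r. f i r - stepf (l i k) r)) < ennreal ((\<sigma> i)\<^sup>2)"
  proof (intro eventually_ball_finite[OF I] ballI)
    fix i assume "i \<in> I"
    then show "\<forall>\<^sub>F k in sequentially. (sqint lborel (\<lambda>r. f i r - stepf (l i k) r)) < ennreal ((\<sigma> i)\<^sup>2)"
      using \<sigma>[of i] by (intro order_tendstoD(2)[OF lf]) auto
  qed
  then have "\<forall>\<^sub>F k in sequentially. Q \<le> P + e k"
  proof eventually_elim
    case (elim k)
    \<comment> \<open>The squared distance to the approximant is by now below
      \<open>(\<sigma> i)^2\<close>, so the squared norm is at most
      \<open>2 * (\<sigma> i)^2 + 2 * (\<sigma> i)^2\<close>.\<close>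
    have var_k: "(sqint lborel (\<lambda>r. stepf (l i k) r)) \<le> ennreal ((2 * \<sigma> i)\<^sup>2)" if i: "i \<in> I" for i
    proof -
      have "(sqint lborel (\<lambda>r. stepf (l i k) r)) = (sqint lborel (\<lambda>r. f i r - (f i r - stepf (l i k) r)))"
        by simp
      also have "\<dots> \<le> 2 * (sqint lborel (\<lambda>r. f i r)) + 2 * (sqint lborel (\<lambda>r. f i r - stepf (l i k) r))"
        using meas(1)[OF i] by (intro nn_integral_diff_square_le) simp_all
      also have "\<dots> \<le> 2 * ennreal ((\<sigma> i)\<^sup>2) + 2 * ennreal ((\<sigma> i)\<^sup>2)"
        using elim i var[OF i] by (intro add_mono mult_left_mono) (auto intro: less_imp_le)
      also have "\<dots> = ennreal ((2 * \<sigma> i)\<^sup>2)"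
        by (simp add: power_mult_distrib ennreal_mult flip: distrib_right)
      finally show ?thesis .
    qed
    obtain m s where s: "strict_mono_on {..m::nat} s" "0 \<le> s 0" and "{0} \<subseteq> s ` {..m}"
      and ls: "\<And>i c a b. i \<in> I \<Longrightarrow> (c, a, b) \<in> set (l i k) \<Longrightarrow> a \<in> s ` {..m} \<and> b \<in> s ` {..m} \<and> a \<le> b"
      and "s ` {..m} = {0} \<union> (\<Union>i\<in>I. \<Union>x\<in>set (l i k). {fst (snd x), snd (snd x)})"
    proof (rule finite_endpoints[of I "{0}" "\<lambda>i. l i k"])
    qed (use I l in auto)
    define cols where "cols = map (\<lambda>j i. stepf (l i k) (s (Suc j)) * sqrt (s (Suc j) - s j)) [0..<m]"
    have sq: "sqrt (\<Sum>B\<leftarrow>cols. (B i)\<^sup>2) \<le> 2 * \<sigma> i" if i: "i \<in> I" for i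
    proof -
      have "ennreal (\<Sum>B\<leftarrow>cols. (B i)\<^sup>2) = (sqint lborel (\<lambda>r. stepf (l i k) r))"
        using ls[OF i] by (subst nn_integral_stepf_square_UNIV[OF s(1)])
          (auto simp: cols_def comp_def interv_sum_list_conv_sum_set_nat atLeast0LessThan)
      also have "\<dots> \<le> ennreal ((2 * \<sigma> i)\<^sup>2)" by (rule var_k[OF i])
      finally have "(\<Sum>B\<leftarrow>cols. (B i)\<^sup>2) \<le> (2 * \<sigma> i)\<^sup>2" by (simp add: ennreal_le_iff)
      then show ?thesis using \<sigma>[OF i] by (intro real_le_lsqrt) auto
    qed
    have "ennreal Q = (\<Prod>i\<in>I. emeasure \<N> {x. \<bar>x\<bar> \<le> a i / (4 * \<sigma> i)})"
      unfolding Q_def N.emeasure_eq_measure by (intro prod_ennreal[symmetric]) auto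
    also have "\<dots> \<le> (\<Prod>i\<in>I. gint (slab {i} (\<lambda>i. a i / 2)) cols (\<lambda>_. 0))"
    proof (rule prod_mono_ennreal)
      fix i assume i: "i \<in> I"
      have "{x. \<bar>x\<bar> \<le> a i / (4 * \<sigma> i)} \<subseteq> {x. \<bar>x\<bar> * sqrt (\<Sum>B\<leftarrow>cols. (B i)\<^sup>2) \<le> a i / 2}"
      proof safe
        fix x :: real assume x: "\<bar>x\<bar> \<le> a i / (4 * \<sigma> i)"
        have "\<bar>x\<bar> * sqrt (\<Sum>B\<leftarrow>cols. (B i)\<^sup>2) \<le> a i / (4 * \<sigma> i) * (2 * \<sigma> i)"
          using x sq[OF i] \<sigma>[OF i] a[OF i] by (intro mult_mono) (auto intro!: real_sqrt_ge_zero sum_list_nonneg)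
        also have "\<dots> = a i / 2" using \<sigma>[OF i] by simp
        finally show "\<bar>x\<bar> * sqrt (\<Sum>B\<leftarrow>cols. (B i)\<^sup>2) \<le> a i / 2" .
      qed
      then show "emeasure \<N> {x. \<bar>x\<bar> \<le> a i / (4 * \<sigma> i)} \<le> gint (slab {i} (\<lambda>i. a i / 2)) cols (\<lambda>_. 0)"
        unfolding gint_slab_single by (auto intro!: emeasure_mono)
    qed
    also have "\<dots> \<le> gint (slab I (\<lambda>i. a i / 2)) cols (\<lambda>_. 0)" by (rule sidak[OF I])
    also have "\<dots> = emeasure M {\<omega>\<in>space M. \<forall>i\<in>I. \<bar>stepW W (l i k) \<omega>\<bar> \<le> a i / 2}"
      unfolding cols_def by (rule stepW_slab_gint[OF bm I s ls, symmetric])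
    finally have "Q \<le> prob {\<omega>\<in>space M. \<forall>i\<in>I. \<bar>stepW W (l i k) \<omega>\<bar> \<le> a i / 2}"
      by (simp add: emeasure_eq_measure)
    also have "\<dots> \<le> prob {\<omega>\<in>space M. \<forall>i\<in>I. \<bar>Y i \<omega>\<bar> \<le> a i / 2 + a i / 2}
       + (\<Sum>i\<in>I. prob {\<omega>\<in>space M. a i / 2 < \<bar>stepW W (l i k) \<omega> - Y i \<omega>\<bar>})"
      using l meas by (intro prob_le_transfer I stepW_measurable[OF bm]) auto
    also have "\<dots> = P + e k" by (simp add: P_def e_def abs_minus_commute)
    finally show ?case .
  qed
  then have "Q \<le> P" using tendsto_lowerbound[OF e] by simp
  then show ?thesis by (simp add: Q_def P_def)
qed

lemma concat_map_upt_blocks: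
  fixes K :: "nat \<Rightarrow> nat"
  assumes "\<And>i. i < n \<Longrightarrow> K i \<le> K (Suc i)"
  shows "K 0 \<le> K n \<and> concat (map (\<lambda>i. map B [K i..<K (Suc i)]) [0..<n]) = map B [K 0..<K n]"
  using assms
proof (induction n)
  case (Suc n)
  have "K 0 \<le> K n" using Suc by simp
  have "[K 0..<K (Suc n)] = [K 0..<K n] @ [K n..<K (Suc n)]"
    using \<open>K 0 \<le> K n\<close> Suc.prems[of n] upt_add_eq_append[of "K 0" "K n" "K (Suc n) - K n"] by simp
  moreover have "K 0 \<le> K (Suc n)" using \<open>K 0 \<le> K n\<close> Suc.prems[of n] by linarith
  ultimately show ?case using Suc by simp
qed simp

text \<open>The approximants of \<open>f i\<close> stop at \<open>\<tau> (Suc i)\<close>, so the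
  columns of a block vanish in all earlier rows, which is the triangular shape required by
  \<open>gint_slab_blocks\<close>. Passing to approximants doubles the threshold and halves the
  guaranteed deviation, hence \<open>4 * a / v\<close>.\<close>

lemma wiener_small_ball_upper:
  fixes \<tau> :: "nat \<Rightarrow> real"
  assumes bm: "standard_brownian_motion M W"
    and \<tau>: "\<And>i. i < n \<Longrightarrow> \<tau> i < \<tau> (Suc i)" "0 \<le> \<tau> 0"
    and w: "\<And>i. i < n \<Longrightarrow> wapprox M W (\<tau> (Suc i)) (f i) (Y i)"
    and v: "0 < v"
    and var: "\<And>i. i < n \<Longrightarrow> ennreal (v\<^sup>2) \<le> (\<integral>\<^sup>+r\<in>{\<tau> i<..\<tau> (Suc i)}. ennreal ((f i r)\<^sup>2) \<partial>lborel)"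
    and a: "0 < a"
  shows "measure M {\<omega>\<in>space M. \<forall>i<n. \<bar>Y i \<omega>\<bar> \<le> a} \<le> measure \<N> {..4 * a / v} ^ n"
proof -
  interpret prob_space M using bm by (simp add: standard_brownian_motion_def)
  interpret N: prob_space \<N> by (rule prob_space_std_normal)
  have \<tau>_less: "\<tau> i < \<tau> j" if "i < j" "j \<le> n" for i j
    using that
  proof (induction j)
    case (Suc j)
    then show ?case using \<tau>(1)[of j] by (cases "i = j") auto
  qed simp
  have meas[measurable]: "f i \<in> borel_measurable borel" "Y i \<in> borel_measurable M" if "i < n" for i
    using w[OF that] by (auto simp: wapprox_def)
  have "\<forall>i\<in>{..<n}. \<exists>l. (\<forall>k c a b. (c, a, b) \<in> set (l k) \<longrightarrow> 0 \<le> a \<and> a \<le> b \<and> b \<le> \<tau> (Suc i)) \<and>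
     (\<lambda>k. sqint lborel (\<lambda>r. f i r - stepf (l k) r)) \<longlonglongrightarrow> 0 \<and>
     (\<lambda>k. sqint M (\<lambda>\<omega>. Y i \<omega> - stepW W (l k) \<omega>)) \<longlonglongrightarrow> 0"
    by (intro ballI wapprox_ex w) simp
  then obtain l where l0: "\<forall>i\<in>{..<n}. (\<forall>k c a b. (c, a, b) \<in> set (l i k) \<longrightarrow> 0 \<le> a \<and> a \<le> b \<and> b \<le> \<tau> (Suc i)) \<and>
     (\<lambda>k. sqint lborel (\<lambda>r. f i r - stepf (l i k) r)) \<longlonglongrightarrow> 0 \<and>
     (\<lambda>k. sqint M (\<lambda>\<omega>. Y i \<omega> - stepW W (l i k) \<omega>)) \<longlonglongrightarrow> 0"
    by (rule bchoice[THEN exE])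
  have l: "0 \<le> x \<and> x \<le> y \<and> y \<le> \<tau> (Suc i)" if "i < n" "(c, x, y) \<in> set (l i k)" for i k c x y
    using l0 that by blast
  have lf: "(\<lambda>k. sqint lborel (\<lambda>r. f i r - stepf (l i k) r)) \<longlonglongrightarrow> 0"
    and lW: "(\<lambda>k. sqint M (\<lambda>\<omega>. Y i \<omega> - stepW W (l i k) \<omega>)) \<longlonglongrightarrow> 0" if "i < n" for i
    using l0 that by auto
  define Q where "Q = measure \<N> {..4 * a / v} ^ n"
  define P where "P = prob {\<omega>\<in>space M. \<forall>i<n. \<bar>Y i \<omega>\<bar> \<le> a}"
  define e where "e k = (\<Sum>i<n. prob {\<omega>\<in>space M. a < \<bar>Y i \<omega> - stepW W (l i k) \<omega>\<bar>})" for k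
  have "e \<longlonglongrightarrow> 0"
    unfolding e_def using a l lW meas by (intro tendsto_sum_prob_of_wapprox[OF bm]) auto
  then have e: "(\<lambda>k. Q + e k) \<longlonglongrightarrow> Q" using tendsto_add[OF tendsto_const, of e 0 _ Q] by simp
  have "\<forall>\<^sub>F k in sequentially. \<forall>i\<in>{..<n}. (sqint lborel (\<lambda>r. f i r - stepf (l i k) r)) < ennreal (v\<^sup>2 / 4)"
    using lf v by (intro eventually_ball_finite) (auto intro!: order_tendstoD(2))
  then have "\<forall>\<^sub>F k in sequentially. P \<le> Q + e k"
  proof eventually_elim
    case (elim k)
    \<comment> \<open>The squared distance to the approximant is below \<open>v^2 / 4\<close>, so
      \<open>v^2 \<le> v^2 / 2 + 2 * D\<close>, which leaves a squared norm of at least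
      \<open>v^2 / 4\<close> on the block.\<close>
    have var_k: "ennreal ((v / 2)\<^sup>2) \<le> (\<integral>\<^sup>+r\<in>{\<tau> i<..\<tau> (Suc i)}. ennreal ((stepf (l i k) r)\<^sup>2) \<partial>lborel)" if i: "i < n" for i
    proof -
      define J where "J = {\<tau> i<..\<tau> (Suc i)}"
      have J[measurable]: "J \<in> sets borel" by (simp add: J_def)
      have set_eq: "(\<integral>\<^sup>+r\<in>J. ennreal ((h r)\<^sup>2) \<partial>lborel) = (sqint lborel (\<lambda>r. indicator J r * h r))" for h :: "real \<Rightarrow> real"
        by (intro nn_integral_cong) (auto simp: indicator_def)
      define D where "D = (\<integral>\<^sup>+r\<in>J. ennreal ((stepf (l i k) r)\<^sup>2) \<partial>lborel)"
      have "ennreal (v\<^sup>2) \<le> (sqint lborel (\<lambda>r. indicator J r * f i r))"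
        using var[OF i] unfolding J_def[symmetric] set_eq .
      also have "\<dots> = (sqint lborel (\<lambda>r. indicator J r * (f i r - stepf (l i k) r) - indicator J r * (- stepf (l i k) r)))"
        by (simp add: algebra_simps)
      also have "\<dots> \<le> 2 * (sqint lborel (\<lambda>r. indicator J r * (f i r - stepf (l i k) r)))
          + 2 * (sqint lborel (\<lambda>r. indicator J r * (- stepf (l i k) r)))"
        using meas(1)[OF i] by (intro nn_integral_diff_square_le) simp_all
      also have "(sqint lborel (\<lambda>r. indicator J r * (- stepf (l i k) r))) = D"
        unfolding D_def set_eq by (simp add: power_mult_distrib)
      also have "(sqint lborel (\<lambda>r. indicator J r * (f i r - stepf (l i k) r)))
         \<le> (sqint lborel (\<lambda>r. f i r - stepf (l i k) r))"
        by (intro nn_integral_mono) (auto simp: indicator_def)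
      also have "\<dots> \<le> ennreal (v\<^sup>2 / 4)" using elim i by (auto intro: less_imp_le)
      finally have le: "ennreal (v\<^sup>2) \<le> 2 * ennreal (v\<^sup>2 / 4) + 2 * D"
        by (metis (no_types, lifting) add_right_mono mult_left_mono zero_le)
      show ?thesis
      proof (cases D)
        case (real d)
        have "ennreal (v\<^sup>2) \<le> ennreal (v\<^sup>2 / 2 + 2 * d)"
        proof -
          have "2 * ennreal (v\<^sup>2 / 4) + 2 * ennreal d = ennreal (2 * (v\<^sup>2 / 4) + 2 * d)"
            using real by (simp only: ennreal_mult ennreal_plus ennreal_numeral zero_le_numeral mult_nonneg_nonneg divide_nonneg_nonneg zero_le_power2)
          then show ?thesis using le real by simp
        qed
        then have "v\<^sup>2 \<le> v\<^sup>2 / 2 + 2 * d" using real by (subst (asm) ennreal_le_iff) auto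
        then show ?thesis using real unfolding D_def[symmetric] J_def[symmetric]
          by (auto simp: power_divide intro!: ennreal_leI)
      qed (simp add: D_def J_def)
    qed
    obtain m s where s: "strict_mono_on {..m::nat} s" "0 \<le> s 0" and P: "\<tau> ` {..n} \<subseteq> s ` {..m}"
      and ls: "\<And>i c a b. i \<in> {..<n} \<Longrightarrow> (c, a, b) \<in> set (l i k) \<Longrightarrow> a \<in> s ` {..m} \<and> b \<in> s ` {..m} \<and> a \<le> b"
      and im: "s ` {..m} = \<tau> ` {..n} \<union> (\<Union>i\<in>{..<n}. \<Union>x\<in>set (l i k). {fst (snd x), snd (snd x)})"
    proof (rule finite_endpoints[of "{..<n}" "\<tau> ` {..n}" "\<lambda>i. l i k"])
      show "0 \<le> x" if "x \<in> \<tau> ` {..n}" for x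
        using that \<tau>(2) \<tau>_less[of 0] by (auto) (metis bot_nat_0.not_eq_extremum less_eq_real_def order_trans)
    qed (use l in auto)
    note grid_le_iff = grid_le_iff[OF s(1), of "[]", simplified] and grid_less_iff = grid_less_iff[OF s(1), of "[]", simplified]
    have "\<forall>i\<in>{..n}. \<exists>j. j \<le> m \<and> s j = \<tau> i"
      using P by (auto simp: image_subset_iff) (metis atMost_iff imageE)
    then obtain K0 where K0: "\<And>i. i \<le> n \<Longrightarrow> K0 i \<le> m \<and> s (K0 i) = \<tau> i"
      by (metis atMost_iff)
    have K0_less: "K0 i < K0 (Suc i)" if "i < n" for i
      using K0[of i] K0[of "Suc i"] \<tau>(1)[OF that] that by (simp add: grid_less_iff[symmetric])
    \<comment> \<open>No interval of the lists extends past \<open>\<tau> n\<close>, so the blocks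
      exhaust the grid on the right.\<close>
    have K0n: "K0 n = m"
    proof -
      have "s m \<le> \<tau> n"
      proof -
        have "s m \<in> \<tau> ` {..n} \<union> (\<Union>i\<in>{..<n}. \<Union>x\<in>set (l i k). {fst (snd x), snd (snd x)})"
          unfolding im[symmetric] by simp
        then show ?thesis
        proof
          assume "s m \<in> \<tau> ` {..n}"
          then show ?thesis using \<tau>_less[of _ n] by (auto simp: le_less)
        next
          assume "s m \<in> (\<Union>i\<in>{..<n}. \<Union>x\<in>set (l i k). {fst (snd x), snd (snd x)})"
          then obtain i c x y where "i < n" "(c, x, y) \<in> set (l i k)" "s m = x \<or> s m = y" by auto
          with l[of i c x y k] have "s m \<le> \<tau> (Suc i)" "i < n" by auto
          then show ?thesis using \<tau>_less[of "Suc i" n] by (cases "Suc i = n") auto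
        qed
      qed
      then show ?thesis using K0[of n] grid_le_iff[of m "K0 n"] by simp
    qed
    \<comment> \<open>Cells before \<open>\<tau> 0\<close> are added to the first block: the blocks
      must use up all columns, and additional columns can only increase the variance of row
      0.\<close>
    define K where "K i = (if i = 0 then 0 else K0 i)" for i
    have K_le: "K i \<le> K (Suc i)" if "i < n" for i using K0_less[OF that] by (auto simp: K_def)
    define B where "B = (\<lambda>j i. stepf (l i k) (s (Suc j)) * sqrt (s (Suc j) - s j))"
    show ?case
    proof (cases "n = 0")
      case True
      then show ?thesis by (simp add: Q_def P_def e_def)
    next
      case False
      have cols: "map B [0..<m] = concat (map (\<lambda>i. map B [K i..<K (Suc i)]) [0..<n])"
        using concat_map_upt_blocks[of n K B, OF K_le] False K0n by (simp add: K_def)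
      have "emeasure M {\<omega>\<in>space M. \<forall>i\<in>{..<n}. \<bar>stepW W (l i k) \<omega>\<bar> \<le> 2 * a} = gint (slab {..<n} (\<lambda>_. 2 * a)) (map B [0..<m]) (\<lambda>_. 0)"
        unfolding B_def by (rule stepW_slab_gint[OF bm _ s ls]) auto
      also have "\<dots> \<le> emeasure \<N> {..2 * a / (v / 2)} ^ n"
        unfolding cols
      proof (rule gint_slab_blocks)
        fix k' i C assume k': "k' < n" and "C \<in> set (map B [K k'..<K (Suc k')])" and ik: "i < k'"
        then obtain j where j: "C = B j" "K0 k' \<le> j" "j < K0 (Suc k')" by (auto simp: K_def)
        have jm: "Suc j \<le> m" using j K0[of "Suc k'"] k' by simp
        have "\<tau> (Suc i) \<le> \<tau> k'" using \<tau>_less[of "Suc i" k'] ik k' by (cases "Suc i = k'") auto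
        also have "\<tau> k' < s (Suc j)" using K0[of k'] k' j jm grid_less_iff[of "K0 k'" "Suc j"] by simp
        finally have "stepf (l i k) (s (Suc j)) = 0"
          using l[of i _ _ _ k] ik k' by (intro stepf_eq_0) force
        then show "C i = 0" by (simp add: j B_def)
      next
        fix i assume i: "i < n"
        have "ennreal ((v / 2)\<^sup>2) \<le> (\<integral>\<^sup>+r\<in>{s (K0 i)<..s (K0 (Suc i))}. ennreal ((stepf (l i k) r)\<^sup>2) \<partial>lborel)"
          using var_k[OF i] K0[of i] K0[of "Suc i"] i by simp
        also have "\<dots> = ennreal (\<Sum>j\<in>{K0 i..<K0 (Suc i)}. (B j i)\<^sup>2)"
          unfolding B_def using K0[of "Suc i"] K0_less[OF i] i ls[of i]
          by (intro nn_integral_stepf_square[OF s(1)]) auto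
        finally have "(v / 2)\<^sup>2 \<le> (\<Sum>j\<in>{K0 i..<K0 (Suc i)}. (B j i)\<^sup>2)"
          by (subst (asm) ennreal_le_iff) (auto intro: sum_nonneg)
        also have "\<dots> \<le> (\<Sum>j\<in>{K i..<K (Suc i)}. (B j i)\<^sup>2)"
          by (intro sum_mono2) (auto simp: K_def)
        also have "\<dots> = (\<Sum>C\<leftarrow>map B [K i..<K (Suc i)]. (C i)\<^sup>2)"
          by (simp add: comp_def interv_sum_list_conv_sum_set_nat)
        finally show "(v / 2)\<^sup>2 \<le> (\<Sum>C\<leftarrow>map B [K i..<K (Suc i)]. (C i)\<^sup>2)" .
      qed (use a v in auto)
      also have "\<dots> = ennreal Q"
        by (simp add: Q_def N.emeasure_eq_measure ennreal_power)
      finally have le: "prob {\<omega>\<in>space M. \<forall>i\<in>{..<n}. \<bar>stepW W (l i k) \<omega>\<bar> \<le> 2 * a} \<le> Q"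
        by (simp add: emeasure_eq_measure Q_def)
      have "P \<le> prob {\<omega>\<in>space M. \<forall>i\<in>{..<n}. \<bar>stepW W (l i k) \<omega>\<bar> \<le> a + a} + e k"
        unfolding P_def e_def using l meas prob_le_transfer[of "{..<n}" Y "\<lambda>i. stepW W (l i k)" "\<lambda>_. a" "\<lambda>_. a"]
        by (simp add: stepW_measurable[OF bm] Ball_def)
      then show ?thesis using le by simp
    qed
  qed
  then have "P \<le> Q" using tendsto_lowerbound[OF e] by simp
  then show ?thesis by (simp add: Q_def P_def)
qed

section \<open>The Volterra kernel\<close>

text \<open>For negative \<open>e\<close> the integrand is unbounded near \<open>a\<close>, but the
  primitive is continuous there since \<open>e + 1 > 0\<close>; so its derivative is used in the
  interior only.\<close>

lemma nn_integral_powr: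
  fixes a b e :: real
  assumes "-1 < e" "a \<le> b"
  shows "(\<integral>\<^sup>+u. ennreal (indicator {a..b} u * (u - a) powr e) \<partial>lborel) = ennreal ((b - a) powr (e + 1) / (e + 1))"
proof -
  have "((\<lambda>u. (u - a) powr e) has_integral ((b - a) powr (e + 1) / (e + 1) - (a - a) powr (e + 1) / (e + 1))) {a..b}"
  proof (rule fundamental_theorem_of_calculus_interior[OF assms(2)])
    show "continuous_on {a..b} (\<lambda>u. (u - a) powr (e + 1) / (e + 1))"
      using assms by (intro continuous_intros continuous_on_powr') auto
    fix x assume "x \<in> {a<..<b}"
    then show "((\<lambda>u. (u - a) powr (e + 1) / (e + 1)) has_vector_derivative (x - a) powr e) (at x)"
      using assms unfolding has_real_derivative_iff_has_vector_derivative[symmetric]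
      by (auto intro!: derivative_eq_intros)
  qed
  then have "((\<lambda>u. (u - a) powr e) has_integral ((b - a) powr (e + 1) / (e + 1))) {a..b}"
    using assms by simp
  then have "integral\<^sup>N lborel (\<lambda>x. indicator {a..b} x * (x - a) powr e) = ennreal ((b - a) powr (e + 1) / (e + 1))"
    by (intro nn_integral_has_integral_lebesgue) auto
  then show ?thesis by simp
qed

text \<open>With \<open>x = q * y\<close>, both bounds say that \<open>b * ln q\<close> is at most
  \<open>\<bar>b\<bar> * ln 2\<close> in absolute value. This covers exponents of either sign, as
  needed for \<alpha>, \<beta> and their sum.\<close>

lemma powr_comparable:
  fixes x y b :: real
  assumes "0 < y" "y / 2 \<le> x" "x \<le> 2 * y"
  shows "x powr b \<le> 2 powr \<bar>b\<bar> * y powr b" and "2 powr (- \<bar>b\<bar>) * y powr b \<le> x powr b"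
proof -
  define q where "q = x / y"
  have q: "1 / 2 \<le> q" "q \<le> 2" "0 < q" "x = q * y" using assms by (auto simp: q_def field_simps)
  have xb: "x powr b = q powr b * y powr b" using q assms by (simp add: powr_mult)
  have l: "\<bar>ln q\<bar> \<le> ln 2"
  proof -
    have "ln (1/2) \<le> ln q" "ln q \<le> ln 2" using q by (auto simp: ln_le_cancel_iff)
    then show ?thesis by (simp add: ln_div)
  qed
  have "\<bar>b * ln q\<bar> \<le> \<bar>b\<bar> * ln 2" unfolding abs_mult by (intro mult_left_mono l) auto
  then have "q powr b \<le> 2 powr \<bar>b\<bar>" "2 powr (- \<bar>b\<bar>) \<le> q powr b"
    using q by (auto simp: powr_def)
  then show "x powr b \<le> 2 powr \<bar>b\<bar> * y powr b" "2 powr (- \<bar>b\<bar>) * y powr b \<le> x powr b"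
    unfolding xb by (auto intro: mult_right_mono)
qed

section \<open>Comparison of the inner integrals\<close>

text \<open>Values in \<open>ennreal\<close> keep comparisons of kernels free of integrability
  conditions; finiteness is required only when a bound is carried over to the reals.\<close>

definition inner_kernel :: "real \<Rightarrow> real \<Rightarrow> real \<Rightarrow> real \<Rightarrow> ennreal" where
  "inner_kernel \<beta> \<gamma> t r = (\<integral>\<^sup>+u. ennreal (indicator {r..t} u * (u powr \<beta> * (u - r) powr \<gamma>)) \<partial>lborel)"

lemma volterra_kernel_eq: "volterra_kernel \<alpha> \<beta> \<gamma> t r = r powr \<alpha> * enn2real (inner_kernel \<beta> \<gamma> t r)"
  unfolding volterra_kernel_def inner_kernel_def set_lebesgue_integral_def
  by (subst integral_eq_nn_integral) (auto simp: indicator_def)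

lemma inner_kernel_eq_0: "t < r \<Longrightarrow> inner_kernel \<beta> \<gamma> t r = 0"
  by (simp add: inner_kernel_def)

context
  fixes \<beta> \<gamma> :: real
  assumes \<gamma>: "- 1 < \<gamma>" "\<gamma> < 0"
begin

lemma nn_integral_kernel_le:
  assumes "0 < s" "s \<le> x" "x \<le> y" "y \<le> 2 * s"
  shows "(\<integral>\<^sup>+u. ennreal (indicator {x..y} u * (u powr \<beta> * (u - x) powr \<gamma>)) \<partial>lborel)
     \<le> ennreal (2 powr \<bar>\<beta>\<bar> * s powr \<beta> * ((y - x) powr (\<gamma> + 1) / (\<gamma> + 1)))"
proof -
  have "(\<integral>\<^sup>+u. ennreal (indicator {x..y} u * (u powr \<beta> * (u - x) powr \<gamma>)) \<partial>lborel)
    \<le> (\<integral>\<^sup>+u. ennreal (2 powr \<bar>\<beta>\<bar> * s powr \<beta>) * ennreal (indicator {x..y} u * (u - x) powr \<gamma>) \<partial>lborel)"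
    using assms by (intro nn_integral_mono)
      (auto simp: indicator_def ennreal_mult[symmetric] intro!: ennreal_leI mult_right_mono powr_comparable)
  also have "\<dots> = ennreal (2 powr \<bar>\<beta>\<bar> * s powr \<beta>) * ennreal ((y - x) powr (\<gamma> + 1) / (\<gamma> + 1))"
    using \<gamma> assms by (subst nn_integral_cmult) (auto simp: nn_integral_powr)
  also have "\<dots> = ennreal (2 powr \<bar>\<beta>\<bar> * s powr \<beta> * ((y - x) powr (\<gamma> + 1) / (\<gamma> + 1)))"
    using \<gamma> by (intro ennreal_mult[symmetric]) auto
  finally show ?thesis .
qed

lemma inner_kernel_ge:
  assumes "0 < s" "s \<le> r" "r \<le> t" "t \<le> 2 * s"
  shows "ennreal (2 powr (- \<bar>\<beta>\<bar>) * s powr \<beta> * ((t - r) powr (\<gamma> + 1) / (\<gamma> + 1))) \<le> inner_kernel \<beta> \<gamma> t r"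
proof -
  have "ennreal (2 powr (- \<bar>\<beta>\<bar>) * s powr \<beta> * ((t - r) powr (\<gamma> + 1) / (\<gamma> + 1)))
    = ennreal (2 powr (- \<bar>\<beta>\<bar>) * s powr \<beta>) * (\<integral>\<^sup>+u. ennreal (indicator {r..t} u * (u - r) powr \<gamma>) \<partial>lborel)"
    using \<gamma> by (subst nn_integral_powr[OF \<gamma>(1) assms(3)], intro ennreal_mult) auto
  also have "\<dots> = (\<integral>\<^sup>+u. ennreal (2 powr (- \<bar>\<beta>\<bar>) * s powr \<beta>) * ennreal (indicator {r..t} u * (u - r) powr \<gamma>) \<partial>lborel)"
    by (subst nn_integral_cmult) auto
  also have "\<dots> \<le> inner_kernel \<beta> \<gamma> t r"
    unfolding inner_kernel_def using assms by (intro nn_integral_mono)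
      (auto simp: indicator_def ennreal_mult[symmetric] intro!: ennreal_leI mult_right_mono powr_comparable)
  finally show ?thesis .
qed

lemma inner_kernel_finite:
  assumes "0 < r"
  shows "inner_kernel \<beta> \<gamma> t r < top"
proof (cases "r \<le> t")
  case True
  define C where "C = max (r powr \<beta>) (t powr \<beta>)"
  have C: "u powr \<beta> \<le> C" if "r \<le> u" "u \<le> t" for u
  proof (cases "0 \<le> \<beta>")
    case True
    then have "u powr \<beta> \<le> t powr \<beta>" using that assms by (intro powr_mono2) auto
    then show ?thesis by (simp add: C_def)
  next
    case False
    then have "u powr \<beta> \<le> r powr \<beta>" using that assms by (intro powr_mono2') auto
    then show ?thesis by (simp add: C_def)
  qed
  have "C \<ge> 0" by (simp add: C_def le_max_iff_disj)
  have "inner_kernel \<beta> \<gamma> t r \<le> (\<integral>\<^sup>+u. ennreal C * ennreal (indicator {r..t} u * (u - r) powr \<gamma>) \<partial>lborel)"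
    unfolding inner_kernel_def using C \<open>C \<ge> 0\<close> by (intro nn_integral_mono)
      (auto simp: indicator_def ennreal_mult[symmetric] intro!: ennreal_leI mult_right_mono)
  also have "\<dots> = ennreal C * ennreal ((t - r) powr (\<gamma> + 1) / (\<gamma> + 1))"
    using \<gamma> True by (subst nn_integral_cmult) (auto simp: nn_integral_powr)
  also have "\<dots> < top" by (simp add: ennreal_mult_less_top)
  finally show ?thesis .
qed (simp add: inner_kernel_eq_0)

lemma inner_kernel_mono: "s \<le> t \<Longrightarrow> inner_kernel \<beta> \<gamma> s r \<le> inner_kernel \<beta> \<gamma> t r"
  unfolding inner_kernel_def by (intro nn_integral_mono) (auto simp: indicator_def)

text \<open>For \<open>r \<le> s\<close> only \<open>u\<close> in \<open>[s, t]\<close> is new.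
  There \<open>(u - r) powr \<gamma> \<le> (u - s) powr \<gamma>\<close> because \<gamma> < 0, and
  moving the singularity to \<open>s\<close> gives a bound independent of \<open>r\<close>. It
  serves for \<open>r\<close> above \<open>s - (t - s)\<close>.\<close>

lemma inner_kernel_diff_le:
  assumes st: "0 < s" "s < t" "t \<le> 2 * s" and r: "0 < r" "r < t"
  shows "inner_kernel \<beta> \<gamma> t r \<le> inner_kernel \<beta> \<gamma> s r + ennreal (2 powr \<bar>\<beta>\<bar> * s powr \<beta> * ((t - s) powr (\<gamma> + 1) / (\<gamma> + 1)))"
proof (cases "r \<le> s")
  case True
  have "inner_kernel \<beta> \<gamma> t r \<le> (\<integral>\<^sup>+u. ennreal (indicator {r..s} u * (u powr \<beta> * (u - r) powr \<gamma>))
     + ennreal (indicator {s..t} u * (u powr \<beta> * (u - s) powr \<gamma>)) \<partial>lborel)"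
    unfolding inner_kernel_def
  proof (intro nn_integral_mono)
    fix u
    show "ennreal (indicator {r..t} u * (u powr \<beta> * (u - r) powr \<gamma>)) \<le> ennreal (indicator {r..s} u * (u powr \<beta> * (u - r) powr \<gamma>))
     + ennreal (indicator {s..t} u * (u powr \<beta> * (u - s) powr \<gamma>))"
    proof (cases "s < u \<and> u \<le> t")
      case u: True
      then have "(u - r) powr \<gamma> \<le> (u - s) powr \<gamma>" using True \<gamma> by (intro powr_mono2') auto
      then show ?thesis using u True by (auto simp: indicator_def intro!: ennreal_leI mult_left_mono)
    qed (use True in \<open>auto simp: indicator_def\<close>)
  qed
  also have "\<dots> = inner_kernel \<beta> \<gamma> s r + (\<integral>\<^sup>+u. ennreal (indicator {s..t} u * (u powr \<beta> * (u - s) powr \<gamma>)) \<partial>lborel)"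
    unfolding inner_kernel_def by (intro nn_integral_add) auto
  also have "\<dots> \<le> inner_kernel \<beta> \<gamma> s r + ennreal (2 powr \<bar>\<beta>\<bar> * s powr \<beta> * ((t - s) powr (\<gamma> + 1) / (\<gamma> + 1)))"
    using st by (intro add_left_mono nn_integral_kernel_le) auto
  finally show ?thesis .
next
  case False
  then have "inner_kernel \<beta> \<gamma> t r \<le> ennreal (2 powr \<bar>\<beta>\<bar> * s powr \<beta> * ((t - r) powr (\<gamma> + 1) / (\<gamma> + 1)))"
    unfolding inner_kernel_def using st r by (intro nn_integral_kernel_le) auto
  also have "\<dots> \<le> ennreal (2 powr \<bar>\<beta>\<bar> * s powr \<beta> * ((t - s) powr (\<gamma> + 1) / (\<gamma> + 1)))"
    using False \<gamma> r by (intro ennreal_leI mult_left_mono divide_right_mono powr_mono2) auto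
  finally show ?thesis by (simp add: add_increasing)
qed

text \<open>On \<open>[s, t]\<close> the factor \<open>(u - r) powr \<gamma>\<close> is largest at
  \<open>u = s\<close>. The resulting bound is linear in \<open>t - s\<close>, and its decay as
  \<open>s - r\<close> grows controls the contribution of the distant past.\<close>

lemma inner_kernel_diff_le_far:
  assumes st: "0 < s" "s < t" "t \<le> 2 * s" and r: "0 < r" "r < s"
  shows "inner_kernel \<beta> \<gamma> t r \<le> inner_kernel \<beta> \<gamma> s r + ennreal (2 powr \<bar>\<beta>\<bar> * s powr \<beta> * ((t - s) * (s - r) powr \<gamma>))"
proof -
  define c where "c = 2 powr \<bar>\<beta>\<bar> * s powr \<beta> * (s - r) powr \<gamma>"
  have "inner_kernel \<beta> \<gamma> t r \<le> (\<integral>\<^sup>+u. ennreal (indicator {r..s} u * (u powr \<beta> * (u - r) powr \<gamma>))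
     + ennreal c * indicator {s..t} u \<partial>lborel)"
    unfolding inner_kernel_def
  proof (intro nn_integral_mono)
    fix u
    show "ennreal (indicator {r..t} u * (u powr \<beta> * (u - r) powr \<gamma>)) \<le> ennreal (indicator {r..s} u * (u powr \<beta> * (u - r) powr \<gamma>))
     + ennreal c * indicator {s..t} u"
    proof (cases "s < u \<and> u \<le> t")
      case u: True
      then have "(u - r) powr \<gamma> \<le> (s - r) powr \<gamma>" using r \<gamma> by (intro powr_mono2') auto
      moreover have "u powr \<beta> \<le> 2 powr \<bar>\<beta>\<bar> * s powr \<beta>" using u st by (intro powr_comparable) auto
      ultimately have "u powr \<beta> * (u - r) powr \<gamma> \<le> c" unfolding c_def by (intro mult_mono) auto
      then show ?thesis using u r by (auto simp: indicator_def intro!: ennreal_leI)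
    qed (use r in \<open>auto simp: indicator_def\<close>)
  qed
  also have "\<dots> = inner_kernel \<beta> \<gamma> s r + ennreal c * ennreal (t - s)"
    unfolding inner_kernel_def using st by (subst nn_integral_add) (auto simp: nn_integral_cmult_indicator)
  also have "ennreal c * ennreal (t - s) = ennreal (2 powr \<bar>\<beta>\<bar> * s powr \<beta> * ((t - s) * (s - r) powr \<gamma>))"
    using st by (simp add: c_def ac_simps flip: ennreal_mult)
  finally show ?thesis .
qed

lemma volterra_kernel_diff_le:
  assumes "0 < r" "s \<le> t" "0 \<le> d" "inner_kernel \<beta> \<gamma> t r \<le> inner_kernel \<beta> \<gamma> s r + ennreal d"
  shows "(volterra_kernel \<alpha> \<beta> \<gamma> t r - volterra_kernel \<alpha> \<beta> \<gamma> s r)\<^sup>2 \<le> (r powr \<alpha> * d)\<^sup>2"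
proof -
  have fin: "inner_kernel \<beta> \<gamma> x r \<noteq> top" for x using inner_kernel_finite[OF assms(1), of x] by simp
  have "enn2real (inner_kernel \<beta> \<gamma> t r) \<le> enn2real (inner_kernel \<beta> \<gamma> s r + ennreal d)"
    using assms fin by (intro enn2real_mono) (auto simp: less_top ennreal_add_eq_top)
  also have "\<dots> = enn2real (inner_kernel \<beta> \<gamma> s r) + d"
    using assms fin by (subst enn2real_plus) (auto simp: less_top)
  finally have 1: "enn2real (inner_kernel \<beta> \<gamma> t r) - enn2real (inner_kernel \<beta> \<gamma> s r) \<le> d" by simp
  have 2: "enn2real (inner_kernel \<beta> \<gamma> s r) \<le> enn2real (inner_kernel \<beta> \<gamma> t r)"
    using fin by (intro enn2real_mono inner_kernel_mono assms) (simp add: less_top)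
  have "(volterra_kernel \<alpha> \<beta> \<gamma> t r - volterra_kernel \<alpha> \<beta> \<gamma> s r)
     = r powr \<alpha> * (enn2real (inner_kernel \<beta> \<gamma> t r) - enn2real (inner_kernel \<beta> \<gamma> s r))"
    by (simp add: volterra_kernel_eq algebra_simps)
  also have "(\<dots>)\<^sup>2 \<le> (r powr \<alpha> * d)\<^sup>2"
    using 1 2 by (intro power_mono mult_left_mono) auto
  finally show ?thesis .
qed

end

section \<open>Square norms of the kernel and of its increments\<close>

lemma powr_power2: "0 < x \<Longrightarrow> (x powr a)\<^sup>2 = (x::real) powr (2 * a)"
  by (simp add: powr_powr mult.commute flip: powr_numeral)

definition kernel_ext :: "real \<Rightarrow> real \<Rightarrow> real \<Rightarrow> real \<Rightarrow> real \<Rightarrow> real" where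
  "kernel_ext \<alpha> \<beta> \<gamma> t r = indicator {0..t} r * volterra_kernel \<alpha> \<beta> \<gamma> t r"

text \<open>Half of \<open>(s, t]\<close> suffices: for \<open>r \<le> s + h / 2\<close> at least
  \<open>h / 2\<close> remains up to \<open>t\<close>, so the kernel is at least
  \<open>c0 * s powr (\<alpha> + \<beta>) * h powr (\<gamma> + 1)\<close>. Its square over an
  interval of length \<open>h / 2\<close> gives the exponent \<open>2 * \<gamma> + 3\<close> of
  \<open>h\<close> and the factor \<open>sqrt (1/2)\<close> in \<open>c\<close>.\<close>

lemma kernel_ext_lower:
  assumes \<gamma>: "- 1 < \<gamma>" "\<gamma> < 0"
  obtains c where "0 < c" "\<And>s t. 0 < s \<Longrightarrow> s < t \<Longrightarrow> t \<le> 2 * s \<Longrightarrow>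
     ennreal ((c * s powr (\<alpha> + \<beta>) * (t - s) powr (\<gamma> + 3/2))\<^sup>2) \<le> (\<integral>\<^sup>+r\<in>{s<..t}. ennreal ((kernel_ext \<alpha> \<beta> \<gamma> t r)\<^sup>2) \<partial>lborel)"
proof -
  define c0 where "c0 = 2 powr (- \<bar>\<alpha>\<bar>) * 2 powr (- \<bar>\<beta>\<bar>) * ((1/2) powr (\<gamma> + 1) / (\<gamma> + 1))"
  define c where "c = c0 * sqrt (1/2)"
  have c0: "0 < c0" using \<gamma> by (simp add: c0_def)
  then have c: "0 < c" by (simp add: c_def)
  show ?thesis
  proof (rule that[OF c])
    fix s t :: real assume st: "0 < s" "s < t" "t \<le> 2 * s"
    define h where "h = t - s"
    have h: "0 < h" using st by (simp add: h_def)
    have K: "c0 * s powr (\<alpha> + \<beta>) * h powr (\<gamma> + 1) \<le> volterra_kernel \<alpha> \<beta> \<gamma> t r" if r: "s < r" "r \<le> s + h / 2" for r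
    proof -
      have rt: "r \<le> t" "h / 2 \<le> t - r" using r h by (auto simp: h_def field_simps)
      have 1: "2 powr (- \<bar>\<alpha>\<bar>) * s powr \<alpha> \<le> r powr \<alpha>"
        using r rt st by (intro powr_comparable) auto
      have "ennreal (2 powr (- \<bar>\<beta>\<bar>) * s powr \<beta> * ((t - r) powr (\<gamma> + 1) / (\<gamma> + 1))) \<le> inner_kernel \<beta> \<gamma> t r"
        using st r rt \<gamma> by (intro inner_kernel_ge) auto
      then have "enn2real (ennreal (2 powr (- \<bar>\<beta>\<bar>) * s powr \<beta> * ((t - r) powr (\<gamma> + 1) / (\<gamma> + 1)))) \<le> enn2real (inner_kernel \<beta> \<gamma> t r)"
        using inner_kernel_finite[OF \<gamma>, of r \<beta> t] st r by (intro enn2real_mono) auto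
      then have 2: "2 powr (- \<bar>\<beta>\<bar>) * s powr \<beta> * ((t - r) powr (\<gamma> + 1) / (\<gamma> + 1)) \<le> enn2real (inner_kernel \<beta> \<gamma> t r)"
        using \<gamma> by simp
      have 3: "(h / 2) powr (\<gamma> + 1) \<le> (t - r) powr (\<gamma> + 1)" using rt h \<gamma> by (intro powr_mono2) auto
      have "c0 * s powr (\<alpha> + \<beta>) * h powr (\<gamma> + 1)
          = (2 powr (- \<bar>\<alpha>\<bar>) * s powr \<alpha>) * (2 powr (- \<bar>\<beta>\<bar>) * s powr \<beta> * ((h / 2) powr (\<gamma> + 1) / (\<gamma> + 1)))"
        using h st by (simp add: c0_def powr_add powr_divide field_simps)
      also have "\<dots> \<le> (2 powr (- \<bar>\<alpha>\<bar>) * s powr \<alpha>) * (2 powr (- \<bar>\<beta>\<bar>) * s powr \<beta> * ((t - r) powr (\<gamma> + 1) / (\<gamma> + 1)))"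
        using 3 \<gamma> by (intro mult_left_mono divide_right_mono) auto
      also have "\<dots> \<le> r powr \<alpha> * enn2real (inner_kernel \<beta> \<gamma> t r)"
        using 1 2 \<gamma> by (intro mult_mono) auto
      finally show ?thesis by (simp add: volterra_kernel_eq)
    qed
    define k where "k = c0 * s powr (\<alpha> + \<beta>) * h powr (\<gamma> + 1)"
    have k: "0 \<le> k" using c0 by (simp add: k_def)
    have "(c * s powr (\<alpha> + \<beta>) * (t - s) powr (\<gamma> + 3/2))\<^sup>2 = k\<^sup>2 * (h / 2)"
    proof -
      have "h powr (\<gamma> + 3/2) = h powr (\<gamma> + 1) * sqrt h"
      proof -
        have "\<gamma> + 3/2 = (\<gamma> + 1) + 1/2" by simp
        then show ?thesis using h by (simp only: powr_add powr_half_sqrt)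
      qed
      then have "c * s powr (\<alpha> + \<beta>) * (t - s) powr (\<gamma> + 3/2) = k * (sqrt (1/2) * sqrt h)"
        by (simp add: c_def k_def h_def[symmetric])
      then show ?thesis using h by (simp add: power_mult_distrib)
    qed
    then have "ennreal ((c * s powr (\<alpha> + \<beta>) * (t - s) powr (\<gamma> + 3/2))\<^sup>2) = (\<integral>\<^sup>+r. ennreal (k\<^sup>2) * indicator {s<..s + h/2} r \<partial>lborel)"
      using h by (subst nn_integral_cmult_indicator) (auto simp: ennreal_mult[symmetric])
    also have "\<dots> \<le> (\<integral>\<^sup>+r\<in>{s<..t}. ennreal ((kernel_ext \<alpha> \<beta> \<gamma> t r)\<^sup>2) \<partial>lborel)"
    proof (intro nn_integral_mono)
      fix r
      show "ennreal (k\<^sup>2) * indicator {s<..s + h/2} r \<le> ennreal ((kernel_ext \<alpha> \<beta> \<gamma> t r)\<^sup>2) * indicator {s<..t} r"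
      proof (cases "s < r \<and> r \<le> s + h/2")
        case True
        then have "k\<^sup>2 \<le> (volterra_kernel \<alpha> \<beta> \<gamma> t r)\<^sup>2" using K[of r] k by (intro power_mono) (auto simp: k_def)
        moreover have "r \<le> t" using True h by (simp add: h_def field_simps)
        ultimately show ?thesis using True st by (auto simp: kernel_ext_def indicator_def intro!: ennreal_leI)
      qed (auto simp: indicator_def)
    qed
    finally show "ennreal ((c * s powr (\<alpha> + \<beta>) * (t - s) powr (\<gamma> + 3/2))\<^sup>2) \<le> (\<integral>\<^sup>+r\<in>{s<..t}. ennreal ((kernel_ext \<alpha> \<beta> \<gamma> t r)\<^sup>2) \<partial>lborel)" .
  qed
qed

text \<open>Self-similarity: substituting \<open>t * u\<close> in the inner integral shows that the
  kernel at \<open>(t, t * r)\<close> is \<open>t powr e\<close> times the kernel at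
  \<open>(1, r)\<close>. Here \<open>e\<close> is 1/2 less than the index of self-similarity, and
  the Jacobian in \<open>r\<close> supplies the missing half.\<close>

lemma kernel_ext_scale:
  assumes t: "0 < t"
    and meas: "kernel_ext \<alpha> \<beta> \<gamma> t \<in> borel_measurable borel"
  shows "(sqint lborel (\<lambda>r. kernel_ext \<alpha> \<beta> \<gamma> t r))
     = ennreal ((t powr (\<alpha> + \<beta> + \<gamma> + 3/2))\<^sup>2) * (sqint lborel (\<lambda>r. kernel_ext \<alpha> \<beta> \<gamma> 1 r))"
proof -
  note [measurable] = meas
  have inner: "inner_kernel \<beta> \<gamma> t (t * r) = ennreal (t powr (\<beta> + \<gamma> + 1)) * inner_kernel \<beta> \<gamma> 1 r" if r: "0 < r" for r
  proof -
    have "inner_kernel \<beta> \<gamma> t (t * r) = \<bar>t\<bar> * (\<integral>\<^sup>+u. ennreal (indicator {t * r..t} (0 + t * u) * ((0 + t * u) powr \<beta> * (0 + t * u - t * r) powr \<gamma>)) \<partial>lborel)"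
      unfolding inner_kernel_def using t by (intro nn_integral_real_affine) auto
    also have "\<dots> = ennreal t * (\<integral>\<^sup>+u. ennreal (t powr (\<beta> + \<gamma>)) * ennreal (indicator {r..1} u * (u powr \<beta> * (u - r) powr \<gamma>)) \<partial>lborel)"
    proof -
      have "indicator {t * r..t} (0 + t * u) * ((0 + t * u) powr \<beta> * (0 + t * u - t * r) powr \<gamma>)
          = t powr (\<beta> + \<gamma>) * (indicator {r..1} u * (u powr \<beta> * (u - r) powr \<gamma>))" for u
      proof (cases "r \<le> u \<and> u \<le> 1")
        case True
        have "t * u - t * r = t * (u - r)" by (simp add: algebra_simps)
        then show ?thesis using True r t by (simp add: powr_mult powr_add)
      next
        case False
        then have "\<not> (t * r \<le> t * u \<and> t * u \<le> t)" using t by simp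
        then show ?thesis using False by (auto simp: indicator_def)
      qed
      then show ?thesis using t by (simp add: ennreal_mult[symmetric])
    qed
    also have "\<dots> = ennreal (t * t powr (\<beta> + \<gamma>)) * inner_kernel \<beta> \<gamma> 1 r"
      using t by (subst nn_integral_cmult) (auto simp: inner_kernel_def ennreal_mult mult.assoc)
    also have "t * t powr (\<beta> + \<gamma>) = t powr (\<beta> + \<gamma> + 1)" using t by (simp add: powr_add)
    finally show ?thesis .
  qed
  define e where "e = \<alpha> + \<beta> + \<gamma> + 1"
  have K: "kernel_ext \<alpha> \<beta> \<gamma> t (t * r) = t powr e * kernel_ext \<alpha> \<beta> \<gamma> 1 r" for r
  proof (cases "0 < r")
    case True
    have "(indicator {0..t} (t * r) :: real) = indicator {0..1} r"
      using t True by (auto simp: indicator_def)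
    moreover have "(t * r) powr \<alpha> = t powr \<alpha> * r powr \<alpha>" using t True by (simp add: powr_mult)
    ultimately show ?thesis
      using t by (simp add: kernel_ext_def volterra_kernel_eq inner[OF True] enn2real_mult e_def powr_add)
  next
    \<comment> \<open>At \<open>r = 0\<close> both sides vanish because
      \<open>0 powr \<alpha> = 0\<close>; negative arguments are cut off by the indicator.\<close>
    case False
    then have "t * r \<le> 0" using t by (simp add: mult_le_0_iff)
    then have "t * r < 0 \<or> r = 0" using t False by (cases "r = 0") (auto simp: mult_less_0_iff)
    then show ?thesis using False by (auto simp: kernel_ext_def volterra_kernel_eq indicator_def)
  qed
  have k1: "kernel_ext \<alpha> \<beta> \<gamma> 1 \<in> borel_measurable borel"
  proof -
    have "kernel_ext \<alpha> \<beta> \<gamma> 1 = (\<lambda>r. kernel_ext \<alpha> \<beta> \<gamma> t (t * r) / t powr e)" using t by (simp add: K)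
    then show ?thesis by simp
  qed
  have "(sqint lborel (\<lambda>r. kernel_ext \<alpha> \<beta> \<gamma> t r)) = \<bar>t\<bar> * (sqint lborel (\<lambda>r. kernel_ext \<alpha> \<beta> \<gamma> t (0 + t * r)))"
    using t by (intro nn_integral_real_affine) auto
  also have "\<dots> = ennreal t * (ennreal ((t powr e)\<^sup>2) * (sqint lborel (\<lambda>r. kernel_ext \<alpha> \<beta> \<gamma> 1 r)))"
    using t k1 by (simp add: K power_mult_distrib ennreal_mult nn_integral_cmult)
  also have "\<dots> = ennreal (t * (t powr e)\<^sup>2) * (sqint lborel (\<lambda>r. kernel_ext \<alpha> \<beta> \<gamma> 1 r))"
    using t by (simp add: ennreal_mult mult.assoc)
  also have "t * (t powr e)\<^sup>2 = (t powr (\<alpha> + \<beta> + \<gamma> + 3/2))\<^sup>2"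
  proof -
    have "(t powr (\<alpha> + \<beta> + \<gamma> + 3/2))\<^sup>2 = t powr (2 * e + 1)" using t by (simp add: powr_power2 e_def algebra_simps)
    then show ?thesis using t by (simp add: powr_power2 powr_add)
  qed
  finally show ?thesis .
qed

text \<open>Three ranges of \<open>r\<close> contribute, each of order \<open>s powr (2 * \<alpha> +
  2 * \<beta>) * h powr (2 * \<gamma> + 3)\<close> with \<open>h = t - s\<close>. On
  \<open>[s - h, t]\<close> the bound independent of \<open>r\<close> is integrated over length
  \<open>2 * h\<close> (\<open>C1\<close>). Between \<open>s / 2\<close> and \<open>s - h\<close>
  the far bound is used, and \<open>2 * \<gamma> < - 1\<close> makes the end near
  \<open>s - h\<close> dominate (\<open>C2\<close>). Below \<open>s / 2\<close> the factor
  \<open>(s - r) powr \<gamma>\<close> is at most \<open>(s / 2) powr \<gamma>\<close>, and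
  \<open>r powr (2 * \<alpha>)\<close> is integrable at 0 because \<alpha> > -1/2
  (\<open>C3\<close>).\<close>

lemma kernel_ext_increment:
  assumes \<alpha>: "- 1/2 < \<alpha>" and \<gamma>: "- 1 < \<gamma>" "\<gamma> < - 1/2"
  obtains C where "0 < C" "\<And>s t. 0 < s \<Longrightarrow> s < t \<Longrightarrow> t \<le> 2 * s \<Longrightarrow>
     (sqint lborel (\<lambda>r. kernel_ext \<alpha> \<beta> \<gamma> t r - kernel_ext \<alpha> \<beta> \<gamma> s r)) \<le> ennreal ((C * s powr (\<alpha> + \<beta>) * (t - s) powr (\<gamma> + 3/2))\<^sup>2)"
proof -
  have \<gamma>0: "\<gamma> < 0" using \<gamma> by simp
  define b a2 where "b = 2 powr \<bar>\<beta>\<bar>" and "a2 = 2 powr \<bar>2 * \<alpha>\<bar>"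
  define C1 where "C1 = a2 * (b / (\<gamma> + 1))\<^sup>2 * 2"
  define C2 where "C2 = a2 * b\<^sup>2 * (1 / (- (2 * \<gamma> + 1)))"
  define C3 where "C3 = b\<^sup>2 * (1/2) powr (2 * \<gamma>) * ((1/2) powr (2 * \<alpha> + 1) / (2 * \<alpha> + 1))"
  have pos: "0 < b" "0 < a2" "0 < C1" "0 < C2" "0 < C3"
    using \<alpha> \<gamma> by (auto simp: b_def a2_def C1_def C2_def C3_def intro!: mult_pos_pos divide_pos_pos)
  show ?thesis
  proof (rule that[of "sqrt (C1 + C2 + C3)"])
    show "0 < sqrt (C1 + C2 + C3)" using pos by simp
    fix s t :: real assume st: "0 < s" "s < t" "t \<le> 2 * s"
    define h where "h = t - s"
    have h: "0 < h" "h \<le> s" using st by (auto simp: h_def)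
    define k where "k r = (kernel_ext \<alpha> \<beta> \<gamma> t r - kernel_ext \<alpha> \<beta> \<gamma> s r)\<^sup>2" for r
    define q1 where "q1 = a2 * s powr (2 * \<alpha>) * (b * s powr \<beta> * (h powr (\<gamma> + 1) / (\<gamma> + 1)))\<^sup>2"
    define q2 where "q2 = a2 * s powr (2 * \<alpha>) * (b * s powr \<beta> * h)\<^sup>2"
    define q3 where "q3 = (b * s powr \<beta> * h * (s / 2) powr \<gamma>)\<^sup>2"
    have q: "0 \<le> q1" "0 \<le> q2" "0 \<le> q3" using pos by (auto simp: q1_def q2_def q3_def)
    have keq: "k r = (volterra_kernel \<alpha> \<beta> \<gamma> t r - volterra_kernel \<alpha> \<beta> \<gamma> s r)\<^sup>2" if "0 < r" "r \<le> t" for r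
      using that st inner_kernel_eq_0[of s r \<beta> \<gamma>] by (auto simp: k_def kernel_ext_def volterra_kernel_eq indicator_def)
    have k0: "k r = 0" if "\<not> (0 < r \<and> r < t)" for r
    proof -
      have z: "inner_kernel \<beta> \<gamma> t t = 0" "inner_kernel \<beta> \<gamma> s t = 0"
      proof -
        have "indicator {t..t} u * (u powr \<beta> * (u - t) powr \<gamma>) = (0::real)" for u by (auto simp: indicator_def)
        then show "inner_kernel \<beta> \<gamma> t t = 0"
          unfolding inner_kernel_def by (simp only: ennreal_0 nn_integral_const mult_zero_left)
      qed (use st in \<open>simp add: inner_kernel_eq_0\<close>)
      have "r < 0 \<or> r = 0 \<or> r = t \<or> t < r" using that by auto
      then show ?thesis using z st by (elim disjE) (auto simp: k_def kernel_ext_def volterra_kernel_eq indicator_def)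
    qed
    have k1: "k r \<le> q1" if r: "s / 2 \<le> r" "0 < r" "r < t" for r
    proof -
      have i: "inner_kernel \<beta> \<gamma> t r \<le> inner_kernel \<beta> \<gamma> s r + ennreal (b * s powr \<beta> * (h powr (\<gamma> + 1) / (\<gamma> + 1)))"
        unfolding b_def h_def by (rule inner_kernel_diff_le[OF \<gamma>(1) \<gamma>0 st r(2,3)])
      have "k r \<le> (r powr \<alpha> * (b * s powr \<beta> * (h powr (\<gamma> + 1) / (\<gamma> + 1))))\<^sup>2"
        unfolding keq[OF r(2) less_imp_le[OF r(3)]] using st h pos \<gamma>
        by (intro volterra_kernel_diff_le[OF \<gamma>(1) \<gamma>0 r(2) _ _ i]) auto
      also have "\<dots> = r powr (2 * \<alpha>) * (b * s powr \<beta> * (h powr (\<gamma> + 1) / (\<gamma> + 1)))\<^sup>2"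
        by (simp only: power_mult_distrib[of "r powr \<alpha>"] powr_power2[OF r(2)])
      also have "\<dots> \<le> q1" unfolding q1_def a2_def using r st by (intro mult_right_mono powr_comparable) auto
      finally show ?thesis .
    qed
    have kf: "k r \<le> (r powr \<alpha> * (b * s powr \<beta> * (h * (s - r) powr \<gamma>)))\<^sup>2" if r: "0 < r" "r < s" for r
    proof -
      have "r \<le> t" using r st by simp
      have i: "inner_kernel \<beta> \<gamma> t r \<le> inner_kernel \<beta> \<gamma> s r + ennreal (b * s powr \<beta> * (h * (s - r) powr \<gamma>))"
        unfolding b_def h_def by (rule inner_kernel_diff_le_far[OF \<gamma>(1) \<gamma>0 st r])
      show ?thesis unfolding keq[OF r(1) \<open>r \<le> t\<close>] using st h pos
        by (intro volterra_kernel_diff_le[OF \<gamma>(1) \<gamma>0 r(1) _ _ i]) auto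
    qed
    have k2: "k r \<le> q2 * (s - r) powr (2 * \<gamma>)" if r: "s / 2 \<le> r" "0 < r" "r < s" for r
    proof -
      have "k r \<le> r powr (2 * \<alpha>) * ((b * s powr \<beta> * h)\<^sup>2 * (s - r) powr (2 * \<gamma>))"
        using kf[of r] r by (simp add: power_mult_distrib powr_power2 mult_ac)
      also have "\<dots> \<le> (a2 * s powr (2 * \<alpha>)) * ((b * s powr \<beta> * h)\<^sup>2 * (s - r) powr (2 * \<gamma>))"
        unfolding a2_def using r st by (intro mult_right_mono powr_comparable) auto
      finally show ?thesis by (simp add: q2_def mult_ac)
    qed
    have k3: "k r \<le> q3 * r powr (2 * \<alpha>)" if r: "0 < r" "r \<le> s / 2" for r
    proof -
      have le: "(s - r) powr \<gamma> \<le> (s / 2) powr \<gamma>" using r st \<gamma> by (intro powr_mono2') auto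
      have "k r \<le> (r powr \<alpha> * (b * s powr \<beta> * (h * (s - r) powr \<gamma>)))\<^sup>2" using kf[of r] r st by auto
      also have "\<dots> \<le> (r powr \<alpha> * (b * s powr \<beta> * (h * (s / 2) powr \<gamma>)))\<^sup>2"
        using le h pos by (intro power_mono mult_left_mono) auto
      also have "\<dots> = q3 * r powr (2 * \<alpha>)"
        using r by (simp add: q3_def power_mult_distrib powr_power2 mult_ac)
      finally show ?thesis .
    qed
    have bound: "ennreal (k r) \<le> ennreal q1 * indicator {s - h..t} r
        + (ennreal q2 * ennreal (indicator {..s - h} r * indicator {s/2..} r * (s - r) powr (2 * \<gamma>))
        + ennreal q3 * ennreal (indicator {0..s/2} r * (r - 0) powr (2 * \<alpha>)))" for r
    proof (cases "0 < r \<and> r < t")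
      case False
      then show ?thesis using k0[of r] by simp
    next
      case True
      \<comment> \<open>If \<open>h > s / 2\<close>, the third range is empty and the second one
        begins at \<open>s / 2\<close>.\<close>
      consider "r \<le> s / 2" | "s / 2 < r" "s - h \<le> r" | "s / 2 < r" "r < s - h" by linarith
      then show ?thesis
      proof cases
        case 1
        then have "ennreal (k r) \<le> ennreal q3 * ennreal (r powr (2 * \<alpha>))"
          using k3[of r] True q by (simp add: ennreal_leI flip: ennreal_mult)
        then show ?thesis using 1 True by (simp add: add_increasing)
      next
        case 2
        then have "ennreal (k r) \<le> ennreal q1" using k1[of r] True by (simp add: ennreal_leI)
        then show ?thesis using 2 True by (simp add: add_increasing2)
      next
        case 3
        then have "ennreal (k r) \<le> ennreal q2 * ennreal ((s - r) powr (2 * \<gamma>))"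
          using k2[of r] True h q by (simp add: ennreal_leI flip: ennreal_mult)
        then show ?thesis using 3 True by (simp add: add_increasing add_increasing2)
      qed
    qed
    have i2: "(\<integral>\<^sup>+r. ennreal (indicator {..s - h} r * indicator {s/2..} r * (s - r) powr (2 * \<gamma>)) \<partial>lborel)
       \<le> ennreal (h powr (2 * \<gamma> + 1) / (- (2 * \<gamma> + 1)))"
    proof (cases "s / 2 \<le> s - h")
      case True
      define e where "e = 2 * \<gamma> + 1"
      have e: "e \<noteq> 0" "2 * \<gamma> = e - 1" using \<gamma> by (auto simp: e_def)
      define F where "F r = (s - r) powr (2 * \<gamma> + 1) / (- (2 * \<gamma> + 1))" for r
      have "(\<integral>\<^sup>+r. ennreal (indicator {..s - h} r * indicator {s/2..} r * (s - r) powr (2 * \<gamma>)) \<partial>lborel)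
         = (\<integral>\<^sup>+r. ennreal ((s - r) powr (2 * \<gamma>)) * indicator {s/2..s - h} r \<partial>lborel)"
        by (intro nn_integral_cong) (auto simp: indicator_def)
      also have "\<dots> = ennreal (F (s - h) - F (s/2))"
      proof (rule nn_integral_FTC_Icc)
        fix x assume "x \<in> {s / 2..s - h}"
        then have sx: "0 < s - x" using h by simp
        have "((\<lambda>r. (s - r) powr e) has_real_derivative (e * (s - x) powr (e - 1) * (- 1))) (at x)"
          using sx by (auto intro!: derivative_eq_intros)
        from DERIV_cdivide[OF this, of "- e"]
        show "(F has_real_derivative (s - x) powr (2 * \<gamma>)) (at x)"
          unfolding F_def[abs_def] e_def[symmetric] e(2) using e(1) by simp
      qed (use True in auto)
      also have "\<dots> \<le> ennreal (F (s - h))" using \<gamma> by (intro ennreal_leI) (simp add: F_def divide_nonneg_neg)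
      finally show ?thesis by (simp add: F_def)
    next
      case False
      then have "indicator {..s - h} r * indicator {s/2..} r * (s - r) powr (2 * \<gamma>) = 0" for r
        by (auto simp: indicator_def)
      then show ?thesis by (simp only: ennreal_0 nn_integral_const mult_zero_left zero_le)
    qed
    have "(\<integral>\<^sup>+r. ennreal (k r) \<partial>lborel) \<le> (\<integral>\<^sup>+r. (ennreal q1 * indicator {s - h..t} r
        + (ennreal q2 * ennreal (indicator {..s - h} r * indicator {s/2..} r * (s - r) powr (2 * \<gamma>))
        + ennreal q3 * ennreal (indicator {0..s/2} r * (r - 0) powr (2 * \<alpha>)))) \<partial>lborel)"
      by (intro nn_integral_mono bound)
    also have "\<dots> = ennreal q1 * ennreal (2 * h) + (ennreal q2 * (\<integral>\<^sup>+r. ennreal (indicator {..s - h} r * indicator {s/2..} r * (s - r) powr (2 * \<gamma>)) \<partial>lborel)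
        + ennreal q3 * ennreal ((s / 2) powr (2 * \<alpha> + 1) / (2 * \<alpha> + 1)))"
    proof -
      have "emeasure lborel {s - h..t} = ennreal (2 * h)" using h by (simp add: h_def)
      moreover have "(\<integral>\<^sup>+r. ennreal (indicator {0..s/2} r * (r - 0) powr (2 * \<alpha>)) \<partial>lborel) = ennreal ((s / 2) powr (2 * \<alpha> + 1) / (2 * \<alpha> + 1))"
        using nn_integral_powr[of "2 * \<alpha>" 0 "s/2"] \<alpha> st by simp
      ultimately show ?thesis
        by (subst nn_integral_add, simp, simp, subst nn_integral_add, simp, simp)
          (simp add: nn_integral_cmult nn_integral_cmult_indicator)
    qed
    also have "\<dots> \<le> ennreal q1 * ennreal (2 * h) + (ennreal q2 * ennreal (h powr (2 * \<gamma> + 1) / (- (2 * \<gamma> + 1)))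
        + ennreal q3 * ennreal ((s / 2) powr (2 * \<alpha> + 1) / (2 * \<alpha> + 1)))"
      by (intro add_mono mult_left_mono i2 order_refl) auto
    also have "\<dots> = ennreal (q1 * (2 * h) + (q2 * (h powr (2 * \<gamma> + 1) / (- (2 * \<gamma> + 1))) + q3 * ((s / 2) powr (2 * \<alpha> + 1) / (2 * \<alpha> + 1))))"
    proof -
      have "0 \<le> h powr (2 * \<gamma> + 1) / (- (2 * \<gamma> + 1))" "0 \<le> (s / 2) powr (2 * \<alpha> + 1) / (2 * \<alpha> + 1)"
        using \<gamma> \<alpha> by (auto intro: divide_nonneg_nonneg)
      moreover have "ennreal a * ennreal b + (ennreal c * ennreal d + ennreal e * ennreal f) = ennreal (a * b + (c * d + e * f))"
        if "0 \<le> a" "0 \<le> b" "0 \<le> c" "0 \<le> d" "0 \<le> e" "0 \<le> f" for a b c d e f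
        using that by (simp add: ennreal_mult)
      ultimately show ?thesis using q h by (metis less_imp_le mult_nonneg_nonneg zero_le_numeral)
    qed
    also have "\<dots> \<le> ennreal ((C1 + C2 + C3) * (s powr (2 * \<alpha> + 2 * \<beta>) * h powr (2 * \<gamma> + 3)))"
    proof (rule ennreal_leI)
      define z where "z = s powr (2 * \<alpha> + 2 * \<beta>) * h powr (2 * \<gamma> + 3)"
      have hp: "h powr (2 * \<gamma> + 3) = h powr (2 * \<gamma> + 2) * h" "h powr (2 * \<gamma> + 3) = h\<^sup>2 * h powr (2 * \<gamma> + 1)"
        using h by (simp_all flip: powr_add powr_numeral add: powr_mult_base) (simp_all add: algebra_simps powr_mult_base mult.commute)
      have sp: "s powr (2 * \<alpha> + 2 * \<beta>) = s powr (2 * \<alpha>) * s powr (2 * \<beta>)" by (simp add: powr_add)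
      have e1: "q1 * (2 * h) = C1 * z"
        using h st unfolding z_def sp hp(1) by (simp add: q1_def C1_def power_mult_distrib power_divide powr_power2 mult_ac)
      have e2: "q2 * (h powr (2 * \<gamma> + 1) / (- (2 * \<gamma> + 1))) = C2 * z"
        using h st unfolding z_def sp hp(2) by (simp add: q2_def C2_def power_mult_distrib powr_power2 mult_ac)
      have e3: "q3 * ((s / 2) powr (2 * \<alpha> + 1) / (2 * \<alpha> + 1)) \<le> C3 * z"
      proof -
        \<comment> \<open>Away from the singularity the increment is of order \<open>h\<close>, a
          higher power than \<gamma> + 3/2. The surplus is traded for powers of \<open>s\<close> by
          means of \<open>h \<le> s\<close> and the positive exponent
          \<open>- 1 - 2 * \<gamma>\<close>.\<close>
        have "h powr (- 1 - 2 * \<gamma>) \<le> s powr (- 1 - 2 * \<gamma>)" using h \<gamma> by (intro powr_mono2) auto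
        then have "h powr (2 * \<gamma> + 3) * h powr (- 1 - 2 * \<gamma>) \<le> h powr (2 * \<gamma> + 3) * s powr (- 1 - 2 * \<gamma>)"
          by (intro mult_left_mono) auto
        then have hh: "h\<^sup>2 \<le> h powr (2 * \<gamma> + 3) * s powr (- 1 - 2 * \<gamma>)" using h by (simp flip: powr_add)
        have "q3 * ((s / 2) powr (2 * \<alpha> + 1) / (2 * \<alpha> + 1)) = C3 * (s powr (2 * \<beta>) * s powr (2 * \<gamma>) * s powr (2 * \<alpha> + 1)) * h\<^sup>2"
        proof -
          have "(s / 2) powr x = s powr x * (1/2) powr x" for x
            using st powr_mult[of s "1/2" x] by simp
          then show ?thesis using st
            by (simp add: q3_def C3_def power_mult_distrib powr_power2 mult_ac)
        qed
        also have "\<dots> \<le> C3 * (s powr (2 * \<beta>) * s powr (2 * \<gamma>) * s powr (2 * \<alpha> + 1)) * (h powr (2 * \<gamma> + 3) * s powr (- 1 - 2 * \<gamma>))"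
          using hh pos by (intro mult_left_mono) auto
        also have "\<dots> = C3 * (s powr (2 * \<beta> + 2 * \<gamma> + (2 * \<alpha> + 1) + (- 1 - 2 * \<gamma>)) * h powr (2 * \<gamma> + 3))"
          by (simp only: powr_add mult_ac)
        also have "\<dots> = C3 * z" by (simp add: z_def algebra_simps)
        finally show ?thesis .
      qed
      show "q1 * (2 * h) + (q2 * (h powr (2 * \<gamma> + 1) / (- (2 * \<gamma> + 1))) + q3 * ((s / 2) powr (2 * \<alpha> + 1) / (2 * \<alpha> + 1)))
        \<le> (C1 + C2 + C3) * (s powr (2 * \<alpha> + 2 * \<beta>) * h powr (2 * \<gamma> + 3))"
        using e1 e2 e3 unfolding z_def[symmetric] by (simp add: algebra_simps)
    qed
    also have "(C1 + C2 + C3) * (s powr (2 * \<alpha> + 2 * \<beta>) * h powr (2 * \<gamma> + 3))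
       = (sqrt (C1 + C2 + C3) * s powr (\<alpha> + \<beta>) * (t - s) powr (\<gamma> + 3/2))\<^sup>2"
      using st pos h by (simp add: power_mult_distrib powr_power2 h_def algebra_simps)
    finally show "(sqint lborel (\<lambda>r. kernel_ext \<alpha> \<beta> \<gamma> t r - kernel_ext \<alpha> \<beta> \<gamma> s r))
       \<le> ennreal ((sqrt (C1 + C2 + C3) * s powr (\<alpha> + \<beta>) * (t - s) powr (\<gamma> + 3/2))\<^sup>2)"
      by (simp add: k_def)
  qed
qed

section \<open>Normal tails and dyadic points\<close>

lemma std_normal_atMost_less_1: "measure \<N> {..x} < 1"
proof -
  interpret N: prob_space \<N> by (rule prob_space_std_normal)
  have "0 < emeasure \<N> {x<..}"
  proof (rule ccontr)
    assume "\<not> ?thesis"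
    then have "(\<integral>\<^sup>+y. ennreal (std_normal_density y) * indicator {x<..} y \<partial>lborel) = 0"
      by (simp add: emeasure_density)
    then have "AE y in lborel. ennreal (std_normal_density y) * indicator {x<..} y = 0"
      by (subst (asm) nn_integral_0_iff_AE) auto
    then have "AE y in lborel. y \<notin> {x<..}"
    proof eventually_elim
      case (elim y)
      then show ?case using normal_density_pos[of 1 0 y] by (auto simp: indicator_def split: if_splits)
    qed
    then have "emeasure lborel {x<..} = 0" by (subst (asm) AE_iff_measurable[OF _ refl]) (auto simp: greaterThan_def)
    moreover have "emeasure lborel {x<..x+1} \<le> emeasure lborel {x<..}" by (intro emeasure_mono) auto
    ultimately show False by simp
  qed
  then have "0 < measure \<N> {x<..}" by (simp add: N.emeasure_eq_measure)
  moreover have "measure \<N> {x<..} = 1 - measure \<N> {..x}"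
    using N.prob_compl[of "{..x}"] by (simp add: Compl_atMost[symmetric] Compl_eq_Diff_UNIV)
  ultimately show ?thesis by simp
qed

definition central_prob :: "real \<Rightarrow> real" where
  "central_prob x = measure \<N> {y. \<bar>y\<bar> \<le> x}"

lemma central_prob_small:
  assumes "0 \<le> x" "x \<le> 1"
  shows "2 * std_normal_density 1 * x \<le> central_prob x"
proof -
  interpret N: prob_space \<N> by (rule prob_space_std_normal)
  have S: "{y. \<bar>y\<bar> \<le> x} = {-x..x}" by auto
  have d: "std_normal_density 1 \<le> std_normal_density y" if "\<bar>y\<bar> \<le> 1" for y
  proof -
    have "y\<^sup>2 \<le> 1" using that by (simp add: abs_square_le_1)
    then show ?thesis by (simp add: std_normal_density_def divide_right_mono)
  qed
  have "ennreal (2 * std_normal_density 1 * x) = ennreal (std_normal_density 1) * emeasure lborel {-x..x}"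
    using assms by (simp add: mult_ac flip: ennreal_mult)
  also have "\<dots> = (\<integral>\<^sup>+y. ennreal (std_normal_density 1) * indicator {-x..x} y \<partial>lborel)"
    by (rule nn_integral_cmult_indicator[symmetric]) simp
  also have "\<dots> \<le> (\<integral>\<^sup>+y. ennreal (std_normal_density y) * indicator {-x..x} y \<partial>lborel)"
    using assms d by (intro nn_integral_mono) (auto simp: indicator_def intro!: ennreal_leI)
  also have "\<dots> = emeasure \<N> {-x..x}" by (subst emeasure_density) auto
  finally show ?thesis by (simp add: central_prob_def S N.emeasure_eq_measure)
qed

text \<open>Markov's inequality for the eighth moment, which is 105 = 1 * 3 * 5 * 7. A polynomial
  tail is enough, since it meets arguments that themselves grow like a power of the dyadic
  scale.\<close>

lemma central_prob_large:
  assumes "0 < x"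
  shows "1 - central_prob x \<le> 105 / x ^ 8"
proof -
  interpret N: prob_space \<N> by (rule prob_space_std_normal)
  have "1 - central_prob x = N.prob {y. x < \<bar>y\<bar>}"
  proof -
    have "UNIV - {y. \<bar>y\<bar> \<le> x} = {y. x < \<bar>y\<bar>}" by auto
    then show ?thesis using N.prob_compl[of "{y. \<bar>y\<bar> \<le> x}"] by (simp add: central_prob_def)
  qed
  also have "\<dots> \<le> N.prob {y \<in> space \<N>. x ^ 8 \<le> y ^ 8}"
  proof (intro N.finite_measure_mono)
    show "{y. x < \<bar>y\<bar>} \<subseteq> {y \<in> space \<N>. x ^ 8 \<le> y ^ 8}"
    proof safe
      fix y assume "x < \<bar>y\<bar>"
      then have "x ^ 8 \<le> \<bar>y\<bar> ^ 8" using assms by (intro power_mono) auto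
      then show "x ^ 8 \<le> y ^ 8" by (simp add: power_even_abs)
    qed simp
  qed simp
  also have "\<dots> \<le> (LINT y|\<N>. y ^ 8) / x ^ 8"
    using std_normal_distribution_even_moments(2)[of 4] assms
    by (intro integral_Markov_inequality_measure[where A="{}"]) auto
  also have "(LINT y|\<N>. y ^ 8) = 105"
    using std_normal_distribution_even_moments(1)[of 4] by (simp add: fact_numeral)
  finally show ?thesis .
qed

lemma central_prob_mono: "x \<le> y \<Longrightarrow> central_prob x \<le> central_prob y"
proof -
  interpret N: prob_space \<N> by (rule prob_space_std_normal)
  show "x \<le> y \<Longrightarrow> central_prob x \<le> central_prob y"
    unfolding central_prob_def by (intro N.finite_measure_mono) auto
qed

text \<open>For small \<open>x\<close> the probability is at least linear, so minus its logarithm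
  grows like \<open>ln (1 / x)\<close>, more slowly than any power \<open>x powr (- q)\<close>; for
  large \<open>x\<close> it is of the order of the tail, hence the restriction
  \<open>q \<le> 8\<close>. The summands of \<open>D\<close> belong to the linear factor, to the
  logarithm and to the tail.\<close>

lemma central_prob_ge_exp:
  fixes q :: real
  assumes q: "0 < q" "q \<le> 8"
  obtains D where "0 < D" "\<And>x. 0 < x \<Longrightarrow> exp (- D * x powr (- q)) \<le> central_prob x"
proof -
  define c where "c = 2 * std_normal_density 1"
  have c: "0 < c" using normal_density_pos[of 1 0 1] by (simp add: c_def)
  define D where "D = \<bar>ln c\<bar> + 1 / q + 105 / c"
  have D: "0 < D" using q c by (simp add: D_def add_nonneg_pos)
  show ?thesis
  proof (rule that[OF D])
    fix x :: real assume x: "0 < x"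
    show "exp (- D * x powr (- q)) \<le> central_prob x"
    proof (cases "x \<le> 1")
      case True
      have y: "1 \<le> (1 / x)" using x True by simp
      have xq: "x powr (- q) = (1 / x) powr q" using x by (simp add: powr_minus powr_divide divide_simps)
      have "1 \<le> (1 / x) powr q" using y q by (intro ge_one_powr_ge_zero) auto
      then have 1: "\<bar>ln c\<bar> * 1 \<le> \<bar>ln c\<bar> * x powr (- q)" unfolding xq by (intro mult_left_mono) auto
      have 2: "ln (1 / x) \<le> x powr (- q) / q" unfolding xq using y q by (intro ln_powr_bound) auto
      have "- ln (c * x) = - ln c + ln (1 / x)" using c x by (simp add: ln_mult ln_div)
      also have "\<dots> \<le> \<bar>ln c\<bar> * x powr (- q) + x powr (- q) / q" using 1 2 by simp
      also have "\<dots> \<le> D * x powr (- q)" using c by (simp add: D_def algebra_simps)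
      finally have "exp (- D * x powr (- q)) \<le> exp (ln (c * x))" by simp
      also have "\<dots> = c * x" using c x by simp
      also have "\<dots> \<le> central_prob x" using central_prob_small[of x] x True by (simp add: c_def)
      finally show ?thesis .
    next
      case False
      define F where "F = central_prob x"
      have F: "c \<le> F" using central_prob_small[of 1] central_prob_mono[of 1 x] False by (simp add: c_def F_def)
      then have F0: "0 < F" using c by simp
      have "1 - F \<le> 105 / x ^ 8" using central_prob_large[OF x] by (simp add: F_def)
      also have "105 / x ^ 8 = 105 * x powr (- 8)" 
        using x by (simp add: powr_minus divide_inverse)
      also have "\<dots> \<le> 105 * x powr (- q)" using False q by (intro mult_left_mono powr_mono) auto
      finally have 1: "1 - F \<le> 105 * x powr (- q)" .
      have "- ln F = ln (1 / F)" using F0 by (simp add: ln_div)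
      also have "\<dots> \<le> 1 / F - 1" using F0 by (intro ln_le_minus_one) auto
      also have "\<dots> = (1 - F) / F" using F0 by (simp add: field_simps)
      also have "\<dots> \<le> (105 * x powr (- q)) / c"
        using 1 F F0 c by (intro frac_le) auto
      also have "\<dots> = 105 / c * x powr (- q)" by simp
      also have "\<dots> \<le> D * x powr (- q)" using q by (intro mult_right_mono) (auto simp: D_def)
      finally have "exp (- D * x powr (- q)) \<le> exp (ln F)" by simp
      also have "\<dots> = central_prob x" using F0 by (simp add: F_def)
      finally show ?thesis .
    qed
  qed
qed

section \<open>Two-sided geometric weights\<close>

text \<open>A weight with its peak at \<open>z = 1\<close> that falls off geometrically along
  \<open>2 ^ j * z\<close> on either side; in the chaining, \<open>z = 1\<close> is the scale where
  the standard deviation is comparable with the radius.\<close>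

definition decay :: "real \<Rightarrow> real \<Rightarrow> real" where
  "decay q z = min (z powr q) (z powr (- q))"

lemma decay_ge_1: "1 \<le> z \<Longrightarrow> 0 \<le> q \<Longrightarrow> decay q z = z powr (- q)"
  unfolding decay_def by (intro min_absorb2 powr_mono) auto

lemma decay_le_1: "0 < z \<Longrightarrow> z \<le> 1 \<Longrightarrow> 0 \<le> q \<Longrightarrow> decay q z = z powr q"
  unfolding decay_def by (intro min_absorb1 powr_mono') auto

lemma decay_pos: "0 < z \<Longrightarrow> 0 < decay q z"
  by (simp add: decay_def)

text \<open>The bound has to be uniform in \<open>z\<close>, although for tiny \<open>z\<close>
  arbitrarily many terms precede the peak.\<close>

lemma sum_decay_bounded:
  fixes q :: real
  assumes q: "0 < q"
  obtains B where "0 < B" "\<And>z J. 0 < z \<Longrightarrow> (\<Sum>j<J. decay q (2 ^ j * z)) \<le> B"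
proof -
  define \<rho> where "\<rho> = 2 powr q"
  have \<rho>: "1 < \<rho>" using q by (simp add: \<rho>_def)
  define D e where "D = \<rho> / (\<rho> - 1)" and "e = 1 / (\<rho> - 1)"
  have De: "0 < D" "0 < e" "D = 1 + e" "e * \<rho> = D" using \<rho> by (auto simp: D_def e_def field_simps)
  \<comment> \<open>A potential in \<open>w = z powr q\<close> with
    \<open>decay q z + U (\<rho> * w) \<le> U w\<close>, since doubling \<open>z\<close> multiplies
    \<open>w\<close> by \<open>\<rho>\<close>. For \<open>w \<ge> 1\<close> it is the exact
    geometric tail; below 1 the part \<open>- e * w\<close> pays for the term \<open>w\<close>,
    because \<open>e * \<rho> = 1 + e\<close>.\<close>
  define U where "U w = (if 1 \<le> w then D / w else 1 + D + e - e * w)" for w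
  have main: "(\<Sum>j<J. decay q (2 ^ j * z)) \<le> U (z powr q)" if "0 < z" for z J
    using that
  proof (induction J arbitrary: z)
    case 0
    show ?case
    proof (cases "1 \<le> z powr q")
      case False
      then have "e * z powr q \<le> e * 1" using De by (intro mult_left_mono) auto
      then have "0 \<le> 1 + D + e - e * z powr q" using De(1,2) by linarith
      then show ?thesis using False by (simp add: U_def)
    qed (use De in \<open>simp add: U_def\<close>)
  next
    case (Suc J)
    define w where "w = z powr q"
    have w: "0 < w" using Suc.prems by (simp add: w_def)
    have w2: "(2 * z) powr q = \<rho> * w" using Suc.prems by (simp add: w_def \<rho>_def powr_mult)
    have "(\<Sum>j<Suc J. decay q (2 ^ j * z)) = decay q z + (\<Sum>j<J. decay q (2 ^ j * (2 * z)))"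
      by (subst sum.lessThan_Suc_shift) (simp add: mult_ac)
    also have "\<dots> \<le> decay q z + U (\<rho> * w)" using Suc.IH[of "2 * z"] Suc.prems w2 by simp
    also have "\<dots> \<le> U w"
    proof (cases "1 \<le> w")
      case True
      have "1 \<le> z" using True powr_less_mono2[of q z 1] q Suc.prems unfolding w_def by force
      then have d: "decay q z = 1 / w" using q by (simp add: decay_ge_1 w_def powr_minus divide_inverse)
      have "1 * 1 \<le> \<rho> * w" using True \<rho> by (intro mult_mono) auto
      then have "U (\<rho> * w) = D / (\<rho> * w)" by (simp add: U_def)
      also have "\<dots> = e / w" using \<rho> De(4)[symmetric] by simp
      finally show ?thesis using True d De by (simp add: U_def flip: add_divide_distrib)
    next
      case False
      have "z \<le> 1" using False ge_one_powr_ge_zero[of z q] q unfolding w_def by force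
      then have d: "decay q z = w" using q Suc.prems by (simp add: decay_le_1 w_def)
      have ew: "e * w \<le> e" using False De by simp
      show ?thesis
      proof (cases "1 \<le> \<rho> * w")
        case True
        have "D / (\<rho> * w) \<le> D" using True De by (simp add: divide_le_eq mult_le_cancel_left1)
        then show ?thesis using True False d ew by (simp add: U_def)
      next
        case f: False
        have "w + (1 + D + e - e * (\<rho> * w)) = 1 + D + e - e * w"
        proof -
          have "e * (\<rho> * w) = D * w" using De(4) by (simp flip: mult.assoc)
          then show ?thesis using De(3) by (simp add: algebra_simps)
        qed
        then show ?thesis using f False d by (simp add: U_def)
      qed
    qed
    finally show ?case by (simp add: w_def)
  qed
  show ?thesis
  proof (rule that[of "1 + D + e"])
    show "0 < 1 + D + e" using De by simp
    fix z :: real and J assume z: "0 < z"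
    have "U w \<le> 1 + D + e" if "0 < w" for w
    proof (cases "1 \<le> w")
      case True
      then have "D / w \<le> D" using De by (simp add: divide_le_eq mult_le_cancel_left1)
      then show ?thesis using True De by (simp add: U_def)
    qed (use De that in \<open>simp add: U_def\<close>)
    then show "(\<Sum>j<J. decay q (2 ^ j * z)) \<le> 1 + D + e" using main[OF z, of J] z by (smt (verit) powr_gt_zero)
  qed
qed

text \<open>The form \<open>decay (1/2) z / z\<close> of the cost is dictated by counting: level
  \<open>j\<close> has \<open>2 ^ j\<close> points, and the division by \<open>z\<close> cancels
  this number, leaving summable weights. For \<open>z \<ge> 1\<close> the argument is
  \<open>c * z powr (\<tau>/2)\<close>, and exponent 8 yields \<open>z powr (- 4 * \<tau>)\<close>,
  small enough as \<tau> \<ge> 1/2. For \<open>z < 1\<close> it is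
  \<open>c * z powr (3/2 * \<tau>)\<close>, and exponent 1/3 yields
  \<open>z powr (- \<tau> / 2)\<close>, admissible as \<tau> \<le> 1.\<close>

lemma central_prob_decay:
  fixes \<tau> c :: real
  assumes \<tau>: "1/2 \<le> \<tau>" "\<tau> \<le> 1" and c: "0 < c"
  obtains D where "0 < D" "\<And>z. 0 < z \<Longrightarrow> exp (- D * (decay (1/2) z / z)) \<le> central_prob (c * z powr \<tau> * decay (\<tau>/2) z)"
proof -
  obtain D1 where D1: "0 < D1" "\<And>x. 0 < x \<Longrightarrow> exp (- D1 * x powr (- 8)) \<le> central_prob x"
    by (rule central_prob_ge_exp[of 8]) auto
  obtain D2 where D2: "0 < D2" "\<And>x. 0 < x \<Longrightarrow> exp (- D2 * x powr (- (1/3))) \<le> central_prob x"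
    by (rule central_prob_ge_exp[of "1/3"]) auto
  define D where "D = D1 * c powr (- 8) + D2 * c powr (- (1/3))"
  show ?thesis
  proof (rule that[of D])
    show "0 < D" using D1 D2 c by (simp add: D_def add_pos_pos)
    fix z :: real assume z: "0 < z"
    show "exp (- D * (decay (1/2) z / z)) \<le> central_prob (c * z powr \<tau> * decay (\<tau>/2) z)"
    proof (cases "1 \<le> z")
      case True
      have x: "c * z powr \<tau> * decay (\<tau>/2) z = c * z powr (\<tau>/2)"
        using True \<tau> by (simp add: decay_ge_1 mult.assoc flip: powr_add)
      have "decay (1/2) z / z = z powr (- 3/2)"
        using True z powr_diff[of z "- 1/2" 1] by (simp add: decay_ge_1)
      have e: "(c * z powr (\<tau>/2)) powr (- 8) = c powr (- 8) * z powr (- 4 * \<tau>)"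
        using c z by (simp add: powr_mult powr_powr)
      have "z powr (- 4 * \<tau>) \<le> z powr (- 3/2)" using True \<tau> by (intro powr_mono) auto
      then have "D1 * (c powr (- 8) * z powr (- 4 * \<tau>)) \<le> D1 * (c powr (- 8) * z powr (- 3/2))"
        using D1 by (intro mult_left_mono) auto
      also have "\<dots> \<le> D * z powr (- 3/2)" using D2 by (simp add: D_def algebra_simps)
      finally have "exp (- D * (decay (1/2) z / z)) \<le> exp (- D1 * (c * z powr (\<tau>/2)) powr (- 8))"
        unfolding e \<open>decay (1/2) z / z = z powr (- 3/2)\<close> by simp
      also have "\<dots> \<le> central_prob (c * z powr \<tau> * decay (\<tau>/2) z)"
        unfolding x using c z by (intro D1(2)) auto
      finally show ?thesis .
    next
      case False
      have x: "c * z powr \<tau> * decay (\<tau>/2) z = c * z powr (3/2 * \<tau>)"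
        using False z \<tau> by (simp add: decay_le_1 mult.assoc flip: powr_add)
      have d: "decay (1/2) z / z = z powr (- 1/2)"
        using False z powr_diff[of z "1/2" 1] by (simp add: decay_le_1)
      have e: "(c * z powr (3/2 * \<tau>)) powr (- (1/3)) = c powr (- (1/3)) * z powr (- \<tau> / 2)"
        using c z by (simp add: powr_mult powr_powr)
      have "z powr (- \<tau> / 2) \<le> z powr (- 1/2)" using False z \<tau> by (intro powr_mono') auto
      then have "D2 * (c powr (- (1/3)) * z powr (- \<tau> / 2)) \<le> D2 * (c powr (- (1/3)) * z powr (- 1/2))"
        using D2 by (intro mult_left_mono) auto
      also have "\<dots> \<le> D * z powr (- 1/2)" using D1 by (simp add: D_def algebra_simps)
      finally have "exp (- D * (decay (1/2) z / z)) \<le> exp (- D2 * (c * z powr (3/2 * \<tau>)) powr (- (1/3)))"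
        unfolding e d by simp
      also have "\<dots> \<le> central_prob (c * z powr \<tau> * decay (\<tau>/2) z)"
        unfolding x using c z by (intro D2(2)) auto
      finally show ?thesis .
    qed
  qed
qed

section \<open>Dyadic points and the supremum\<close>

text \<open>Point \<open>i\<close> of level \<open>j\<close> in the block from
  \<open>t / 2 ^ Suc m\<close> to \<open>t / 2 ^ m\<close>, counted from the left end. With
  \<open>i < 2 ^ j\<close> the right end is left out: it starts the neighbouring block or is
  \<open>t\<close> itself. The coarser neighbour of \<open>i\<close> is \<open>i div 2\<close> on
  level \<open>j - 1\<close>.\<close>

definition dyadic_pt :: "real \<Rightarrow> nat \<Rightarrow> nat \<Rightarrow> nat \<Rightarrow> real" where
  "dyadic_pt t m j i = t / 2 ^ Suc m * (1 + real i / 2 ^ j)"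

lemma dyadic_pt_bounds:
  assumes "0 < t" "i < 2 ^ j"
  shows "t / 2 ^ Suc m \<le> dyadic_pt t m j i" "dyadic_pt t m j i \<le> t / 2 ^ m" "0 < dyadic_pt t m j i" "dyadic_pt t m j i \<le> t"
proof -
  have i: "real i / 2 ^ j \<le> 1" "0 \<le> real i / 2 ^ j" using assms(2) by (auto simp: divide_le_eq)
  have "t / 2 ^ Suc m * 1 \<le> dyadic_pt t m j i"
    unfolding dyadic_pt_def using assms i by (intro mult_left_mono) auto
  then show 1: "t / 2 ^ Suc m \<le> dyadic_pt t m j i" by simp
  have "dyadic_pt t m j i \<le> t / 2 ^ Suc m * 2"
    unfolding dyadic_pt_def using assms i by (intro mult_left_mono) auto
  then show 2: "dyadic_pt t m j i \<le> t / 2 ^ m" by simp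
  have "0 < t / 2 ^ Suc m" using assms by simp
  then show "0 < dyadic_pt t m j i" using 1 by linarith
  have "t / 2 ^ m \<le> t / 1" using assms by (intro divide_left_mono) auto
  then show "dyadic_pt t m j i \<le> t" using 2 by simp
qed

lemma dyadic_pt_dense:
  assumes t: "0 < t"
  shows "{0..t} \<subseteq> closure {dyadic_pt t m j i | m j i. i < 2 ^ j}"
proof
  fix x assume x: "x \<in> {0..t}"
  show "x \<in> closure {dyadic_pt t m j i | m j i. i < 2 ^ j}"
    unfolding closure_approachable
  proof (intro allI impI)
    fix e :: real assume e: "0 < e"
    \<comment> \<open>Neither 0 nor \<open>t\<close> lies in one of the half-open blocks, so
      \<open>x\<close> is first moved slightly into the interior.\<close>
    define s where "s = (if x \<le> t / 2 then x + min (e/4) (t/4) else x - min (e/4) (t/4))"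
    have s: "0 < s" "s < t" "\<bar>s - x\<bar> < e / 2" using x e t by (auto simp: s_def min_def)
    obtain k where k: "t / 2 ^ k \<le> s"
    proof -
      obtain k where "t / s < 2 ^ k" using real_arch_pow[of 2 "t / s"] by auto
      then show ?thesis using s t by (intro that[of k]) (simp add: field_simps)
    qed
    \<comment> \<open>The least such exponent locates the block: \<open>s\<close> lies between
      \<open>t / 2 ^ m'\<close> and twice that value.\<close>
    define m' where "m' = (LEAST k. t / 2 ^ k \<le> s)"
    have m1: "t / 2 ^ m' \<le> s" unfolding m'_def using k by (rule LeastI)
    have "m' \<noteq> 0" using m1 s by (intro notI) simp
    then obtain m where m: "m' = Suc m" by (cases m') auto
    have m2: "s < t / 2 ^ m"
    proof (rule ccontr)
      assume "\<not> s < t / 2 ^ m"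
      then have "m' \<le> m" unfolding m'_def by (intro Least_le) simp
      then show False using m by simp
    qed
    obtain j where j: "t / (e / 2) < 2 ^ j" using real_arch_pow[of 2 "t / (e/2)"] by auto
    define y where "y = (s / (t / 2 ^ Suc m) - 1) * 2 ^ j"
    have u: "1 \<le> s / (t / 2 ^ Suc m)" using m1 m t by (simp add: field_simps)
    have u2: "s / (t / 2 ^ Suc m) < 2" using m2 t by (simp add: field_simps)
    have y: "0 \<le> y" "y < 2 ^ j" using u u2 by (auto simp: y_def)
    define i where "i = nat \<lfloor>y\<rfloor>"
    have i: "real i \<le> y" "y < real i + 1" using y by (auto simp: i_def)
    have "real i < 2 ^ j" using i y by linarith
    then have ij: "i < 2 ^ j" by (metis of_nat_less_iff of_nat_numeral of_nat_power)
    have sy: "s = t / 2 ^ Suc m * (1 + y / 2 ^ j)" using t by (simp add: y_def)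
    have diff: "s - dyadic_pt t m j i = t / 2 ^ Suc m * ((y - real i) / 2 ^ j)"
    proof -
      have "a * (1 + y / p) - a * (1 + z / p) = a * ((y - z) / p)" for a z p :: real
        by (simp add: algebra_simps diff_divide_distrib)
      then show ?thesis unfolding sy dyadic_pt_def .
    qed
    have "t / 2 ^ Suc m * ((y - real i) / 2 ^ j) \<le> t * (1 / 2 ^ j)"
    proof (intro mult_mono)
      show "t / 2 ^ Suc m \<le> t" using t by (simp add: divide_le_eq mult_le_cancel_left1 del: power_Suc)
      show "(y - real i) / 2 ^ j \<le> 1 / 2 ^ j" using i by (intro divide_right_mono) auto
    qed (use t i in auto)
    also have "\<dots> < e / 2" using j e by (simp add: field_simps)
    finally have "s - dyadic_pt t m j i < e / 2" using diff by simp
    moreover have "0 \<le> s - dyadic_pt t m j i" unfolding diff using t i by simp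
    ultimately have "dist (dyadic_pt t m j i) x < e" using s(3) unfolding dist_real_def by linarith
    then show "\<exists>y\<in>{dyadic_pt t m j i | m j i. i < 2 ^ j}. dist y x < e" using ij by blast
  qed
qed

text \<open>Continuity and density reduce the supremum to countably many points. This yields
  measurability of the small ball and lets the chaining control dyadic values only; the point 0,
  which no block contains, is reached by closure.\<close>

lemma SUP_abs_le_iff_dyadic:
  assumes t: "0 < t" and g: "continuous_on {0..} g"
  shows "(SUP s\<in>{0..t}. \<bar>g s\<bar>) \<le> (e::real) \<longleftrightarrow> (\<forall>m j i. i < 2 ^ j \<longrightarrow> \<bar>g (dyadic_pt t m j i)\<bar> \<le> e)"
proof -
  have c: "continuous_on {0..t} (\<lambda>s. \<bar>g s\<bar>)" using g by (intro continuous_on_rabs) (auto elim: continuous_on_subset)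
  have bdd: "bdd_above ((\<lambda>s. \<bar>g s\<bar>) ` {0..t})"
    using compact_continuous_image[OF c] by (intro bounded_imp_bdd_above compact_imp_bounded) simp
  define S where "S = {dyadic_pt t m j i | m j i. i < 2 ^ j}"
  have S: "S \<subseteq> {0..t}" using dyadic_pt_bounds[OF t] by (auto simp: S_def less_imp_le)
  then have "closure S \<subseteq> {0..t}" by (intro closure_minimal) auto
  then have cl: "closure S = {0..t}" using dyadic_pt_dense[OF t] by (auto simp: S_def)
  show ?thesis
  proof
    assume "(SUP s\<in>{0..t}. \<bar>g s\<bar>) \<le> e"
    then have "\<bar>g s\<bar> \<le> e" if "s \<in> {0..t}" for s using cSUP_upper[OF that bdd] by linarith
    then show "\<forall>m j i. i < 2 ^ j \<longrightarrow> \<bar>g (dyadic_pt t m j i)\<bar> \<le> e" using S unfolding S_def by blast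
  next
    assume "\<forall>m j i. i < 2 ^ j \<longrightarrow> \<bar>g (dyadic_pt t m j i)\<bar> \<le> e"
    then have "\<bar>g s\<bar> \<le> e" if "s \<in> S" for s using that by (auto simp: S_def)
    then have "\<bar>g s\<bar> \<le> e" if "s \<in> {0..t}" for s
      using continuous_le_on_closure[of S "\<lambda>s. \<bar>g s\<bar>" s e] c that unfolding cl by auto
    then show "(SUP s\<in>{0..t}. \<bar>g s\<bar>) \<le> e" using t by (intro cSUP_least) auto
  qed
qed

section \<open>Small balls of the Volterra process\<close>

locale volterra =
  fixes \<alpha> \<beta> \<gamma> H :: real
    and M :: "'a measure"
    and W X :: "real \<Rightarrow> 'a \<Rightarrow> real"
  assumes \<alpha>: "\<alpha> > - 1/2"
    and \<gamma>: "- 1 < \<gamma>" "\<gamma> < - 1/2"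
    and H_def: "H = \<alpha> + \<beta> + \<gamma> + 3/2"
    and H_pos: "H > 0"
    and bm: "standard_brownian_motion M W"
    and vp: "gaussian_volterra_process M W \<alpha> \<beta> \<gamma> X"
begin

sublocale prob_space M
  using bm by (simp add: standard_brownian_motion_def)

abbreviation "K \<equiv> kernel_ext \<alpha> \<beta> \<gamma>"

definition "\<tau> = \<gamma> + 3/2"

lemma \<tau>: "1/2 < \<tau>" "\<tau> < 1" using \<gamma> by (auto simp: \<tau>_def)

lemma H_split: "H = \<alpha> + \<beta> + \<tau>" by (simp add: H_def \<tau>_def)

lemma wapprox_X: "0 < t \<Longrightarrow> t \<le> T \<Longrightarrow> wapprox M W T (K t) (X t)"
proof -
  assume t: "0 < t" "t \<le> T"
  have "wapprox M W t (\<lambda>r. indicator {0..t} r * volterra_kernel \<alpha> \<beta> \<gamma> t r) (X t)"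
    using vp t by (intro has_wiener_integral_imp_wapprox) (simp add: gaussian_volterra_process_def)
  then show ?thesis unfolding kernel_ext_def[abs_def] using t(2) by (rule wapprox_mono)
qed

lemma X_measurable: "0 < t \<Longrightarrow> X t \<in> borel_measurable M"
  using wapprox_X[of t t] by (simp add: wapprox_def)

definition "small_ball t \<epsilon> = {\<omega> \<in> space M. (SUP s\<in>{0..t}. \<bar>X s \<omega>\<bar>) \<le> \<epsilon>}"

lemma small_ball_eq:
  assumes "0 < t"
  shows "small_ball t \<epsilon> = {\<omega> \<in> space M. \<forall>m j i. i < 2 ^ j \<longrightarrow> \<bar>X (dyadic_pt t m j i) \<omega>\<bar> \<le> \<epsilon>}"
proof -
  have "(SUP s\<in>{0..t}. \<bar>X s \<omega>\<bar>) \<le> \<epsilon> \<longleftrightarrow> (\<forall>m j i. i < 2 ^ j \<longrightarrow> \<bar>X (dyadic_pt t m j i) \<omega>\<bar> \<le> \<epsilon>)"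
    if "\<omega> \<in> space M" for \<omega>
    using vp that by (intro SUP_abs_le_iff_dyadic assms) (simp add: gaussian_volterra_process_def)
  then show ?thesis by (auto simp: small_ball_def)
qed

lemma small_ball_sets:
  assumes "0 < t"
  shows "small_ball t \<epsilon> \<in> sets M"
proof -
  have [measurable]: "X (dyadic_pt t m j i) \<in> borel_measurable M" if "i < 2 ^ j" for m j i
    using dyadic_pt_bounds[OF assms that] by (intro X_measurable) auto
  show ?thesis unfolding small_ball_eq[OF assms]
  proof (intro sets.sets_Collect_countable_All)
    fix m j i :: nat
    show "{\<omega> \<in> space M. i < 2 ^ j \<longrightarrow> \<bar>X (dyadic_pt t m j i) \<omega>\<bar> \<le> \<epsilon>} \<in> sets M"
      by (cases "i < 2 ^ j") auto
  qed
qed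

section \<open>Upper bound from fresh noise on the second half of the interval\<close>

lemma small_ball_upper:
  obtains \<kappa> where "0 < \<kappa>"
    "\<And>t \<epsilon>. 0 < t \<Longrightarrow> 0 < \<epsilon> \<Longrightarrow> \<epsilon> < t powr H \<Longrightarrow> prob (small_ball t \<epsilon>) \<le> exp (- \<kappa> * (t powr H / \<epsilon>) powr (1 / \<tau>))"
proof -
  have \<gamma>0: "\<gamma> < 0" using \<gamma> by simp
  obtain c where c: "0 < c" "\<And>s t. 0 < s \<Longrightarrow> s < t \<Longrightarrow> t \<le> 2 * s \<Longrightarrow>
     ennreal ((c * s powr (\<alpha> + \<beta>) * (t - s) powr (\<gamma> + 3/2))\<^sup>2) \<le> (\<integral>\<^sup>+r\<in>{s<..t}. ennreal ((K t r)\<^sup>2) \<partial>lborel)"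
    by (rule kernel_ext_lower[OF \<gamma>(1) \<gamma>0]) blast
  define c' where "c' = c * 2 powr (- \<bar>\<alpha> + \<beta>\<bar>) * (1/2) powr \<tau>"
  have c': "0 < c'" using c by (simp add: c'_def)
  \<comment> \<open>The second entry bounds the factor of one interval for all \<open>t\<close> and
    \<epsilon> at once; the maximum with 1/2 keeps \<open>q\<close> positive, so that
    \<open>q ^ n\<close> is an exponential of \<open>ln q\<close>.\<close>
  define q where "q = max (1/2) (measure \<N> {..4 * 2 powr \<tau> / c'})"
  have q: "0 < q" "q < 1" using std_normal_atMost_less_1 by (auto simp: q_def)
  show ?thesis
  proof (rule that[of "- ln q"])
    show "0 < - ln q" using q by simp
    fix t \<epsilon> :: real assume t: "0 < t" and \<epsilon>: "0 < \<epsilon>" "\<epsilon> < t powr H"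
    define R where "R = (t powr H / \<epsilon>) powr (1 / \<tau>)"
    have R: "1 \<le> R" unfolding R_def using \<epsilon> \<tau> by (intro ge_one_powr_ge_zero) auto
    \<comment> \<open>Since \<epsilon> is below \<open>t powr H\<close>, \<open>R\<close> is at
      least 1 and rounding up loses at most a factor 2, which is the source of
      \<open>2 powr \<tau>\<close> in \<open>q\<close>.\<close>
    define n where "n = nat \<lceil>R\<rceil>"
    have n: "R \<le> real n" "real n \<le> 2 * R" "0 < n" using R by (auto simp: n_def) linarith+
    define u where "u i = t / 2 * (1 + real i / real n)" for i
    \<comment> \<open>The deviation guaranteed on a cell of length \<open>t / (2 * n)\<close>, with
      the left end of the cell replaced by the comparable time \<open>t\<close>.\<close>
    define v where "v = c' * t powr H * real n powr (- \<tau>)"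
    have v: "0 < v" using c' t n by (simp add: v_def)
    have u_pos: "t / 2 \<le> u i" for i
      using t mult_left_mono[of 1 "1 + real i / real n" "t / 2"] by (simp add: u_def)
    have u_le: "u i \<le> t" if "i \<le> n" for i
    proof -
      have "real i / real n \<le> 1" using that n by simp
      then show ?thesis using t mult_left_mono[of "1 + real i / real n" 2 "t / 2"] by (simp add: u_def)
    qed
    have u_diff: "u (Suc i) - u i = t / 2 / real n" for i
    proof -
      have "u (Suc i) - u i = t / 2 * ((real (Suc i) - real i) / real n)"
        unfolding u_def by (simp only: diff_divide_distrib algebra_simps)
      then show ?thesis by simp
    qed
    have "measure M {\<omega>\<in>space M. \<forall>i<n. \<bar>X (u (Suc i)) \<omega>\<bar> \<le> \<epsilon>} \<le> measure \<N> {..4 * \<epsilon> / v} ^ n"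
    proof (rule wiener_small_ball_upper[OF bm, where \<tau>=u and f="\<lambda>i. K (u (Suc i))" and Y="\<lambda>i. X (u (Suc i))"])
      show "u i < u (Suc i)" if "i < n" for i
      proof -
        have "0 < t / 2 / real n" using t n by simp
        then show ?thesis using u_diff[of i] by linarith
      qed
      show "0 \<le> u 0" using t by (simp add: u_def)
      show "wapprox M W (u (Suc i)) (K (u (Suc i))) (X (u (Suc i)))" if "i < n" for i
      proof (rule wapprox_X)
        show "0 < u (Suc i)" using u_pos[of "Suc i"] t by linarith
      qed simp
      show "ennreal (v\<^sup>2) \<le> (\<integral>\<^sup>+r\<in>{u i<..u (Suc i)}. ennreal ((K (u (Suc i)) r)\<^sup>2) \<partial>lborel)" if i: "i < n" for i
      proof -
        have pos: "0 < t / 2 / real n" using t n by simp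
        have 1: "2 powr (- \<bar>\<alpha> + \<beta>\<bar>) * t powr (\<alpha> + \<beta>) \<le> u i powr (\<alpha> + \<beta>)"
          using u_pos[of i] u_le[of i] i t by (intro powr_comparable) auto
        have "v = c * (2 powr (- \<bar>\<alpha> + \<beta>\<bar>) * t powr (\<alpha> + \<beta>)) * (u (Suc i) - u i) powr (\<gamma> + 3/2)"
        proof -
          have "(t / 2 / real n) powr \<tau> = t powr \<tau> * (1/2) powr \<tau> * real n powr (- \<tau>)"
          proof -
            have "t / 2 / real n = t * (1/2) * inverse (real n)" by (simp add: field_simps)
            moreover have "inverse (real n) powr \<tau> = real n powr (- \<tau>)" by (simp only: powr_minus inverse_powr)
            ultimately show ?thesis by (simp only: powr_mult)
          qed
          then show ?thesis
            unfolding u_diff v_def c'_def H_split \<tau>_def[symmetric] powr_add[of t "\<alpha> + \<beta>"] by (simp only: mult_ac)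
        qed
        also have "\<dots> \<le> c * u i powr (\<alpha> + \<beta>) * (u (Suc i) - u i) powr (\<gamma> + 3/2)"
          using 1 c by (intro mult_right_mono mult_left_mono) auto
        finally have "v\<^sup>2 \<le> (c * u i powr (\<alpha> + \<beta>) * (u (Suc i) - u i) powr (\<gamma> + 3/2))\<^sup>2"
          using v by (intro power_mono) auto
        then have "ennreal (v\<^sup>2) \<le> ennreal ((c * u i powr (\<alpha> + \<beta>) * (u (Suc i) - u i) powr (\<gamma> + 3/2))\<^sup>2)"
          by (rule ennreal_leI)
        also have "\<dots> \<le> (\<integral>\<^sup>+r\<in>{u i<..u (Suc i)}. ennreal ((K (u (Suc i)) r)\<^sup>2) \<partial>lborel)"
        proof (rule c(2))
          show "0 < u i" using u_pos[of i] t by linarith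
          show "u i < u (Suc i)" using u_diff[of i] pos by linarith
          show "u (Suc i) \<le> 2 * u i" using u_le[of "Suc i"] u_pos[of i] i by simp
        qed
        finally show ?thesis .
      qed
    qed (use v \<epsilon> in auto)
    also have "\<dots> \<le> q ^ n"
    proof (rule power_mono)
      have "real n powr \<tau> \<le> (2 * R) powr \<tau>" using n \<tau> by (intro powr_mono2) auto
      also have "\<dots> = 2 powr \<tau> * (t powr H / \<epsilon>)"
        using \<tau> \<epsilon> by (simp add: R_def powr_mult powr_powr)
      finally have "4 * \<epsilon> / v \<le> 4 * 2 powr \<tau> / c'"
        using t \<epsilon> c' n by (simp add: v_def powr_minus field_simps)
      then have "measure \<N> {..4 * \<epsilon> / v} \<le> measure \<N> {..4 * 2 powr \<tau> / c'}"
        by (intro finite_measure.finite_measure_mono prob_space.finite_measure prob_space_std_normal) auto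
      then show "measure \<N> {..4 * \<epsilon> / v} \<le> q" by (simp add: q_def)
    qed simp
    also have "\<dots> = exp (real n * ln q)" using q by (simp add: exp_of_nat_mult)
    also have "\<dots> \<le> exp (- (- ln q) * R)"
      using n q by (simp add: mult.commute mult_le_cancel_left)
    finally have le: "measure M {\<omega>\<in>space M. \<forall>i<n. \<bar>X (u (Suc i)) \<omega>\<bar> \<le> \<epsilon>} \<le> exp (- (- ln q) * R)" .
    have "prob (small_ball t \<epsilon>) \<le> prob {\<omega>\<in>space M. \<forall>i<n. \<bar>X (u (Suc i)) \<omega>\<bar> \<le> \<epsilon>}"
    proof (rule finite_measure_mono)
      show "small_ball t \<epsilon> \<subseteq> {\<omega>\<in>space M. \<forall>i<n. \<bar>X (u (Suc i)) \<omega>\<bar> \<le> \<epsilon>}"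
      proof safe
        fix \<omega> i assume \<omega>: "\<omega> \<in> small_ball t \<epsilon>" and i: "i < n"
        then have "\<omega> \<in> space M" by (simp add: small_ball_def)
        then have "continuous_on {0..} (\<lambda>s. X s \<omega>)" using vp by (simp add: gaussian_volterra_process_def)
        then have "continuous_on {0..t} (\<lambda>s. X s \<omega>)" by (rule continuous_on_subset) auto
        then have "continuous_on {0..t} (\<lambda>s. \<bar>X s \<omega>\<bar>)" by (rule continuous_on_rabs)
        then have "bdd_above ((\<lambda>s. \<bar>X s \<omega>\<bar>) ` {0..t})"
          by (intro bounded_imp_bdd_above compact_imp_bounded compact_continuous_image) simp_all
        moreover have "u (Suc i) \<in> {0..t}" using u_le[of "Suc i"] u_pos[of "Suc i"] i t by simp
        ultimately have "\<bar>X (u (Suc i)) \<omega>\<bar> \<le> (SUP s\<in>{0..t}. \<bar>X s \<omega>\<bar>)" by (intro cSUP_upper)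
        then show "\<bar>X (u (Suc i)) \<omega>\<bar> \<le> \<epsilon>" using \<omega> by (simp add: small_ball_def)
      qed (simp add: small_ball_def)
      have "X (u (Suc i)) \<in> borel_measurable M" for i using u_pos[of "Suc i"] t by (intro X_measurable) linarith
      then show "{\<omega>\<in>space M. \<forall>i<n. \<bar>X (u (Suc i)) \<omega>\<bar> \<le> \<epsilon>} \<in> sets M" by measurable
    qed
    then show "prob (small_ball t \<epsilon>) \<le> exp (- (- ln q) * (t powr H / \<epsilon>) powr (1 / \<tau>))"
      using le by (simp add: R_def)
  qed
qed

section \<open>Lower bound by chaining\<close>

text \<open>On level 0 there is no coarser point and the increment is the value itself, so every
  block is chained separately. On finer levels a point with even \<open>i\<close> coincides with its
  coarser neighbour and the increment vanishes.\<close>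

definition inc_kernel :: "real \<Rightarrow> nat \<Rightarrow> nat \<Rightarrow> nat \<Rightarrow> real \<Rightarrow> real" where
  "inc_kernel t m j i r = K (dyadic_pt t m j i) r - (if j = 0 then 0 else K (dyadic_pt t m (j - 1) (i div 2)) r)"

definition inc_X :: "real \<Rightarrow> nat \<Rightarrow> nat \<Rightarrow> nat \<Rightarrow> 'a \<Rightarrow> real" where
  "inc_X t m j i \<omega> = X (dyadic_pt t m j i) \<omega> - (if j = 0 then 0 else X (dyadic_pt t m (j - 1) (i div 2)) \<omega>)"

lemma wapprox_inc:
  assumes t: "0 < t" and i: "i < 2 ^ j"
  shows "wapprox M W t (inc_kernel t m j i) (inc_X t m j i)"
proof -
  have 1: "wapprox M W t (K (dyadic_pt t m j i)) (X (dyadic_pt t m j i))"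
    using dyadic_pt_bounds[OF t i] by (intro wapprox_X) auto
  show ?thesis
  proof (cases j)
    case 0
    then show ?thesis using 1 unfolding inc_kernel_def[abs_def] inc_X_def[abs_def] by simp
  next
    case (Suc j')
    then have i': "i div 2 < 2 ^ j'" using i by auto
    have "wapprox M W t (K (dyadic_pt t m j' (i div 2))) (X (dyadic_pt t m j' (i div 2)))"
      using dyadic_pt_bounds[OF t i'] by (intro wapprox_X) auto
    from wapprox_diff[OF bm 1 this] show ?thesis
      unfolding inc_kernel_def[abs_def] inc_X_def[abs_def] using Suc by simp
  qed
qed

text \<open>Finiteness at time 1 is part of the definition of the Wiener integral, and scaling
  carries it to all times. The added 1 makes the constant positive.\<close>

lemma kernel_variance:
  obtains C where "0 < C" "\<And>t. 0 < t \<Longrightarrow> (sqint lborel (\<lambda>r. K t r)) \<le> ennreal ((C * t powr H)\<^sup>2)"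
proof -
  define I where "I = (sqint lborel (\<lambda>r. K 1 r))"
  have "set_integrable lborel {0..1} (\<lambda>r. (volterra_kernel \<alpha> \<beta> \<gamma> 1 r)\<^sup>2)"
    using vp by (auto simp: gaussian_volterra_process_def has_wiener_integral_def)
  then have "(\<integral>\<^sup>+r. ennreal (norm (indicator {0..1} r *\<^sub>R (volterra_kernel \<alpha> \<beta> \<gamma> 1 r)\<^sup>2)) \<partial>lborel) < \<infinity>"
    unfolding set_integrable_def integrable_iff_bounded by blast
  also have "(\<integral>\<^sup>+r. ennreal (norm (indicator {0..1} r *\<^sub>R (volterra_kernel \<alpha> \<beta> \<gamma> 1 r)\<^sup>2)) \<partial>lborel) = I"
    unfolding I_def by (intro nn_integral_cong) (auto simp: kernel_ext_def indicator_def)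
  finally have fin: "I < \<infinity>" .
  define C where "C = sqrt (enn2real I) + 1"
  have C: "0 < C" by (simp add: C_def add_nonneg_pos)
  have "enn2real I = (sqrt (enn2real I))\<^sup>2" by simp
  also have "\<dots> \<le> C\<^sup>2" unfolding C_def by (intro power_mono) auto
  finally have "ennreal (enn2real I) \<le> ennreal (C\<^sup>2)" by (rule ennreal_leI)
  moreover have "ennreal (enn2real I) = I" using fin by (intro ennreal_enn2real) simp
  ultimately have IC: "I \<le> ennreal (C\<^sup>2)" by (simp only:)
  show ?thesis
  proof (rule that[OF C])
    fix t :: real assume t: "0 < t"
    have "K t \<in> borel_measurable borel" using wapprox_X[OF t order_refl] by (simp add: wapprox_def)
    then have "(sqint lborel (\<lambda>r. K t r)) = ennreal ((t powr H)\<^sup>2) * I"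
      unfolding I_def H_def by (rule kernel_ext_scale[OF t])
    also have "\<dots> \<le> ennreal ((t powr H)\<^sup>2) * ennreal (C\<^sup>2)" by (intro mult_left_mono IC) auto
    also have "\<dots> = ennreal ((C * t powr H)\<^sup>2)" by (simp add: power_mult_distrib mult.commute flip: ennreal_mult)
    finally show "(sqint lborel (\<lambda>r. K t r)) \<le> ennreal ((C * t powr H)\<^sup>2)" .
  qed
qed

text \<open>Level 0 uses the variance of \<open>X\<close> itself, with \<open>H > 0\<close> to
  replace the point by the right end of its block. On finer levels odd \<open>i\<close> contribute
  over the distance \<open>t / 2 ^ m / 2 ^ Suc j\<close>, and the powers \<alpha> + \<beta> and
  \<tau> of the block length add up to \<open>H\<close>.\<close>

lemma inc_variance:
  obtains C where "0 < C" "\<And>t m j i. 0 < t \<Longrightarrow> i < 2 ^ j \<Longrightarrow>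
     (sqint lborel (\<lambda>r. inc_kernel t m j i r)) \<le> ennreal ((C * (t / 2 ^ m) powr H * (2 ^ j) powr (- \<tau>))\<^sup>2)"
proof -
  obtain C1 where C1: "0 < C1" "\<And>t. 0 < t \<Longrightarrow> (sqint lborel (\<lambda>r. K t r)) \<le> ennreal ((C1 * t powr H)\<^sup>2)"
    by (rule kernel_variance) blast
  obtain C2 where C2: "0 < C2" "\<And>s t. 0 < s \<Longrightarrow> s < t \<Longrightarrow> t \<le> 2 * s \<Longrightarrow>
     (sqint lborel (\<lambda>r. K t r - K s r)) \<le> ennreal ((C2 * s powr (\<alpha> + \<beta>) * (t - s) powr (\<gamma> + 3/2))\<^sup>2)"
    by (rule kernel_ext_increment[OF \<alpha> \<gamma>]) blast
  define C where "C = C1 + C2 * 2 powr \<bar>\<alpha> + \<beta>\<bar>"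
  have C: "0 < C" using C1 C2 by (simp add: C_def add_pos_pos)
  show ?thesis
  proof (rule that[OF C])
    fix t :: real and m j i :: nat assume t: "0 < t" and i: "i < 2 ^ j"
    define y where "y = t / 2 ^ m"
    have y: "0 < y" using t by (simp add: y_def)
    show "(sqint lborel (\<lambda>r. inc_kernel t m j i r)) \<le> ennreal ((C * (t / 2 ^ m) powr H * (2 ^ j) powr (- \<tau>))\<^sup>2)"
      unfolding y_def[symmetric]
    proof (cases j)
      case 0
      define p where "p = dyadic_pt t m j i"
      have p: "0 < p" "p \<le> y" using dyadic_pt_bounds[OF t i, of m] by (auto simp: p_def y_def)
      have "(sqint lborel (\<lambda>r. inc_kernel t m j i r)) \<le> ennreal ((C1 * p powr H)\<^sup>2)"
        using C1(2)[OF p(1)] 0 by (simp add: inc_kernel_def p_def)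
      also have "\<dots> \<le> ennreal ((C * y powr H * (2 ^ j) powr (- \<tau>))\<^sup>2)"
      proof (intro ennreal_leI power_mono)
        have "p powr H \<le> y powr H" using p H_pos by (intro powr_mono2) auto
        then have "C1 * p powr H \<le> C * y powr H" using C1 C2 by (intro mult_mono) (auto simp: C_def)
        then show "C1 * p powr H \<le> C * y powr H * (2 ^ j) powr (- \<tau>)" using 0 by simp
      qed (use C1 in auto)
      finally show "(sqint lborel (\<lambda>r. inc_kernel t m j i r)) \<le> ennreal ((C * y powr H * (2 ^ j) powr (- \<tau>))\<^sup>2)" .
    next
      case (Suc j')
      define s where "s = dyadic_pt t m j' (i div 2)"
      have i': "i div 2 < 2 ^ j'" using i Suc by auto
      have s: "y / 2 \<le> s" "s \<le> y" "0 < s" using dyadic_pt_bounds[OF t i', of m] by (auto simp: s_def y_def)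
      have kern: "inc_kernel t m j i r = K (dyadic_pt t m j i) r - K s r" for r
        using Suc by (simp add: inc_kernel_def s_def)
      show "(sqint lborel (\<lambda>r. inc_kernel t m j i r)) \<le> ennreal ((C * y powr H * (2 ^ j) powr (- \<tau>))\<^sup>2)"
      proof (cases "even i")
        case True
        then have "real (i div 2) / 2 ^ j' = real i / 2 ^ j" using Suc by (auto elim!: evenE)
        then have "dyadic_pt t m j i = s" by (simp add: s_def dyadic_pt_def)
        then show ?thesis by (simp add: kern)
      next
        case False
        then obtain k where k: "i = 2 * k + 1" by (auto elim: oddE)
        define h where "h = y / 2 * (1 / 2 ^ j)"
        have h: "0 < h" using y by (simp add: h_def)
        have p: "dyadic_pt t m j i = s + h"
          using Suc k by (simp add: s_def h_def y_def dyadic_pt_def field_simps)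
        have "h \<le> y / 2 * 1" unfolding h_def using y by (intro mult_left_mono) auto
        then have hs: "h \<le> s" using s by simp
        have "(sqint lborel (\<lambda>r. inc_kernel t m j i r)) \<le> ennreal ((C2 * s powr (\<alpha> + \<beta>) * h powr \<tau>)\<^sup>2)"
          using C2(2)[of s "s + h"] s h hs by (simp add: kern p \<tau>_def)
        also have "\<dots> \<le> ennreal ((C * y powr H * (2 ^ j) powr (- \<tau>))\<^sup>2)"
        proof (intro ennreal_leI power_mono)
          have 1: "s powr (\<alpha> + \<beta>) \<le> 2 powr \<bar>\<alpha> + \<beta>\<bar> * y powr (\<alpha> + \<beta>)"
            using s y by (intro powr_comparable) auto
          have "h \<le> y * (1 / 2 ^ j)" unfolding h_def using y by (intro mult_right_mono) auto
          then have "h powr \<tau> \<le> (y * (1 / 2 ^ j)) powr \<tau>" using h \<tau> by (intro powr_mono2) auto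
          also have "\<dots> = y powr \<tau> * (2 ^ j) powr (- \<tau>)"
            by (simp only: powr_mult powr_divide powr_minus divide_inverse inverse_powr powr_one_eq_one mult_1)
          finally have 2: "h powr \<tau> \<le> y powr \<tau> * (2 ^ j) powr (- \<tau>)" .
          have "C2 * s powr (\<alpha> + \<beta>) * h powr \<tau> \<le> C2 * (2 powr \<bar>\<alpha> + \<beta>\<bar> * y powr (\<alpha> + \<beta>)) * (y powr \<tau> * (2 ^ j) powr (- \<tau>))"
            using 1 2 C2 by (intro mult_mono) auto
          also have "\<dots> = (C2 * 2 powr \<bar>\<alpha> + \<beta>\<bar>) * (y powr H * (2 ^ j) powr (- \<tau>))"
            unfolding H_split powr_add[of y "\<alpha> + \<beta>"] by (simp only: mult_ac)
          also have "\<dots> \<le> C * (y powr H * (2 ^ j) powr (- \<tau>))"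
            using C1 by (intro mult_right_mono) (auto simp: C_def)
          finally show "C2 * s powr (\<alpha> + \<beta>) * h powr \<tau> \<le> C * y powr H * (2 ^ j) powr (- \<tau>)" by (simp only: mult.assoc)
        qed (use C2 in auto)
        finally show ?thesis .
      qed
    qed
  qed
qed

text \<open>Chaining along \<open>inc_X\<close>: with \<open>z = 2\<^sup>j z\<^sub>0\<close> and \<open>z\<^sub>0 = ((\<epsilon> / t\<^sup>H) 2\<^sup>m\<^sup>H)\<^sup>1\<^sup>/\<^sup>\<tau>\<close>, the standard deviation at level
  \<open>(m, j)\<close> is of order \<open>\<epsilon> z\<^sup>-\<^sup>\<tau>\<close>, and the threshold there is chosen as \<open>\<epsilon> min (z\<^sup>\<tau>\<^sup>/\<^sup>2) (z\<^sup>-\<^sup>\<tau>\<^sup>/\<^sup>2)\<close> up to a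
  constant.\<close>

lemma small_ball_lower:
  obtains \<kappa> where "0 < \<kappa>"
    "\<And>t \<epsilon>. 0 < t \<Longrightarrow> 0 < \<epsilon> \<Longrightarrow> exp (- \<kappa> * (t powr H / \<epsilon>) powr (1 / \<tau>)) \<le> prob (small_ball t \<epsilon>)"
proof -
  obtain C where C: "0 < C" "\<And>t m j i. 0 < t \<Longrightarrow> i < 2 ^ j \<Longrightarrow>
     (sqint lborel (\<lambda>r. inc_kernel t m j i r)) \<le> ennreal ((C * (t / 2 ^ m) powr H * (2 ^ j) powr (- \<tau>))\<^sup>2)"
    by (rule inc_variance) blast
  obtain B where B: "0 < B" "\<And>z J. 0 < z \<Longrightarrow> (\<Sum>j<J. decay (\<tau>/2) (2 ^ j * z)) \<le> B"
    by (rule sum_decay_bounded[of "\<tau>/2"]) (use \<tau> in auto)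
  obtain B' where B': "0 < B'" "\<And>z J. 0 < z \<Longrightarrow> (\<Sum>j<J. decay (1/2) (2 ^ j * z)) \<le> B'"
    by (rule sum_decay_bounded[of "1/2"]) auto
  \<comment> \<open>Collects the constants of threshold and deviation with the 4 of
    \<open>wiener_small_ball_lower\<close>, as the equation \<open>ratio\<close> shows.\<close>
  define c where "c = 1 / (B * 4 * C)"
  have c: "0 < c" using B C by (simp add: c_def)
  obtain D where D: "0 < D" "\<And>z. 0 < z \<Longrightarrow> exp (- D * (decay (1/2) z / z)) \<le> central_prob (c * z powr \<tau> * decay (\<tau>/2) z)"
    by (rule central_prob_decay[OF less_imp_le[OF \<tau>(1)] less_imp_le[OF \<tau>(2)] c]) blast
  \<comment> \<open>Passing to the next smaller block multiplies the cost by \<open>\<rho>\<close>,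
    which is below 1 because \<open>H > 0\<close>; \<open>1 / (1 - \<rho>)\<close> in
    \<open>\<kappa>\<close> sums over the blocks.\<close>
  define \<rho> where "\<rho> = 2 powr (- H / \<tau>)"
  have \<rho>: "0 < \<rho>" "\<rho> < 1" using H_pos \<tau> powr_less_mono[of "- H / \<tau>" 0 2] by (auto simp: \<rho>_def)
  define \<kappa> where "\<kappa> = D * B' / (1 - \<rho>)"
  have \<kappa>: "0 < \<kappa>" using D B' \<rho> by (simp add: \<kappa>_def)
  show ?thesis
  proof (rule that[OF \<kappa>])
    fix t \<epsilon> :: real assume t: "0 < t" and \<epsilon>: "0 < \<epsilon>"
    define R where "R = (t powr H / \<epsilon>) powr (1 / \<tau>)"
    have R: "0 < R" using t \<epsilon> by (simp add: R_def)
    have R\<tau>: "R powr \<tau> = t powr H / \<epsilon>" using t \<epsilon> \<tau> by (simp add: R_def powr_powr)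
    \<comment> \<open>The reciprocal \<open>R * \<rho> ^ m\<close> is the cost of block
      \<open>m\<close> up to constants.\<close>
    define z where "z m = 1 / (R * \<rho> ^ m)" for m :: nat
    have z: "0 < z m" for m using R \<rho> by (simp add: z_def)
    have z\<tau>: "z m powr \<tau> = \<epsilon> / (t / 2 ^ m) powr H" for m
    proof -
      have "(\<rho> ^ m) powr \<tau> = (\<rho> powr real m) powr \<tau>"
        using \<rho> by (simp add: powr_realpow)
      also have "\<dots> = 2 powr (- (real m * H))"
        using \<tau> by (simp add: \<rho>_def powr_powr mult.commute)
      also have "\<dots> = 1 / (2 powr real m) powr H"
        by (simp add: powr_powr powr_minus_divide)
      also have "(2::real) powr real m = 2 ^ m" by (simp add: powr_realpow)
      finally have "(\<rho> ^ m) powr \<tau> = 1 / (2 ^ m) powr H" .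
      then show ?thesis using t by (simp add: z_def powr_divide powr_mult R\<tau>)
    qed
    define a where "a m j = \<epsilon> / B * decay (\<tau>/2) (2 ^ j * z m)" for m j
    define \<sigma> where "\<sigma> m j = C * (t / 2 ^ m) powr H * (2 ^ j) powr (- \<tau>)" for m j :: nat
    have a: "0 < a m j" for m j using \<epsilon> B z by (simp add: a_def decay_pos)
    have \<sigma>: "0 < \<sigma> m j" for m j using C t by (simp add: \<sigma>_def)
    have ratio: "a m j / (4 * \<sigma> m j) = c * (2 ^ j * z m) powr \<tau> * decay (\<tau>/2) (2 ^ j * z m)" for m j
    proof -
      have "(2 ^ j * z m) powr \<tau> = \<epsilon> / (t / 2 ^ m) powr H * (2 ^ j) powr \<tau>"
        using z by (simp add: powr_mult z\<tau>)
      then show ?thesis using C B t by (simp add: a_def \<sigma>_def c_def powr_minus field_simps)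
    qed
    have a_sum: "(\<Sum>j<J. a m j) \<le> \<epsilon>" for m J
    proof -
      have "(\<Sum>j<J. a m j) = \<epsilon> / B * (\<Sum>j<J. decay (\<tau>/2) (2 ^ j * z m))"
        by (simp add: a_def sum_distrib_left)
      also have "\<dots> \<le> \<epsilon> / B * B" using \<epsilon> B z by (intro mult_left_mono) auto
      finally show ?thesis using B by simp
    qed
    \<comment> \<open>Sidak's inequality takes finitely many events, so blocks and levels are cut
      off at \<open>n\<close>; the bound obtained does not depend on \<open>n\<close>.\<close>
    define A where "A n = {\<omega>\<in>space M. \<forall>(m, j, i)\<in>(SIGMA m:{..<n}. SIGMA j:{..<n}. {..<2 ^ j}). \<bar>inc_X t m j i \<omega>\<bar> \<le> a m j}" for n :: nat
    have meas: "inc_X t m j i \<in> borel_measurable M" if "i < 2 ^ j" for m j i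
      using wapprox_inc[OF t that] by (simp add: wapprox_def)
    have A_sets: "A n \<in> sets M" for n
      unfolding A_def
    proof (intro sets.sets_Collect_finite_All)
      fix x assume x: "x \<in> (SIGMA m:{..<n}. SIGMA j:{..<n}. {..<2 ^ j :: nat})"
      obtain m j i where "x = (m, j, i)" by (cases x)
      moreover have "{\<omega> \<in> space M. \<bar>inc_X t m j i \<omega>\<bar> \<le> a m j} \<in> sets M"
        using x meas[of i j m] calculation by auto
      ultimately show "{\<omega> \<in> space M. case x of (m, j, i) \<Rightarrow> \<bar>inc_X t m j i \<omega>\<bar> \<le> a m j} \<in> sets M" by simp
    qed auto
    have A_prob: "exp (- \<kappa> * R) \<le> prob (A n)" for n
    proof -
      define I where "I = (SIGMA m:{..<n}. SIGMA j:{..<n}. {..<2 ^ j :: nat})"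
      have fin: "finite I" by (simp add: I_def)
      have "D * (B' * (\<Sum>m<n. R * \<rho> ^ m)) \<le> \<kappa> * R"
      proof -
        have "(\<Sum>m<n. R * \<rho> ^ m) = R * (\<Sum>m<n. \<rho> ^ m)" by (simp add: sum_distrib_left)
        also have "(\<Sum>m<n. \<rho> ^ m) = (1 - \<rho> ^ n) / (1 - \<rho>)"
          using \<rho> by (simp add: sum_gp_strict)
        also have "\<dots> \<le> 1 / (1 - \<rho>)" using \<rho> by (intro divide_right_mono) auto
        finally have "(\<Sum>m<n. R * \<rho> ^ m) \<le> R * (1 / (1 - \<rho>))" using R by simp
        then have "D * (B' * (\<Sum>m<n. R * \<rho> ^ m)) \<le> D * (B' * (R * (1 / (1 - \<rho>))))"
          using D B' by (intro mult_left_mono) auto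
        then show ?thesis by (simp add: \<kappa>_def mult_ac)
      qed
      moreover have "(\<Sum>(m, j, i)\<in>I. D * (decay (1/2) (2 ^ j * z m) / (2 ^ j * z m))) \<le> D * (B' * (\<Sum>m<n. R * \<rho> ^ m))"
      proof -
        have "(\<Sum>(m, j, i)\<in>I. D * (decay (1/2) (2 ^ j * z m) / (2 ^ j * z m)))
           = (\<Sum>m<n. \<Sum>j<n. \<Sum>i<(2::nat) ^ j. D * (decay (1/2) (2 ^ j * z m) / (2 ^ j * z m)))"
        proof -
          define G where "G m j i = D * (decay (1/2) (2 ^ j * z m) / (2 ^ j * z m))" for m j and i :: nat
          have "(\<Sum>(m, j, i)\<in>I. G m j i) = (\<Sum>m<n. \<Sum>(j, i)\<in>(SIGMA j:{..<n}. {..<2 ^ j}). G m j i)"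
            unfolding I_def by (rule sum.Sigma[symmetric]) auto
          also have "\<dots> = (\<Sum>m<n. \<Sum>j<n. \<Sum>i<(2::nat) ^ j. G m j i)"
            by (intro sum.cong refl sum.Sigma[symmetric]) auto
          finally show ?thesis unfolding G_def .
        qed
        \<comment> \<open>The \<open>2 ^ j\<close> equal summands over \<open>i\<close> cancel
          \<open>2 ^ j\<close> in the denominator, and \<open>1 / z m\<close> comes out as
          \<open>R * \<rho> ^ m\<close>.\<close>
        also have "\<dots> = (\<Sum>m<n. D * (R * \<rho> ^ m * (\<Sum>j<n. decay (1/2) (2 ^ j * z m))))"
          by (simp add: z_def sum_distrib_left mult_ac)
        also have "\<dots> \<le> (\<Sum>m<n. D * (R * \<rho> ^ m * B'))"
          using D R \<rho> by (intro sum_mono mult_left_mono B' z) auto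
        also have "\<dots> = D * (B' * (\<Sum>m<n. R * \<rho> ^ m))"
          by (simp add: sum_distrib_left mult_ac)
        finally show ?thesis .
      qed
      ultimately have "exp (- \<kappa> * R) \<le> exp (- (\<Sum>(m, j, i)\<in>I. D * (decay (1/2) (2 ^ j * z m) / (2 ^ j * z m))))"
        by simp
      also have "\<dots> = (\<Prod>(m, j, i)\<in>I. exp (- D * (decay (1/2) (2 ^ j * z m) / (2 ^ j * z m))))"
        using fin by (simp add: exp_sum case_prod_unfold flip: sum_negf)
      also have "\<dots> \<le> (\<Prod>(m, j, i)\<in>I. central_prob (a m j / (4 * \<sigma> m j)))"
        unfolding ratio using D(2) z by (intro prod_mono) auto
      also have "\<dots> = (\<Prod>x\<in>I. measure \<N> {y. \<bar>y\<bar> \<le> (case x of (m, j, i) \<Rightarrow> a m j) / (4 * (case x of (m, j, i) \<Rightarrow> \<sigma> m j))})"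
        by (intro prod.cong) (auto simp: central_prob_def)
      also have "\<dots> \<le> prob {\<omega>\<in>space M. \<forall>x\<in>I. \<bar>(case x of (m, j, i) \<Rightarrow> inc_X t m j i) \<omega>\<bar> \<le> (case x of (m, j, i) \<Rightarrow> a m j)}"
      proof (rule wiener_small_ball_lower[OF bm fin, where T=t and f="\<lambda>x. case x of (m, j, i) \<Rightarrow> inc_kernel t m j i"])
        fix x assume "x \<in> I"
        then obtain m j i where x: "x = (m, j, i)" "i < 2 ^ j" by (auto simp: I_def)
        show "wapprox M W t (case x of (m, j, i) \<Rightarrow> inc_kernel t m j i) (case x of (m, j, i) \<Rightarrow> inc_X t m j i)"
          using wapprox_inc[OF t x(2)] by (simp add: x(1))
        show "(sqint lborel (\<lambda>r. (case x of (m, j, i) \<Rightarrow> inc_kernel t m j i) r)) \<le> ennreal ((case x of (m, j, i) \<Rightarrow> \<sigma> m j)\<^sup>2)"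
          using C(2)[OF t x(2)] by (simp add: x(1) \<sigma>_def)
      qed (use a \<sigma> in \<open>auto split: prod.split\<close>)
      also have "\<dots> = prob (A n)"
        unfolding A_def I_def by (intro arg_cong[where f=prob]) auto
      finally show ?thesis .
    qed
    have "decseq A" unfolding decseq_def A_def by fastforce
    then have lim: "(\<lambda>n. prob (A n)) \<longlonglongrightarrow> prob (\<Inter>n. A n)"
      using A_sets by (intro finite_Lim_measure_decseq) auto
    have "exp (- \<kappa> * R) \<le> prob (\<Inter>n. A n)"
      using A_prob by (intro LIMSEQ_le_const[OF lim]) auto
    also have "\<dots> \<le> prob (small_ball t \<epsilon>)"
    proof (rule finite_measure_mono[OF _ small_ball_sets[OF t]])
      show "(\<Inter>n. A n) \<subseteq> small_ball t \<epsilon>"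
      proof
        fix \<omega> assume \<omega>: "\<omega> \<in> (\<Inter>n. A n)"
        have "\<omega> \<in> A 0" using \<omega> by blast
        then have sp: "\<omega> \<in> space M" by (simp add: A_def)
        have inc: "\<bar>inc_X t m j i \<omega>\<bar> \<le> a m j" if "i < 2 ^ j" for m j i
        proof -
          have "\<omega> \<in> A (Suc (max m j))" using \<omega> by blast
          then show ?thesis using that by (auto simp: A_def less_Suc_eq_le)
        qed
        \<comment> \<open>Following the ancestors \<open>i div 2\<close> up to level 0 telescopes,
          where the value itself counts as an increment; \<open>a_sum\<close> then bounds the total
          by \<epsilon>.\<close>
        have "\<bar>X (dyadic_pt t m j i) \<omega>\<bar> \<le> (\<Sum>k<Suc j. a m k)" if "i < 2 ^ j" for m j i
          using that
        proof (induction j arbitrary: i)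
          case 0
          then show ?case using inc[OF 0, of m] by (simp add: inc_X_def)
        next
          case (Suc j)
          have "i div 2 < 2 ^ j" using Suc.prems by auto
          from Suc.IH[OF this] inc[OF Suc.prems, of m] show ?case
            by (simp add: inc_X_def)
        qed
        then have "\<bar>X (dyadic_pt t m j i) \<omega>\<bar> \<le> \<epsilon>" if "i < 2 ^ j" for m j i
          using that a_sum[of m "Suc j"] order_trans by blast
        then show "\<omega> \<in> small_ball t \<epsilon>" using sp by (simp add: small_ball_eq[OF t])
      qed
    qed
    finally show "exp (- \<kappa> * (t powr H / \<epsilon>) powr (1 / \<tau>)) \<le> prob (small_ball t \<epsilon>)" by (simp add: R_def)
  qed
qed

end

theorem theorem1p1:
  fixes \<alpha> \<beta> \<gamma> H :: real
    and M :: "'a measure"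
    and W X :: "real \<Rightarrow> 'a \<Rightarrow> real"
  assumes "\<alpha> > - 1/2"
    and "\<gamma> \<in> {-1 <..< - 1/2}"
    and "H = \<alpha> + \<beta> + \<gamma> + 3/2"
    and "H > 0"
    and "standard_brownian_motion M W"
    and "gaussian_volterra_process M W \<alpha> \<beta> \<gamma> X"
  shows "\<exists>\<kappa>\<^sub>1 > 0. \<exists>\<kappa>\<^sub>2 > 0. \<forall>t > 0. \<forall>\<epsilon>. 0 < \<epsilon> \<and> \<epsilon> < t powr H \<longrightarrow>
      exp (- \<kappa>\<^sub>1 * (t powr H / \<epsilon>) powr (2 / (2 * \<gamma> + 3)))
        \<le> measure M {\<omega> \<in> space M. (SUP s\<in>{0..t}. \<bar>X s \<omega>\<bar>) \<le> \<epsilon>} \<and>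
      measure M {\<omega> \<in> space M. (SUP s\<in>{0..t}. \<bar>X s \<omega>\<bar>) \<le> \<epsilon>}
        \<le> exp (- \<kappa>\<^sub>2 * (t powr H / \<epsilon>) powr (2 / (2 * \<gamma> + 3)))"
proof -
  interpret volterra \<alpha> \<beta> \<gamma> H M W X
    using assms by unfold_locales auto
  have e: "2 / (2 * \<gamma> + 3) = 1 / \<tau>" using \<gamma> by (simp add: \<tau>_def field_simps)
  obtain \<kappa>1 where "0 < \<kappa>1"
    "\<And>t \<epsilon>. 0 < t \<Longrightarrow> 0 < \<epsilon> \<Longrightarrow> exp (- \<kappa>1 * (t powr H / \<epsilon>) powr (1 / \<tau>)) \<le> prob (small_ball t \<epsilon>)"
    by (rule small_ball_lower) blast
  moreover obtain \<kappa>2 where "0 < \<kappa>2"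
    "\<And>t \<epsilon>. 0 < t \<Longrightarrow> 0 < \<epsilon> \<Longrightarrow> \<epsilon> < t powr H \<Longrightarrow> prob (small_ball t \<epsilon>) \<le> exp (- \<kappa>2 * (t powr H / \<epsilon>) powr (1 / \<tau>))"
    by (rule small_ball_upper) blast
  ultimately show ?thesis unfolding e small_ball_def
    by (intro exI[of _ \<kappa>1] exI[of _ \<kappa>2] conjI allI impI) auto
qed

end
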